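(* Let $P,P'\in M_n(\Bbbk[[\hbar]])$ be two matrices of Cartan type with the same associated Cartan matrix $A$. (a) Let $\mathcal R$ be a straight realization of $P$ of rank $t$, with associated FoMpQUEA $U^{\mathcal R}_{P,\hbar}(\mathfrak g)$. Then there exist a straight realization $\check{\mathcal R}'$ of $P'$ (of the same rank) and a matrix $\Phi\in\mathfrak{so}_t(\Bbbk[[\hbar]])$ such that, for the associated toral twist $\mathcal F_\Phi$, $U^{\check{\mathcal R}'}_{P',\hbar}(\mathfrak g)\cong\big(U^{\mathcal R}_{P,\hbar}(\mathfrak g)\big)^{\mathcal F_\Phi}$ as topological Hopf algebras. Conversely, if $\mathcal R'$ is any straight realization of $P'$, of rank $t$, then there exist a straight realization $\hat{\mathcal R}$ of $P$ and $\Phi\in\mathfrak{so}_t(\Bbbk[[\hbar]])$ such that $U^{\mathcal R'}_{P',\hbar}(\mathfrak g)\cong\big(U^{\hat{\mathcal R}}_{P,\hbar}(\mathfrak g)\big)^{\mathcal F_\Phi}$. (b) Let $\mathcal R$ and $\mathcal R'$ be straight small realizations of $P$ and $P'$ respectively, with $\mathrm{rk}(\mathcal R)=\mathrm{rk}(\mathcal R')=t$. Then there exists $\Phi\in\mathfrak{so}_t(\Bbbk[[\hbar]])$ such that $U^{\mathcal R'}_{P',\hbar}(\mathfrak g)\cong\big(U^{\mathcal R}_{P,\hbar}(\mathfrak g)\big)^{\mathcal F_\Phi}$. (c) Every straight small FoMpQUEA over a matrix $P$ of Cartan type is isomorphic to some toral twist deformation of Drinfeld's standard FoMpQUEA over $DA=\frac12(P+P^T)$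 of the same rank, i.e. of the FoMpQUEA attached to a straight small realization of $DA$ of that rank in which $T_i^+=T_i^-$ for all $i\in I$. (d) Statements (a), (b), (c) also hold with every FoMpQUEA $U^{\mathcal R}_{P,\hbar}(\mathfrak g)$ replaced throughout by its positive Borel subalgebra $U^{\mathcal R}_{P,\hbar}(\mathfrak b_+)$, respectively by its negative Borel subalgebra $U^{\mathcal R}_{P,\hbar}(\mathfrak b_-)$.
   Context: $\Bbbk$ is a field of characteristic zero, $n\ge1$, $I=\{1,\dots,n\}$. $A=(a_{ij})$ is a symmetrizable generalized Cartan matrix, $D=\mathrm{diag}(d_i)$ the unique diagonal matrix with coprime positive integer entries such that $DA$ is symmetric. $P=(p_{ij})\in M_n(\Bbbk[[\hbar]])$ is of Cartan type with Cartan matrix $A$ if $P+P^T=2DA$. Realization of $P$: a triple $\mathcal R=(\mathfrak h,\Pi,\Pi^\vee)$, $\mathfrak h$ a free $\Bbbk[[\hbar]]$-module of finite rank (the rank $\mathrm{rk}(\mathcal R)$), $\Pi^\vee=\{T_i^\pm\}_{i\in I}\subseteq\mathfrak h$, $\Pi=\{\alpha_i\}_{i\in I}\subseteq\mathfrak h^*$, with $\alpha_j(T_i^+)=p_{ij}$, $\alpha_j(T_i^-)=p_{ji}$, and the classes of $S_i=\frac12(T_i^++T_i^-)$ in $\mathfrak h/\hbar\mathfrak h$ linearly independent over $\Bbbk$. It is straight if the classes of the $\alpha_i$ in $\mathfrak h^*/\hbar\mathfrak h^*$ are linearly independent; small if $\mathrm{Span}_{\Bbbk[[\hbar]]}\{S_i\}=\mathrm{Span}_{\Bbbk[[\hbar]]}\{T_i^\pm\}$.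 FoMpQUEA: $U^{\mathcal R}_{P,\hbar}(\mathfrak g)$ is the unital associative $\hbar$-adically complete topological $\Bbbk[[\hbar]]$-algebra generated by the module $\mathfrak h$ and $E_i,F_i$ ($i\in I$), with relations $TE_j-E_jT=\alpha_j(T)E_j$, $TF_j-F_jT=-\alpha_j(T)F_j$, $T'T''=T''T'$, $E_iF_j-F_jE_i=\delta_{ij}\frac{e^{\hbar T_i^+}-e^{-\hbar T_i^-}}{q_i-q_i^{-1}}$ and, for $i\ne j$, $\sum_{k=0}^{1-a_{ij}}(-1)^k\left[{1-a_{ij}\atop k}\right]_{q_i}q_{ij}^{k/2}q_{ji}^{-k/2}E_i^{1-a_{ij}-k}E_jE_i^k=0=\sum_{k=0}^{1-a_{ij}}(-1)^k\left[{1-a_{ij}\atop k}\right]_{q_i}q_{ij}^{k/2}q_{ji}^{-k/2}F_i^kF_jF_i^{1-a_{ij}-k}$, where $q_i=e^{\hbar d_i}$, $q_{ij}^{\pm1/2}=e^{\pm\hbar p_{ij}/2}$, $[r]_q=(q^r-q^{-r})/(q-q^{-1})$. It is a topological Hopf algebra with $\Delta(E_i)=E_i\otimes1+e^{\hbar T_i^+}\otimes E_i$, $\Delta(T)=T\otimes1+1\otimes T$, $\Delta(F_i)=F_i\otimes e^{-\hbar T_i^-}+1\otimes F_i$, $\epsilon(E_i)=\epsilon(T)=\epsilon(F_i)=0$. The Borel subalgebra $U^{\mathcal R}_{P,\hbar}(\mathfrak b_+)$ (resp. $\mathfrak b_-$) is the complete subalgebra generated by $\mathfrak h$ and the $E_i$'s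 (resp. the $F_i$'s); it is a Hopf subalgebra. A FoMpQUEA is called straight, small, of rank $t$, if its realization is. Toral twist: for a fixed $\Bbbk[[\hbar]]$-basis $\{H_g\}_{g\in\mathcal G}$ of $\mathfrak h$ ($|\mathcal G|=t$) and antisymmetric $\Phi=(\phi_{gk})$, $\mathcal F_\Phi=\exp\!\big(\tfrac{\hbar}{2}\sum_{g,k}\phi_{gk}H_g\otimes H_k\big)$. For a twist $\mathcal F$ of a Hopf algebra $H$, $H^{\mathcal F}$ is $H$ with the same product, unit, counit and coproduct $\Delta^{\mathcal F}(x)=\mathcal F\Delta(x)\mathcal F^{-1}$ (and corresponding antipode). *)

theory Defs
  imports
    "HOL-Analysis.Analysis"
    "HOL-Algebra.QuotRing"
    "HOL-Algebra.Subrings"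
    "HOL-Algebra.Module"
    "HOL-Library.Poly_Mapping"
    "HOL-Library.Product_Plus"
    "HOL-Computational_Algebra.Formal_Power_Series"
begin

unbundle no fps_syntax
unbundle vec_syntax

section \<open>Cartan data and matrices of Cartan type\<close>

text \<open>
  The index set \<open>I\<close> is the finite type \<^typ>\<open>'n\<close>. The diagonal matrix \<open>D\<close> is given by its entries
  \<open>d\<close>; when \<open>A\<close> is decomposable several \<open>d\<close> may satisfy the conditions, and any of them is allowed.
\<close>

definition cartan_datum :: "int ^ 'n ^ 'n \<Rightarrow> ('n::finite \<Rightarrow> nat) \<Rightarrow> bool" where
  "cartan_datum A d \<longleftrightarrow>
     (\<forall>i. A $ i $ i = 2) \<and>
     (\<forall>i j. i \<noteq> j \<longrightarrow> A $ i $ j \<le> 0) \<and>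
     (\<forall>i j. A $ i $ j = 0 \<longleftrightarrow> A $ j $ i = 0) \<and>
     (\<forall>i. d i > 0) \<and> Gcd (range d) = 1 \<and>
     (\<forall>i j. int (d i) * A $ i $ j = int (d j) * A $ j $ i)"

definition DA_matrix :: "int ^ 'n ^ 'n \<Rightarrow> ('n::finite \<Rightarrow> nat) \<Rightarrow> 'k::field_char_0 fps ^ 'n ^ 'n" where
  "DA_matrix A d = (\<chi> i j. of_int (int (d i) * A $ i $ j))"

definition cartan_type ::
  "int ^ 'n ^ 'n \<Rightarrow> ('n::finite \<Rightarrow> nat) \<Rightarrow> 'k::field_char_0 fps ^ 'n ^ 'n \<Rightarrow> bool" where
  "cartan_type A d P \<longleftrightarrow> P + transpose P = (\<chi> i j. 2 * DA_matrix A d $ i $ j)"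

section \<open>Realizations\<close>

text \<open>
  The formal parameter \<open>\<hbar>\<close> is \<^const>\<open>fps_X\<close>. The module \<open>\<hh>\<close> is the type \<^typ>\<open>'h\<close> with its
  addition and the scalar multiplication \<open>scale\<close>.
\<close>

record ('n, 'k, 'h) realization =
  scale :: "'k fps \<Rightarrow> 'h \<Rightarrow> 'h"
  Tplus :: "'n \<Rightarrow> 'h"
  Tminus :: "'n \<Rightarrow> 'h"
  root :: "'n \<Rightarrow> 'h \<Rightarrow> 'k fps"

definition is_basis ::
  "('k::field_char_0 fps \<Rightarrow> 'h \<Rightarrow> 'h::ab_group_add) \<Rightarrow> nat \<Rightarrow> (nat \<Rightarrow> 'h) \<Rightarrow> bool" where
  "is_basis s t H \<longleftrightarrow>
     inj_on H {..<t} \<and> \<not> module.dependent s (H ` {..<t}) \<and> module.span s (H ` {..<t}) = UNIV"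

definition has_rank ::
  "('n, 'k::field_char_0, 'h::ab_group_add) realization \<Rightarrow> nat \<Rightarrow> bool" where
  "has_rank R t \<longleftrightarrow> (\<exists>H. is_basis (scale R) t H)"

definition S_elem ::
  "('n, 'k::field_char_0, 'h::ab_group_add) realization \<Rightarrow> 'n \<Rightarrow> 'h" where
  "S_elem R i = scale R (fps_const (1 / 2)) (Tplus R i + Tminus R i)"

text \<open>
  The classes of the \<open>S\<^sub>i\<close> in \<open>\<hh>/\<hbar>\<hh>\<close> are independent over \<open>\<kk>\<close> when
  \<open>\<Sum> c\<^sub>i S\<^sub>i \<in> \<hbar>\<hh>\<close> with \<open>c\<^sub>i \<in> \<kk>\<close> forces all \<open>c\<^sub>i = 0\<close>; likewise for the \<open>\<alpha>\<^sub>i\<close> in \<open>\<hh>*\<close>.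
\<close>

definition is_realization ::
  "'k fps ^ 'n ^ 'n \<Rightarrow> ('n::finite, 'k::field_char_0, 'h::ab_group_add) realization \<Rightarrow> bool" where
  "is_realization P R \<longleftrightarrow>
     Modules.module (scale R) \<and>
     (\<exists>t. has_rank R t) \<and>
     (\<forall>j. module_hom (scale R) (*) (root R j)) \<and>
     (\<forall>i j. root R j (Tplus R i) = P $ i $ j) \<and>
     (\<forall>i j. root R j (Tminus R i) = P $ j $ i) \<and>
     (\<forall>c. (\<exists>y. (\<Sum>i\<in>UNIV. scale R (fps_const (c i)) (S_elem R i)) = scale R fps_X y)
           \<longrightarrow> (\<forall>i. c i = 0))"

definition straight ::
  "('n::finite, 'k::field_char_0, 'h::ab_group_add) realization \<Rightarrow> bool" where
  "straight R \<longleftrightarrow>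
     (\<forall>c. (\<exists>\<beta>. module_hom (scale R) (*) \<beta> \<and>
               (\<forall>x. (\<Sum>i\<in>UNIV. fps_const (c i) * root R i x) = fps_X * \<beta> x))
           \<longrightarrow> (\<forall>i. c i = 0))"

definition small ::
  "('n::finite, 'k::field_char_0, 'h::ab_group_add) realization \<Rightarrow> bool" where
  "small R \<longleftrightarrow>
     module.span (scale R) (range (S_elem R)) =
     module.span (scale R) (range (Tplus R) \<union> range (Tminus R))"

section \<open>Completed free algebras\<close>

datatype 'x free_monoid = Word (letters: "'x list")

instantiation free_monoid :: (type) monoid_add
begin

definition zero_free_monoid :: "'a free_monoid" where
  "zero_free_monoid = Word []"

definition plus_free_monoid :: "'a free_monoid \<Rightarrow> 'a free_monoid \<Rightarrow> 'a free_monoid" where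
  "plus_free_monoid u v = Word (letters u @ letters v)"

instance
  by standard (simp_all add: zero_free_monoid_def plus_free_monoid_def)

end

text \<open>
  For a monoid \<open>M\<close>, the \<open>\<hbar>\<close>-adic completion of the monoid algebra \<open>\<kk>[[\<hbar>]][M]\<close> is \<open>\<kk>[M][[\<hbar>]]\<close>; the
  library's metric on power series induces the \<open>\<hbar>\<close>-adic topology on it. The free monoid gives the
  completed free algebra. The product of two copies of \<open>M\<close> gives the completed tensor square,
  since \<open>\<kk>[M \<times> M] = \<kk>[M] \<otimes> \<kk>[M]\<close>.
\<close>

type_synonym ('m, 'k) calg = "('m \<Rightarrow>\<^sub>0 'k) fps"

definition scalar :: "'k fps \<Rightarrow> ('m::monoid_add, 'k::field_char_0) calg" where
  "scalar c = Abs_fps (\<lambda>n. Poly_Mapping.single 0 (fps_nth c n))"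

definition monom :: "'m \<Rightarrow> ('m::monoid_add, 'k::field_char_0) calg" where
  "monom u = fps_const (Poly_Mapping.single u 1)"

definition cexp :: "('m::monoid_add, 'k::field_char_0) calg \<Rightarrow> ('m, 'k) calg" where
  "cexp y = suminf (\<lambda>n. scalar (fps_const (1 / fact n)) * y ^ n)"

text \<open>The continuous \<open>\<kk>[[\<hbar>]]\<close>-linear map with \<open>monom u \<mapsto> \<beta> u\<close>:\<close>

definition lin_ext ::
  "('m \<Rightarrow> ('m', 'k) calg) \<Rightarrow> ('m::monoid_add, 'k::field_char_0) calg \<Rightarrow> ('m'::monoid_add, 'k) calg"
  where
  "lin_ext \<beta> a =
     suminf (\<lambda>n. \<Sum>u\<in>Poly_Mapping.keys (fps_nth a n).
        scalar (fps_X ^ n * fps_const (Poly_Mapping.lookup (fps_nth a n) u)) * \<beta> u)"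

definition tens ::
  "('m::monoid_add, 'k::field_char_0) calg \<Rightarrow> ('m, 'k) calg \<Rightarrow> ('m \<times> 'm, 'k) calg" where
  "tens a b = lin_ext (\<lambda>u. monom (u, 0)) a * lin_ext (\<lambda>u. monom (0, u)) b"

definition alg_ext ::
  "('x \<Rightarrow> ('m, 'k) calg) \<Rightarrow> ('x free_monoid, 'k::field_char_0) calg \<Rightarrow> ('m::monoid_add, 'k) calg"
  where
  "alg_ext g = lin_ext (\<lambda>u. prod_list (map g (letters u)))"

definition antialg_ext ::
  "('x \<Rightarrow> ('m, 'k) calg) \<Rightarrow> ('x free_monoid, 'k::field_char_0) calg \<Rightarrow> ('m::monoid_add, 'k) calg"
  where
  "antialg_ext g = lin_ext (\<lambda>u. prod_list (map g (rev (letters u))))"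

section \<open>Quotients by closed ideals and closed subalgebras\<close>

definition full_ring :: "'a::ring_1 ring" where
  "full_ring = \<lparr>carrier = UNIV, monoid.mult = (*), one = 1, zero = 0, add = (+)\<rparr>"

abbreviation cls :: "'a::ring_1 set \<Rightarrow> 'a \<Rightarrow> 'a set" where
  "cls J a \<equiv> J +>\<^bsub>full_ring\<^esub> a"

definition closed_ideal :: "('m::monoid_add, 'k::field_char_0) calg set \<Rightarrow> ('m, 'k) calg set" where
  "closed_ideal S = closure (Idl\<^bsub>full_ring\<^esub> S)"

definition quot_algebra ::
  "('m::monoid_add, 'k::field_char_0) calg set \<Rightarrow> ('k fps, ('m, 'k) calg set) module" where
  "quot_algebra J =
     ring.extend (full_ring Quot J)
       (module.fields (\<lambda>c X. cls J (scalar c) \<otimes>\<^bsub>full_ring Quot J\<^esub> X))"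

text \<open>
  The \<open>\<hbar>\<close>-adic topology of the quotient by \<open>J\<close> is the quotient topology, so a set \<open>B\<close> of cosets is
  closed iff \<open>\<Union>B\<close> is closed.
\<close>

definition closed_subalgebra ::
  "('k fps, 'a::topological_space set, 'z) module_scheme \<Rightarrow> 'a set set \<Rightarrow> 'a set set" where
  "closed_subalgebra M S =
     \<Inter>{B. subring B M \<and> (\<forall>c. \<forall>x\<in>B. c \<odot>\<^bsub>M\<^esub> x \<in> B) \<and> closed (\<Union>B) \<and> S \<subseteq> B}"

section \<open>Topological Hopf algebras\<close>

text \<open>
  The field \<open>tensor_square\<close> is the completed tensor square of the underlying algebra, with
  \<open>tensor\<close> the map \<open>(x, y) \<mapsto> x \<otimes> y\<close>.
\<close>

record ('k, 'a, 'b) top_hopf = "('k fps, 'a) module" +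
  tensor_square :: "('k fps, 'b) module"
  tensor :: "'a \<Rightarrow> 'a \<Rightarrow> 'b"
  comult :: "'a \<Rightarrow> 'b"
  counit :: "'a \<Rightarrow> 'k fps"
  antipode :: "'a \<Rightarrow> 'a"

definition algebra_iso ::
  "('k fps, 'a, 'y) module_scheme \<Rightarrow> ('k fps, 'b, 'z) module_scheme \<Rightarrow> ('a \<Rightarrow> 'b) set" where
  "algebra_iso M N =
     {f. f \<in> ring_iso M N \<and> (\<forall>c. \<forall>x\<in>carrier M. f (c \<odot>\<^bsub>M\<^esub> x) = c \<odot>\<^bsub>N\<^esub> f x)}"

text \<open>
  A \<open>\<kk>[[\<hbar>]]\<close>-linear bijection is automatically a homeomorphism for the \<open>\<hbar>\<close>-adic topologies. In
  particular \<open>\<Psi>\<close> below is continuous and can only be the completed tensor square of \<open>\<phi>\<close>.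
\<close>

definition hopf_isomorphic ::
  "('k, 'a, 'b) top_hopf \<Rightarrow> ('k, 'c, 'e) top_hopf \<Rightarrow> bool" (infix "\<cong>\<^sub>H" 50) where
  "H \<cong>\<^sub>H K \<longleftrightarrow>
     (\<exists>\<phi> \<Psi>. \<phi> \<in> algebra_iso H K \<and>
        \<Psi> \<in> algebra_iso (tensor_square H) (tensor_square K) \<and>
        (\<forall>x\<in>carrier H. \<forall>y\<in>carrier H. \<Psi> (tensor H x y) = tensor K (\<phi> x) (\<phi> y)) \<and>
        (\<forall>x\<in>carrier H. \<Psi> (comult H x) = comult K (\<phi> x)) \<and>
        (\<forall>x\<in>carrier H. counit K (\<phi> x) = counit H x) \<and>
        (\<forall>x\<in>carrier H. \<phi> (antipode H x) = antipode K (\<phi> x)))"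

text \<open>
  The closed subalgebra generated by \<open>S\<close>; its completed tensor square is realized inside that of
  the ambient algebra.
\<close>

definition hopf_subalgebra ::
  "('k, 'a::topological_space set, 'b::topological_space set) top_hopf \<Rightarrow> 'a set set
    \<Rightarrow> ('k, 'a set, 'b set) top_hopf" where
  "hopf_subalgebra H S =
     (let B = closed_subalgebra H S;
          B2 = closed_subalgebra (tensor_square H) {tensor H x y | x y. x \<in> B \<and> y \<in> B}
      in H\<lparr>carrier := B, tensor_square := (tensor_square H)\<lparr>carrier := B2\<rparr>\<rparr>)"

text \<open>Deformation by a twist \<open>\<F>\<close>, where \<open>v\<close> is the image of \<open>\<F>\<close> under \<open>x \<otimes> y \<mapsto> x S(y)\<close>:\<close>

definition twist_by :: "'b \<Rightarrow> 'a \<Rightarrow> ('k, 'a, 'b) top_hopf \<Rightarrow> ('k, 'a, 'b) top_hopf" where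
  "twist_by \<F> v H = H\<lparr>
     comult := (\<lambda>x. \<F> \<otimes>\<^bsub>tensor_square H\<^esub> comult H x \<otimes>\<^bsub>tensor_square H\<^esub> (inv\<^bsub>tensor_square H\<^esub> \<F>)),
     antipode := (\<lambda>x. v \<otimes>\<^bsub>H\<^esub> antipode H x \<otimes>\<^bsub>H\<^esub> (inv\<^bsub>H\<^esub> v))\<rparr>"

section \<open>Formal multiparameter QUEAs\<close>

datatype ('n, 'h) gen = Tor 'h | Egen 'n | Fgen 'n

type_synonym ('n, 'h, 'k) qfree = "(('n, 'h) gen free_monoid, 'k) calg"

abbreviation gen :: "('n, 'h) gen \<Rightarrow> ('n, 'h, 'k::field_char_0) qfree" where
  "gen x \<equiv> monom (Word [x])"

definition q_param :: "nat \<Rightarrow> 'k::field_char_0 fps" where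
  "q_param m = fps_exp (of_nat m)"

definition q_int :: "'k::field_char_0 fps \<Rightarrow> nat \<Rightarrow> 'k fps" where
  "q_int q r = (q ^ r - inverse q ^ r) / (q - inverse q)"

definition q_fact :: "'k::field_char_0 fps \<Rightarrow> nat \<Rightarrow> 'k fps" where
  "q_fact q m = (\<Prod>r=1..m. q_int q r)"

definition q_binom :: "'k::field_char_0 fps \<Rightarrow> nat \<Rightarrow> nat \<Rightarrow> 'k fps" where
  "q_binom q m k = q_fact q m / (q_fact q k * q_fact q (m - k))"

text \<open>\<open>q_half p = e\<^bsup>\<hbar>p/2\<^esup>\<close>\<close>

definition q_half :: "'k::field_char_0 fps \<Rightarrow> 'k fps" where
  "q_half p = fps_compose (fps_exp 1) (fps_X * fps_const (1 / 2) * p)"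

definition exp_tor :: "'h \<Rightarrow> ('n, 'h, 'k::field_char_0) qfree" where
  "exp_tor x = cexp (fps_X * gen (Tor x))"

definition exp_neg_tor :: "'h \<Rightarrow> ('n, 'h, 'k::field_char_0) qfree" where
  "exp_neg_tor x = cexp (- (fps_X * gen (Tor x)))"

text \<open>
  The quotient of \<open>e\<^bsup>\<hbar>T\<^sup>+\<^esup> - e\<^bsup>-\<hbar>T\<^sup>-\<^esup>\<close> by \<open>q - q\<inverse>\<close>: both are divisible by \<open>\<hbar>\<close>, and
  \<open>(q - q\<inverse>)/\<hbar>\<close> is a unit.
\<close>

definition cartan_quotient ::
  "'k::field_char_0 fps \<Rightarrow> 'h \<Rightarrow> 'h \<Rightarrow> ('n, 'h, 'k) qfree" where
  "cartan_quotient q T T' =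
     fps_shift 1 (exp_tor T - exp_neg_tor T') * scalar (inverse (fps_shift 1 (q - inverse q)))"

definition serre_coeff ::
  "int ^ 'n ^ 'n \<Rightarrow> ('n::finite \<Rightarrow> nat) \<Rightarrow> 'k::field_char_0 fps ^ 'n ^ 'n \<Rightarrow> 'n \<Rightarrow> 'n \<Rightarrow> nat \<Rightarrow> 'k fps"
  where
  "serre_coeff A d P i j k =
     (- 1) ^ k * q_binom (q_param (d i)) (nat (1 - A $ i $ j)) k
       * q_half (P $ i $ j) ^ k * inverse (q_half (P $ j $ i)) ^ k"

definition serre_E ::
  "int ^ 'n ^ 'n \<Rightarrow> ('n::finite \<Rightarrow> nat) \<Rightarrow> 'k::field_char_0 fps ^ 'n ^ 'n \<Rightarrow> 'n \<Rightarrow> 'n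
    \<Rightarrow> ('n, 'h, 'k) qfree" where
  "serre_E A d P i j =
     (let m = nat (1 - A $ i $ j) in
      \<Sum>k=0..m. scalar (serre_coeff A d P i j k) * gen (Egen i) ^ (m - k) * gen (Egen j) * gen (Egen i) ^ k)"

definition serre_F ::
  "int ^ 'n ^ 'n \<Rightarrow> ('n::finite \<Rightarrow> nat) \<Rightarrow> 'k::field_char_0 fps ^ 'n ^ 'n \<Rightarrow> 'n \<Rightarrow> 'n
    \<Rightarrow> ('n, 'h, 'k) qfree" where
  "serre_F A d P i j =
     (let m = nat (1 - A $ i $ j) in
      \<Sum>k=0..m. scalar (serre_coeff A d P i j k) * gen (Fgen i) ^ k * gen (Fgen j) * gen (Fgen i) ^ (m - k))"

text \<open>
  Every element of \<open>\<hh>\<close> is a generator; the first two families of relations make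
  \<open>\<hh>\<close> enter linearly.
\<close>

definition quea_relations ::
  "int ^ 'n ^ 'n \<Rightarrow> ('n::finite \<Rightarrow> nat) \<Rightarrow> 'k::field_char_0 fps ^ 'n ^ 'n
    \<Rightarrow> ('n, 'k, 'h::ab_group_add) realization \<Rightarrow> ('n, 'h, 'k) qfree set" where
  "quea_relations A d P R =
     {gen (Tor (x + y)) - (gen (Tor x) + gen (Tor y)) | x y. True} \<union>
     {gen (Tor (scale R c x)) - scalar c * gen (Tor x) | c x. True} \<union>
     {gen (Tor x) * gen (Egen j) - gen (Egen j) * gen (Tor x) - scalar (root R j x) * gen (Egen j) | x j. True} \<union>
     {gen (Tor x) * gen (Fgen j) - gen (Fgen j) * gen (Tor x) + scalar (root R j x) * gen (Fgen j) | x j. True} \<union>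
     {gen (Tor x) * gen (Tor y) - gen (Tor y) * gen (Tor x) | x y. True} \<union>
     {gen (Egen i) * gen (Fgen j) - gen (Fgen j) * gen (Egen i)
        - (if i = j then cartan_quotient (q_param (d i)) (Tplus R i) (Tminus R i) else 0) | i j. True} \<union>
     {serre_E A d P i j | i j. i \<noteq> j} \<union>
     {serre_F A d P i j | i j. i \<noteq> j}"

definition quea_ideal ::
  "int ^ 'n ^ 'n \<Rightarrow> ('n::finite \<Rightarrow> nat) \<Rightarrow> 'k::field_char_0 fps ^ 'n ^ 'n
    \<Rightarrow> ('n, 'k, 'h::ab_group_add) realization \<Rightarrow> ('n, 'h, 'k) qfree set" where
  "quea_ideal A d P R = closed_ideal (quea_relations A d P R)"

text \<open>
  The quotient by this ideal of the completed tensor square of the free algebra is the completed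
  tensor square of the quotient algebra.
\<close>

definition tensor_ideal ::
  "('m::monoid_add, 'k::field_char_0) calg set \<Rightarrow> ('m \<times> 'm, 'k) calg set" where
  "tensor_ideal J = closed_ideal ({tens a 1 | a. a \<in> J} \<union> {tens 1 a | a. a \<in> J})"

fun gen_comult ::
  "('n, 'k::field_char_0, 'h::ab_group_add) realization \<Rightarrow> ('n, 'h) gen
    \<Rightarrow> (('n, 'h) gen free_monoid \<times> ('n, 'h) gen free_monoid, 'k) calg" where
  "gen_comult R (Tor x) = tens (gen (Tor x)) 1 + tens 1 (gen (Tor x))"
| "gen_comult R (Egen i) = tens (gen (Egen i)) 1 + tens (exp_tor (Tplus R i)) (gen (Egen i))"
| "gen_comult R (Fgen i) = tens (gen (Fgen i)) (exp_neg_tor (Tminus R i)) + tens 1 (gen (Fgen i))"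

text \<open>The antipode forced by the coproduct and \<open>\<epsilon>(T) = \<epsilon>(E\<^sub>i) = \<epsilon>(F\<^sub>i) = 0\<close>:\<close>

fun gen_antipode ::
  "('n, 'k::field_char_0, 'h::ab_group_add) realization \<Rightarrow> ('n, 'h) gen \<Rightarrow> ('n, 'h, 'k) qfree" where
  "gen_antipode R (Tor x) = - gen (Tor x)"
| "gen_antipode R (Egen i) = - (exp_neg_tor (Tplus R i) * gen (Egen i))"
| "gen_antipode R (Fgen i) = - (gen (Fgen i) * exp_tor (Tminus R i))"

text \<open>The continuous algebra homomorphism that kills all generators:\<close>

definition free_counit :: "('n, 'h, 'k::field_char_0) qfree \<Rightarrow> 'k fps" where
  "free_counit a = Abs_fps (\<lambda>n. Poly_Mapping.lookup (fps_nth a n) 0)"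

text \<open>
  Coproduct and antipode of a coset are the unions of the cosets of the values at its
  representatives. These values all lie in one coset, so the unions are single cosets.
\<close>

definition quea ::
  "int ^ 'n ^ 'n \<Rightarrow> ('n::finite \<Rightarrow> nat) \<Rightarrow> 'k::field_char_0 fps ^ 'n ^ 'n
    \<Rightarrow> ('n, 'k, 'h::ab_group_add) realization
    \<Rightarrow> ('k, ('n, 'h, 'k) qfree set,
         (('n, 'h) gen free_monoid \<times> ('n, 'h) gen free_monoid, 'k) calg set) top_hopf" where
  "quea A d P R =
     (let J = quea_ideal A d P R; J2 = tensor_ideal J in
      module.extend (quot_algebra J)
        (top_hopf.fields
          (quot_algebra J2)
          (\<lambda>X Y. \<Union>x\<in>X. \<Union>y\<in>Y. cls J2 (tens x y))
          (\<lambda>X. \<Union>x\<in>X. cls J2 (alg_ext (gen_comult R) x))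
          (\<lambda>X. the_elem (free_counit ` X))
          (\<lambda>X. \<Union>x\<in>X. cls J (antialg_ext (gen_antipode R) x))))"

definition borel_plus where
  "borel_plus A d P R =
     hopf_subalgebra (quea A d P R)
       (cls (quea_ideal A d P R) ` (range (\<lambda>x. gen (Tor x)) \<union> range (\<lambda>i. gen (Egen i))))"

definition borel_minus where
  "borel_minus A d P R =
     hopf_subalgebra (quea A d P R)
       (cls (quea_ideal A d P R) ` (range (\<lambda>x. gen (Tor x)) \<union> range (\<lambda>i. gen (Fgen i))))"

datatype part = Whole | Positive_Borel | Negative_Borel

fun quantum_algebra ::
  "part \<Rightarrow> int ^ 'n ^ 'n \<Rightarrow> ('n::finite \<Rightarrow> nat) \<Rightarrow> 'k::field_char_0 fps ^ 'n ^ 'n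
    \<Rightarrow> ('n, 'k, 'h::ab_group_add) realization
    \<Rightarrow> ('k, ('n, 'h, 'k) qfree set,
         (('n, 'h) gen free_monoid \<times> ('n, 'h) gen free_monoid, 'k) calg set) top_hopf" where
  "quantum_algebra Whole A d P R = quea A d P R"
| "quantum_algebra Positive_Borel A d P R = borel_plus A d P R"
| "quantum_algebra Negative_Borel A d P R = borel_minus A d P R"

section \<open>Toral twists\<close>

definition antisymmetric :: "nat \<Rightarrow> (nat \<Rightarrow> nat \<Rightarrow> 'k::field_char_0 fps) set" where
  "antisymmetric t = {\<Phi>. \<forall>g<t. \<forall>k<t. \<Phi> g k = - \<Phi> k g}"

definition toral_element ::
  "nat \<Rightarrow> (nat \<Rightarrow> 'h) \<Rightarrow> (nat \<Rightarrow> nat \<Rightarrow> 'k::field_char_0 fps)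
    \<Rightarrow> (('n, 'h) gen free_monoid \<times> ('n, 'h) gen free_monoid, 'k) calg" where
  "toral_element t H \<Phi> =
     cexp (fps_X * (\<Sum>g<t. \<Sum>k<t.
       scalar (fps_const (1 / 2) * \<Phi> g k) * tens (gen (Tor (H g))) (gen (Tor (H k)))))"

definition toral_twist ::
  "part \<Rightarrow> int ^ 'n ^ 'n \<Rightarrow> ('n::finite \<Rightarrow> nat) \<Rightarrow> 'k::field_char_0 fps ^ 'n ^ 'n
    \<Rightarrow> ('n, 'k, 'h::ab_group_add) realization
    \<Rightarrow> nat \<Rightarrow> (nat \<Rightarrow> 'h) \<Rightarrow> (nat \<Rightarrow> nat \<Rightarrow> 'k fps)
    \<Rightarrow> ('k, ('n, 'h, 'k) qfree set,
         (('n, 'h) gen free_monoid \<times> ('n, 'h) gen free_monoid, 'k) calg set) top_hopf" where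
  "toral_twist X A d P R t H \<Phi> =
     (let J = quea_ideal A d P R; \<F> = toral_element t H \<Phi> in
      twist_by
        (cls (tensor_ideal J) \<F>)
        (cls J (lin_ext (\<lambda>(u, w). monom u * antialg_ext (gen_antipode R) (monom w)) \<F>))
        (quantum_algebra X A d P R))"

end

theory Submission
  imports Defs
begin

text \<open>
  Let \<open>Z\<^sub>i \<in> \<hh>\<close> be such that \<open>\<alpha>\<^sub>j(Z\<^sub>i)\<close> is antisymmetric. If the twist \<open>\<Phi>\<close>, contracted with \<open>\<alpha>\<^sub>i\<close>, gives
  \<open>-2 Z\<^sub>i\<close>, then conjugation by \<open>\<F>\<^sub>\<Phi>\<close> sends \<open>E\<^sub>i \<otimes> 1\<close> to \<open>E\<^sub>i \<otimes> e\<^bsup>-\<hbar>Z\<^sub>i\<^esup>\<close> and \<open>1 \<otimes> E\<^sub>i\<close> to \<open>e\<^bsup>\<hbar>Z\<^sub>i\<^esup> \<otimes> E\<^sub>i\<close>.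
  Consequently the rescaled generators \<open>e\<^bsup>\<hbar>Z\<^sub>i\<^esup> E\<^sub>i\<close>, \<open>e\<^bsup>\<hbar>Z\<^sub>i\<^esup> F\<^sub>i\<close> have, for the twisted coproduct, the
  coproducts belonging to \<open>T\<^sub>i\<^sup>+ + 2 Z\<^sub>i\<close> and \<open>T\<^sub>i\<^sup>- - 2 Z\<^sub>i\<close>, and they satisfy the defining relations for
  \<open>p\<^sub>i\<^sub>j + 2 \<alpha>\<^sub>j(Z\<^sub>i)\<close>. The antipode is unchanged, because \<open>\<Phi>\<close> is antisymmetric and \<open>\<hh>\<close> commutative, so that
  the element \<open>v\<close> is \<open>1\<close>. When the roots are independent modulo \<open>\<hbar>\<close> they have dual vectors \<open>b\<^sub>i\<close>; these
  produce \<open>Z\<^sub>i\<close> with any prescribed antisymmetric \<open>\<alpha>\<^sub>j(Z\<^sub>i)\<close>, and a \<open>\<Phi>\<close> for every such \<open>Z\<close>. Finally, a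
  linear isomorphism between two straight realizations of the same rank that matches the roots and the
  \<open>S\<^sub>i\<close> always exists, since both have \<open>\<alpha>\<^sub>j(S\<^sub>i) = d\<^sub>i a\<^sub>i\<^sub>j\<close>.
\<close>

section \<open>Completed monoid algebras\<close>

text \<open>No PBW basis is used, so the quotients may have \<hbar>-torsion and a congruence modulo
  the defining ideal can never be divided by \<hbar>. Hence all calculations are congruences between
  representatives modulo a closed ideal, and the one relation with a denominator is divided before
  passing to the quotient. The rescaling is dictated by the twisted coproduct of E_i, which is E_i
  \<otimes> e^(-\<hbar>Z_i) + e^(\<hbar>(T_i^+ + Z_i)) \<otimes> E_i: multiplication by the
  group-like element e^(\<hbar>Z_i) \<otimes> e^(\<hbar>Z_i) restores the 1 in the first term and
  doubles Z_i in the second. Antisymmetry of \<alpha>_j(Z_i) does three things: \<alpha>_i(Z_i) = 0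
  lets e^(\<hbar>Z_i) commute with E_i and F_i; the two products in a commutator of a rescaled E and
  a rescaled F acquire the same scalar; so do all terms of a Serre relation. It comes from the
  common symmetric part 2DA of P + P^T and P' + P'^T: once the modules are identified so that the
  S_i agree, Z_i is half the difference of the two T_i^+.\<close>

lemma scalar_nth [simp]: "fps_nth (scalar c) n = Poly_Mapping.single 0 (fps_nth c n)"
  by (simp add: scalar_def)

lemma scalar_0 [simp]: "scalar 0 = 0"
  by (simp add: fps_eq_iff)

lemma scalar_1 [simp]: "scalar 1 = 1"
  by (auto simp: fps_eq_iff)

lemma scalar_add: "scalar (a + b) = scalar a + scalar b"
  by (simp add: fps_eq_iff single_add)

lemma scalar_minus: "scalar (- a) = - scalar a"
  by (simp add: fps_eq_iff single_uminus)

lemma single_zero_sum: "Poly_Mapping.single u (\<Sum>i\<in>S. f i) = (\<Sum>i\<in>S. Poly_Mapping.single u (f i))"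
  by (induction S rule: infinite_finite_induct) (simp_all add: single_add)

lemma scalar_mult: "scalar (a * b) = scalar a * scalar b"
  by (simp add: fps_eq_iff fps_mult_nth single_zero_sum mult_single)

lemma scalar_power: "scalar (a ^ n) = scalar a ^ n"
  by (induction n) (simp_all add: scalar_mult)

lemma scalar_const: "scalar (fps_const c) = fps_const (Poly_Mapping.single 0 c)"
  by (auto simp: fps_eq_iff)

lemma scalar_X [simp]: "scalar fps_X = fps_X"
  by (auto simp: fps_eq_iff fps_X_def)

lemma scalar_of_nat: "scalar (of_nat n) = of_nat n"
  by (induction n) (simp_all add: scalar_add)

lemma scalar_inject: "(scalar a :: ('a::monoid_add, 'b::field_char_0) calg) = scalar b \<longleftrightarrow> a = b"
proof
  have nth: "fps_nth c n = Poly_Mapping.lookup (fps_nth (scalar c :: ('a, 'b) calg) n) 0" for c n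
    by simp
  assume "(scalar a :: ('a, 'b) calg) = scalar b"
  then show "a = b" unfolding fps_eq_iff by (metis nth)
qed simp

lemma poly_mapping_expansion:
  "p = (\<Sum>u\<in>Poly_Mapping.keys p. Poly_Mapping.single u (Poly_Mapping.lookup p u))"
  by (rule poly_mapping_eqI) (auto simp: lookup_sum lookup_single when_def in_keys_iff)

lemma single_zero_commute:
  fixes p :: "'m::monoid_add \<Rightarrow>\<^sub>0 'k::comm_ring_1"
  shows "Poly_Mapping.single 0 c * p = p * Poly_Mapping.single 0 c"
proof -
  show ?thesis
    by (subst (1 2) poly_mapping_expansion[of p]) (simp add: sum_distrib_left sum_distrib_right mult_single mult.commute)
qed

lemma lookup_single_zero_mult:
  fixes p :: "'m::monoid_add \<Rightarrow>\<^sub>0 'k::comm_ring_1"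
  shows "Poly_Mapping.lookup (Poly_Mapping.single 0 c * p) u = c * Poly_Mapping.lookup p u"
  by (simp add: map.rep_eq when_def flip: mult_map_scale_conv_mult)

text \<open>Coefficients commute and the monoid element 0 is neutral on both sides, so scalars are
  central although the monoid is not commutative.\<close>

lemma scalar_commute: "scalar c * a = a * scalar c"
proof -
  have "fps_nth (scalar c * a) n = fps_nth (a * scalar c) n" for n
  proof -
    have "fps_nth (a * scalar c) n = (\<Sum>i=0..n. fps_nth a (n - i) * Poly_Mapping.single 0 (fps_nth c i))"
      unfolding fps_mult_nth
      by (rule sum.reindex_bij_witness[of _ "\<lambda>i. n - i" "\<lambda>i. n - i"]) auto
    then show ?thesis
      by (simp add: fps_mult_nth single_zero_commute)
  qed
  then show ?thesis by (simp add: fps_eq_iff)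
qed

lemma scalar_left_commute: "a * (scalar c * b) = scalar c * (a * b)"
  by (metis mult.assoc scalar_commute)

lemma X_left_commute: "a * (fps_X * b) = fps_X * (a * b :: ('m::monoid_add, 'k::field_char_0) calg)"
  by (metis scalar_X scalar_left_commute)

lemma X_power_left_commute: "a * (fps_X ^ n * b) = fps_X ^ n * (a * b :: ('m::monoid_add, 'k::field_char_0) calg)"
  by (metis scalar_X scalar_power scalar_left_commute)

lemma monom_0 [simp]: "monom 0 = 1"
  by (simp add: monom_def)

lemma monom_add: "monom (u + v) = monom u * monom v"
  by (simp add: monom_def mult_single fps_eq_iff)

subsection \<open>The topology\<close>

text \<open>The distance is 2 to the power minus the order of the difference, so balls are
  congruence classes modulo powers of \<hbar>. All later topology reduces to comparing
  truncations.\<close>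

lemma dist_fps_le_iff:
  fixes a b :: "'a::ab_group_add fps"
  shows "dist a b \<le> inverse (2 ^ n) \<longleftrightarrow> (\<forall>k<n. fps_nth a k = fps_nth b k)"
proof (cases "a = b")
  case False
  then have ne: "a - b \<noteq> 0" by simp
  have "dist a b \<le> inverse (2 ^ n) \<longleftrightarrow> n \<le> subdegree (a - b)"
    using False by (simp add: dist_fps_def)
  also have "\<dots> \<longleftrightarrow> (\<forall>k<n. fps_nth (a - b) k = 0)"
    using ne by (metis nth_less_subdegree_zero order_less_le_trans subdegree_geI)
  finally show ?thesis by simp
qed auto

lemma closed_fps_iff:
  fixes S :: "'a::ab_group_add fps set"
  shows "closed S \<longleftrightarrow> (\<forall>x. (\<forall>n. \<exists>s\<in>S. \<forall>k<n. fps_nth x k = fps_nth s k) \<longrightarrow> x \<in> S)"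
proof -
  have "x \<in> closure S \<longleftrightarrow> (\<forall>n. \<exists>s\<in>S. \<forall>k<n. fps_nth x k = fps_nth s k)" for x
  proof -
    have "x \<in> closure S \<longleftrightarrow> (\<forall>n. \<exists>s\<in>S. dist x s \<le> inverse (2 ^ n))"
    proof
      assume "x \<in> closure S"
      then show "\<forall>n. \<exists>s\<in>S. dist x s \<le> inverse (2 ^ n)"
        unfolding closure_approachable
        by (metis dist_commute less_imp_le inverse_positive_iff_positive zero_less_numeral zero_less_power)
    next
      assume *: "\<forall>n. \<exists>s\<in>S. dist x s \<le> inverse (2 ^ n)"
      have "\<exists>s\<in>S. dist s x < e" if "e > 0" for e
      proof -
        obtain n where "inverse (2 ^ n) < e"
          using real_arch_pow_inv[OF \<open>e > 0\<close>, of "1/2"] by (auto simp: power_one_over inverse_eq_divide)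
        then show ?thesis using * by (metis dist_commute order_le_less_trans)
      qed
      then show "x \<in> closure S" by (simp add: closure_approachable)
    qed
    then show ?thesis by (simp add: dist_fps_le_iff)
  qed
  then show ?thesis
    by (metis closure_subset closure_eq subsetI subset_antisym closure_closed)
qed

lemma closure_fps_iff:
  fixes S :: "'a::ab_group_add fps set"
  shows "x \<in> closure S \<longleftrightarrow> (\<forall>n. \<exists>s\<in>S. \<forall>k<n. fps_nth x k = fps_nth s k)"
proof -
  let ?C = "{x. \<forall>n. \<exists>s\<in>S. \<forall>k<n. fps_nth x k = fps_nth s k}"
  have "closed ?C"
    unfolding closed_fps_iff by (auto) metis
  moreover have "S \<subseteq> ?C" by auto
  ultimately have "closure S \<subseteq> ?C" by (rule closure_minimal[rotated])
  moreover have "x \<in> closure S" if "x \<in> ?C" for x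
    using closed_closure[of S] that closure_subset[of S] unfolding closed_fps_iff
    by (smt (verit, best) mem_Collect_eq subsetD)
  ultimately show ?thesis by blast
qed

text \<open>Only finitely many summands reach a given coefficient, and the error after N summands
  has order at least N.\<close>

lemma suminf_fps:
  fixes f :: "nat \<Rightarrow> 'a::ab_group_add fps"
  assumes "\<And>n k. k < n \<Longrightarrow> fps_nth (f n) k = 0"
  shows "suminf f = Abs_fps (\<lambda>k. \<Sum>n\<le>k. fps_nth (f n) k)"
proof -
  let ?s = "Abs_fps (\<lambda>k. \<Sum>n\<le>k. fps_nth (f n) k)"
  have close: "dist (\<Sum>n<N. f n) ?s \<le> inverse (2 ^ N)" for N
  proof -
    have "fps_nth (\<Sum>n<N. f n) k = fps_nth ?s k" if "k < N" for k
    proof -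
      have "(\<Sum>n<N. fps_nth (f n) k) = (\<Sum>n\<le>k. fps_nth (f n) k)"
        using that by (intro sum.mono_neutral_right) (auto intro: assms)
      then show ?thesis by (simp add: fps_sum_nth)
    qed
    then show ?thesis by (simp add: dist_fps_le_iff)
  qed
  have "(\<lambda>N. dist (\<Sum>n<N. f n) ?s) \<longlonglongrightarrow> 0"
  proof (rule tendsto_sandwich[OF _ _ tendsto_const LIMSEQ_inverse_realpow_zero[of 2]])
    show "\<forall>\<^sub>F n in sequentially. 0 \<le> dist (\<Sum>n<n. f n) ?s" by simp
    show "\<forall>\<^sub>F n in sequentially. dist (\<Sum>n<n. f n) ?s \<le> inverse (2 ^ n)" using close by simp
  qed simp
  then have "f sums ?s" unfolding sums_def by (subst tendsto_dist_iff)
  then show ?thesis by (rule sums_unique[symmetric])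
qed

subsection \<open>Power series in \<open>\<hbar>\<close> with arbitrary coefficients\<close>

text \<open>The series \<Sum> \<hbar>^n f(n), where each f(n) is itself a power series. Collecting
  coefficients avoids limits; \<open>PS_suminf\<close> gives the link to convergence.\<close>

definition PS :: "(nat \<Rightarrow> ('m::monoid_add, 'k::field_char_0) calg) \<Rightarrow> ('m, 'k) calg" where
  "PS f = Abs_fps (\<lambda>k. \<Sum>n\<le>k. fps_nth (f n) (k - n))"

lemma PS_suminf: "PS f = suminf (\<lambda>n. fps_X ^ n * f n)"
  by (subst suminf_fps) (auto simp: PS_def fps_X_power_mult_nth fps_eq_iff)

lemma PS_Suc: "PS f = f 0 + fps_X * PS (\<lambda>n. f (Suc n))"
proof -
  have "fps_nth (PS f) k = fps_nth (f 0 + fps_X * PS (\<lambda>n. f (Suc n))) k" for k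
  proof (cases k)
    case (Suc l)
    then show ?thesis
      by (simp add: PS_def fps_X_mult_nth sum.atMost_Suc_shift del: sum.atMost_Suc)
  qed (simp add: PS_def)
  then show ?thesis by (simp add: fps_eq_iff)
qed

lemma PS_truncate: "PS f = (\<Sum>n<N. fps_X ^ n * f n) + fps_X ^ N * PS (\<lambda>n. f (n + N))"
proof (induction N)
  case (Suc N)
  have "PS (\<lambda>n. f (n + N)) = f N + fps_X * PS (\<lambda>n. f (n + Suc N))"
    by (subst PS_Suc) simp
  with Suc show ?case by (simp add: distrib_left mult.assoc power_Suc2 del: power_Suc)
qed simp

lemma PS_add: "PS (\<lambda>n. f n + g n) = PS f + PS g"
  by (simp add: PS_def fps_eq_iff sum.distrib)

lemma PS_diff: "PS (\<lambda>n. f n - g n) = PS f - PS g"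
  by (simp add: PS_def fps_eq_iff sum_subtractf)

text \<open>Each member of the family is divisible by arbitrarily high powers of \<hbar>. In
  applications \<open>d\<close> is the error in an identity about \<open>PS f\<close> and
  \<open>s\<close> shifts the sequence \<open>f\<close>, so that peeling off one term by
  \<open>PS_Suc\<close> replaces manipulations of double sums.\<close>

lemma X_divides_all_zero:
  fixes d :: "'a \<Rightarrow> ('m::monoid_add, 'k::field_char_0) calg"
  assumes "\<And>x. d x = fps_X * d (s x)"
  shows "d x = 0"
proof -
  have "fps_nth (d x) k = 0" for k
  proof (induction k arbitrary: x)
    case 0
    show ?case by (subst assms) simp
  next
    case (Suc k)
    then show ?case by (subst assms) simp
  qed
  then show ?thesis by (simp add: fps_eq_iff)
qed

lemma PS_mult_left: "c * PS f = PS (\<lambda>n. c * f n)"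
proof -
  have "c * PS f - PS (\<lambda>n. c * f n) = 0"
  proof (rule X_divides_all_zero[where d = "\<lambda>f. c * PS f - PS (\<lambda>n. c * f n)" and s = "\<lambda>f n. f (Suc n)"])
    fix f
    show "c * PS f - PS (\<lambda>n. c * f n) = fps_X * (c * PS (\<lambda>n. f (Suc n)) - PS (\<lambda>n. c * f (Suc n)))"
      by (subst (1 2) PS_Suc) (simp add: algebra_simps X_left_commute)
  qed
  then show ?thesis by simp
qed

lemma PS_mult_right: "PS f * c = PS (\<lambda>n. f n * c)"
proof -
  have "PS f * c - PS (\<lambda>n. f n * c) = 0"
  proof (rule X_divides_all_zero[where d = "\<lambda>f. PS f * c - PS (\<lambda>n. f n * c)" and s = "\<lambda>f n. f (Suc n)"])
    fix f
    show "PS f * c - PS (\<lambda>n. f n * c) = fps_X * (PS (\<lambda>n. f (Suc n)) * c - PS (\<lambda>n. f (Suc n) * c))"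
      by (subst (1 2) PS_Suc) (simp add: algebra_simps)
  qed
  then show ?thesis by simp
qed

lemma PS_mult:
  fixes f :: "nat \<Rightarrow> ('m::monoid_add, 'k::field_char_0) calg"
  shows "PS f * PS g = PS (\<lambda>n. \<Sum>i\<le>n. f i * g (n - i))"
proof -
  let ?d = "\<lambda>f :: nat \<Rightarrow> ('m, 'k) calg. PS f * PS g - PS (\<lambda>n. \<Sum>i\<le>n. f i * g (n - i))"
  have "?d f = 0"
  proof (rule X_divides_all_zero[where d = ?d and s = "\<lambda>f n. f (Suc n)"])
    fix f :: "nat \<Rightarrow> ('m, 'k) calg"
    let ?f = "\<lambda>n. f (Suc n)"
    have "PS (\<lambda>n. \<Sum>i\<le>n. f i * g (n - i)) =
        f 0 * g 0 + fps_X * PS (\<lambda>n. f 0 * g (Suc n) + (\<Sum>i\<le>n. ?f i * g (n - i)))"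
      by (subst PS_Suc) (simp add: sum.atMost_Suc_shift del: sum.atMost_Suc)
    also have "\<dots> = f 0 * g 0 + fps_X * (f 0 * PS (\<lambda>n. g (Suc n))) + fps_X * PS (\<lambda>n. \<Sum>i\<le>n. ?f i * g (n - i))"
      by (simp add: PS_add PS_mult_left algebra_simps)
    also have "f 0 * g 0 + fps_X * (f 0 * PS (\<lambda>n. g (Suc n))) = f 0 * PS g"
      by (subst (2) PS_Suc) (simp add: algebra_simps X_left_commute)
    finally show "?d f = fps_X * ?d ?f"
      by (subst (1) PS_Suc) (simp add: algebra_simps)
  qed
  then show ?thesis by simp
qed

subsection \<open>Continuous linear maps\<close>

text \<open>Continuity is implicit: a map linear over power series commutes with powers of \<hbar>
  and so respects truncation (\<open>klinear_agree\<close>) and infinite sums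
  (\<open>klinear_PS\<close>).\<close>

definition klinear :: "(('m::monoid_add, 'k::field_char_0) calg \<Rightarrow> ('m'::monoid_add, 'k) calg) \<Rightarrow> bool" where
  "klinear L \<longleftrightarrow> (\<forall>a b. L (a + b) = L a + L b) \<and> (\<forall>c a. L (scalar c * a) = scalar c * L a)"

lemma klinearI:
  "(\<And>a b. L (a + b) = L a + L b) \<Longrightarrow> (\<And>c a. L (scalar c * a) = scalar c * L a) \<Longrightarrow> klinear L"
  by (simp add: klinear_def)

lemma klinear_add: "klinear L \<Longrightarrow> L (a + b) = L a + L b"
  and klinear_scalar: "klinear L \<Longrightarrow> L (scalar c * a) = scalar c * L a"
  by (simp_all add: klinear_def)

lemma klinear_0: "klinear L \<Longrightarrow> L 0 = 0"
  using klinear_scalar[of L 0 0] by simp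

lemma klinear_minus: "klinear L \<Longrightarrow> L (- a) = - L a"
  using klinear_scalar[of L "-1" a] by (simp add: scalar_minus)

lemma klinear_diff: "klinear L \<Longrightarrow> L (a - b) = L a - L b"
  using klinear_add[of L a "-b"] klinear_minus[of L b] by simp

lemma klinear_sum: "klinear L \<Longrightarrow> L (\<Sum>i\<in>S. f i) = (\<Sum>i\<in>S. L (f i))"
  by (induction S rule: infinite_finite_induct) (simp_all add: klinear_0 klinear_add)

lemma klinear_X: "klinear L \<Longrightarrow> L (fps_X * a) = fps_X * L a"
  using klinear_scalar[of L fps_X a] by simp

lemma klinear_X_power: "klinear L \<Longrightarrow> L (fps_X ^ n * a) = fps_X ^ n * L a"
  using klinear_scalar[of L "fps_X ^ n" a] by (simp add: scalar_power)

lemma klinear_comp: "klinear L \<Longrightarrow> klinear M \<Longrightarrow> klinear (\<lambda>a. L (M a))"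
  by (simp add: klinear_def)

lemma klinear_id: "klinear (\<lambda>a. a)"
  by (simp add: klinear_def)

lemma klinear_mult_left: "klinear L \<Longrightarrow> klinear (\<lambda>a. b * L a)"
  by (simp add: klinear_def distrib_left scalar_left_commute)

lemma klinear_mult_right: "klinear L \<Longrightarrow> klinear (\<lambda>a. L a * b)"
  by (simp add: klinear_def distrib_right mult.assoc)

lemma klinear_PS: 
  assumes "klinear L" shows "L (PS f) = PS (\<lambda>n. L (f n))"
proof -
  let ?d = "\<lambda>f. L (PS f) - PS (\<lambda>n. L (f n))"
  have "?d f = 0"
  proof (rule X_divides_all_zero[where d = ?d and s = "\<lambda>f n. f (Suc n)"])
    fix f
    have "L (PS f) = L (f 0) + fps_X * L (PS (\<lambda>n. f (Suc n)))"
      by (subst PS_Suc) (simp add: assms klinear_add klinear_X)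
    moreover have "PS (\<lambda>n. L (f n)) = L (f 0) + fps_X * PS (\<lambda>n. L (f (Suc n)))"
      by (subst PS_Suc) simp
    ultimately show "?d f = fps_X * ?d (\<lambda>n. f (Suc n))" by (simp add: algebra_simps)
  qed
  then show ?thesis by simp
qed

lemma calg_expansion: "a = PS (\<lambda>n. fps_const (fps_nth a n))"
proof -
  have "fps_nth (PS (\<lambda>n. fps_const (fps_nth a n))) k = (\<Sum>n\<le>k. if n = k then fps_nth a k else 0)" for k
    unfolding PS_def fps_nth_Abs_fps by (intro sum.cong) auto
  then show ?thesis by (simp add: fps_eq_iff)
qed

lemma fps_const_sum: "fps_const (\<Sum>i\<in>S. f i) = (\<Sum>i\<in>S. fps_const (f i :: 'a::ab_group_add))"
  by (induction S rule: infinite_finite_induct) (simp_all flip: fps_const_add)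

lemma const_expansion:
  "fps_const p = (\<Sum>u\<in>Poly_Mapping.keys p. scalar (fps_const (Poly_Mapping.lookup p u)) * monom u)"
proof -
  have "fps_const p = fps_const (\<Sum>u\<in>Poly_Mapping.keys p. Poly_Mapping.single u (Poly_Mapping.lookup p u))"
    by (subst poly_mapping_expansion[of p]) simp
  also have "\<dots> = (\<Sum>u\<in>Poly_Mapping.keys p. fps_const (Poly_Mapping.single u (Poly_Mapping.lookup p u)))"
    by (simp add: fps_const_sum)
  also have "\<dots> = (\<Sum>u\<in>Poly_Mapping.keys p. scalar (fps_const (Poly_Mapping.lookup p u)) * monom u)"
    by (simp add: scalar_const monom_def mult_single)
  finally show ?thesis .
qed

text \<open>The coefficient level of \<open>lin_ext\<close>. Summation over \<open>keys\<close> is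
  not visibly additive, since supports may shrink under addition; \<open>pm_ext_superset\<close>
  supplies a common larger index set.\<close>

definition pm_ext :: "('m \<Rightarrow> 'm' \<Rightarrow>\<^sub>0 'k) \<Rightarrow> ('m \<Rightarrow>\<^sub>0 'k) \<Rightarrow> ('m'::monoid_add \<Rightarrow>\<^sub>0 'k::field_char_0)" where
  "pm_ext f p = (\<Sum>u\<in>Poly_Mapping.keys p. Poly_Mapping.single 0 (Poly_Mapping.lookup p u) * f u)"

lemma pm_ext_superset:
  assumes "finite S" "Poly_Mapping.keys p \<subseteq> S"
  shows "pm_ext f p = (\<Sum>u\<in>S. Poly_Mapping.single 0 (Poly_Mapping.lookup p u) * f u)"
  unfolding pm_ext_def using assms by (intro sum.mono_neutral_left) (auto simp: in_keys_iff)

lemma pm_ext_0 [simp]: "pm_ext f 0 = 0"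
  by (simp add: pm_ext_def)

lemma pm_ext_add: "pm_ext f (p + q) = pm_ext f p + pm_ext f q"
proof -
  let ?S = "Poly_Mapping.keys p \<union> Poly_Mapping.keys q"
  have "Poly_Mapping.keys (p + q) \<subseteq> ?S" by (rule keys_add)
  then show ?thesis
    by (simp add: pm_ext_superset[of ?S] lookup_add single_add distrib_right sum.distrib)
qed

lemma pm_ext_scale: "pm_ext f (Poly_Mapping.single 0 c * p) = Poly_Mapping.single 0 c * pm_ext f p"
proof -
  have "Poly_Mapping.keys (Poly_Mapping.single 0 c * p) \<subseteq> Poly_Mapping.keys p"
    by (auto simp: in_keys_iff lookup_single_zero_mult)
  then show ?thesis
    by (simp add: pm_ext_superset[of "Poly_Mapping.keys p"] lookup_single_zero_mult sum_distrib_left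
        mult.assoc[symmetric] mult_single)
qed

lemma pm_ext_sum: "pm_ext f (\<Sum>i\<in>S. p i) = (\<Sum>i\<in>S. pm_ext f (p i))"
  by (induction S rule: infinite_finite_induct) (simp_all add: pm_ext_add)

lemma lin_ext_nth:
  fixes \<beta> :: "'m::monoid_add \<Rightarrow> ('m'::monoid_add, 'k::field_char_0) calg"
  shows "fps_nth (lin_ext \<beta> a) k = (\<Sum>n\<le>k. pm_ext (\<lambda>u. fps_nth (\<beta> u) (k - n)) (fps_nth a n))"
proof -
  have sc: "scalar (fps_X ^ n * fps_const c) * y = fps_X ^ n * (fps_const (Poly_Mapping.single 0 c) * y)"
    for n c and y :: "('m', 'k) calg"
    by (simp add: scalar_mult scalar_power scalar_const mult.assoc)
  show ?thesis
    unfolding lin_ext_def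
    by (subst suminf_fps) (auto simp: sc fps_X_power_mult_nth fps_sum_nth pm_ext_def intro!: sum.cong)
qed

lemma klinear_lin_ext: "klinear (lin_ext \<beta>)"
proof (rule klinearI)
  show "lin_ext \<beta> (a + b) = lin_ext \<beta> a + lin_ext \<beta> b" for a b
    by (simp add: fps_eq_iff lin_ext_nth pm_ext_add sum.distrib)
  show "lin_ext \<beta> (scalar c * a) = scalar c * lin_ext \<beta> a" for c a
  proof -
    have "fps_nth (lin_ext \<beta> (scalar c * a)) k = fps_nth (scalar c * lin_ext \<beta> a) k" for k
    proof -
      let ?g = "\<lambda>i m. Poly_Mapping.single 0 (fps_nth c i) * pm_ext (\<lambda>u. fps_nth (\<beta> u) (k - i - m)) (fps_nth a m)"
      have "fps_nth (lin_ext \<beta> (scalar c * a)) k = (\<Sum>n\<le>k. \<Sum>i\<le>n. ?g i (n - i))"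
        by (simp add: lin_ext_nth fps_mult_nth pm_ext_sum pm_ext_scale atLeast0AtMost)
      also have "\<dots> = (\<Sum>(n, i)\<in>(SIGMA n:{..k}. {..n}). ?g i (n - i))"
        by (subst sum.Sigma) auto
      \<comment> \<open>Pairs (total order, order taken from \<open>c\<close>) are traded for pairs
        (order from \<open>c\<close>, order from \<open>a\<close>).\<close>
      also have "\<dots> = (\<Sum>(i, m)\<in>(SIGMA i:{..k}. {..k - i}). ?g i m)"
        by (rule sum.reindex_bij_witness[of _ "\<lambda>(i, m). (i + m, i)" "\<lambda>(n, i). (i, n - i)"]) auto
      also have "\<dots> = (\<Sum>i\<le>k. \<Sum>m\<le>k - i. ?g i m)"
        by (subst sum.Sigma) auto
      also have "\<dots> = fps_nth (scalar c * lin_ext \<beta> a) k"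
        by (simp add: lin_ext_nth fps_mult_nth sum_distrib_left atLeast0AtMost)
      finally show ?thesis .
    qed
    then show ?thesis by (simp add: fps_eq_iff)
  qed
qed

lemma lin_ext_monom [simp]:
  fixes \<beta> :: "'m::monoid_add \<Rightarrow> ('m'::monoid_add, 'k::field_char_0) calg"
  shows "lin_ext \<beta> (monom u) = \<beta> u"
proof -
  have "pm_ext f (Poly_Mapping.single u 1) = f u" for f :: "'m \<Rightarrow> 'm' \<Rightarrow>\<^sub>0 'k"
    by (simp add: pm_ext_def)
  then have "fps_nth (lin_ext \<beta> (monom u)) k = (\<Sum>n\<le>k. if n = 0 then fps_nth (\<beta> u) k else 0)" for k
    unfolding lin_ext_nth by (intro sum.cong) (auto simp: monom_def)
  then show ?thesis by (simp add: fps_eq_iff)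
qed

section \<open>Closed ideals and congruences\<close>

definition khom :: "(('m::monoid_add, 'k::field_char_0) calg \<Rightarrow> ('m'::monoid_add, 'k) calg) \<Rightarrow> bool" where
  "khom L \<longleftrightarrow> klinear L \<and> L 1 = 1 \<and> (\<forall>a b. L (a * b) = L a * L b)"

definition kantihom :: "(('m::monoid_add, 'k::field_char_0) calg \<Rightarrow> ('m'::monoid_add, 'k) calg) \<Rightarrow> bool" where
  "kantihom L \<longleftrightarrow> klinear L \<and> L 1 = 1 \<and> (\<forall>a b. L (a * b) = L b * L a)"

lemma khom_klinear: "khom L \<Longrightarrow> klinear L"
  and khom_1: "khom L \<Longrightarrow> L 1 = 1"
  and khom_mult: "khom L \<Longrightarrow> L (a * b) = L a * L b"
  by (simp_all add: khom_def)

lemma kantihom_klinear: "kantihom L \<Longrightarrow> klinear L"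
  and kantihom_1: "kantihom L \<Longrightarrow> L 1 = 1"
  and kantihom_mult: "kantihom L \<Longrightarrow> L (a * b) = L b * L a"
  by (simp_all add: kantihom_def)

lemmas khom_add = klinear_add[OF khom_klinear]
  and khom_diff = klinear_diff[OF khom_klinear]
  and khom_minus = klinear_minus[OF khom_klinear]
  and khom_0 = klinear_0[OF khom_klinear]
  and khom_sum = klinear_sum[OF khom_klinear]
  and khom_scalar_mult = klinear_scalar[OF khom_klinear]

lemma khom_power: "khom L \<Longrightarrow> L (a ^ n) = L a ^ n"
  by (induction n) (simp_all add: khom_1 khom_mult)

lemma kantihom_power: "kantihom L \<Longrightarrow> L (a ^ n) = L a ^ n"
  by (induction n) (simp_all add: kantihom_1 kantihom_mult power_commutes)

lemma khom_scalar: "khom L \<Longrightarrow> L (scalar c) = scalar c"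
  using khom_scalar_mult[of L c 1] by (simp add: khom_1)

lemma khom_comp: "khom L \<Longrightarrow> khom M \<Longrightarrow> khom (\<lambda>a. L (M a))"
  by (simp add: khom_def klinear_comp)

lemma khom_id: "khom (\<lambda>a. a)"
  by (simp add: khom_def klinear_id)

lemma agree_iff:
  fixes a b :: "('m::monoid_add, 'k::field_char_0) calg"
  shows "(\<forall>k<n. fps_nth a k = fps_nth b k) \<longleftrightarrow> (\<exists>z. a = b + fps_X ^ n * z)"
proof
  assume *: "\<forall>k<n. fps_nth a k = fps_nth b k"
  have "a = b + fps_X ^ n * fps_shift n (a - b)"
    using * by (auto simp: fps_eq_iff fps_X_power_mult_nth)
  then show "\<exists>z. a = b + fps_X ^ n * z" ..
qed (auto simp: fps_X_power_mult_nth)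

lemma klinear_agree:
  assumes "klinear L" "\<forall>k<n. fps_nth a k = fps_nth b k"
  shows "\<forall>k<n. fps_nth (L a) k = fps_nth (L b) k"
  using assms unfolding agree_iff by (auto simp: klinear_add klinear_X_power)

lemma closed_vimage_klinear:
  assumes "klinear L" "closed S"
  shows "closed (L -` S)"
  unfolding closed_fps_iff
proof (intro allI impI)
  fix x
  assume *: "\<forall>n. \<exists>s\<in>L -` S. \<forall>k<n. fps_nth x k = fps_nth s k"
  have "\<exists>s\<in>S. \<forall>k<n. fps_nth (L x) k = fps_nth s k" for n
    using * klinear_agree[OF assms(1)] by (metis vimage_eq)
  then show "x \<in> L -` S"
    using assms(2) unfolding closed_fps_iff by auto
qed

definition eqm :: "'a::ab_group_add \<Rightarrow> 'a set \<Rightarrow> 'a \<Rightarrow> bool" ("(_ \<approx>[_] _)" [51, 0, 51] 50) where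
  "a \<approx>[J] b \<longleftrightarrow> a - b \<in> J"

locale cideal =
  fixes J :: "('m::monoid_add, 'k::field_char_0) calg set"
  assumes zero_mem [simp]: "0 \<in> J"
    and add_mem: "a \<in> J \<Longrightarrow> b \<in> J \<Longrightarrow> a + b \<in> J"
    and mult_left_mem: "a \<in> J \<Longrightarrow> x * a \<in> J"
    and mult_right_mem: "a \<in> J \<Longrightarrow> a * x \<in> J"
    and closed_J: "closed J"
begin

lemma minus_mem: "a \<in> J \<Longrightarrow> - a \<in> J"
  using mult_left_mem[of a "-1"] by simp

lemma diff_mem: "a \<in> J \<Longrightarrow> b \<in> J \<Longrightarrow> a - b \<in> J"
  using add_mem[of a "-b"] minus_mem by simp

lemma sum_mem: "(\<And>i. i \<in> S \<Longrightarrow> f i \<in> J) \<Longrightarrow> sum f S \<in> J"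
  by (induction S rule: infinite_finite_induct) (auto intro: add_mem)

text \<open>Closedness enters here: the partial sums lie in the ideal and approximate the series to
  every order. Congruences between series may therefore be proved term by term.\<close>

lemma PS_mem: assumes "\<And>n. f n \<in> J" shows "PS f \<in> J"
proof -
  have "\<exists>s\<in>J. \<forall>k<N. fps_nth (PS f) k = fps_nth s k" for N
    unfolding agree_iff using PS_truncate[of f N]
    by (auto intro!: bexI[of _ "\<Sum>n<N. fps_X ^ n * f n"] sum_mem mult_left_mem assms)
  then show ?thesis
    using closed_J unfolding closed_fps_iff by blast
qed

lemma eqv_refl [simp, intro]: "a \<approx>[J] a"
  by (simp add: eqm_def)

lemma eqv_sym: "a \<approx>[J] b \<Longrightarrow> b \<approx>[J] a"
  unfolding eqm_def using minus_mem by fastforce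

lemma eqv_trans [trans]: "a \<approx>[J] b \<Longrightarrow> b \<approx>[J] c \<Longrightarrow> a \<approx>[J] c"
  unfolding eqm_def using add_mem by fastforce

lemma eqv_0_iff: "a \<approx>[J] 0 \<longleftrightarrow> a \<in> J"
  by (simp add: eqm_def)

lemma eqv_add: "a \<approx>[J] b \<Longrightarrow> c \<approx>[J] d \<Longrightarrow> a + c \<approx>[J] b + d"
  unfolding eqm_def using add_mem by (fastforce simp: algebra_simps)

lemma eqv_diff: "a \<approx>[J] b \<Longrightarrow> c \<approx>[J] d \<Longrightarrow> a - c \<approx>[J] b - d"
  unfolding eqm_def using diff_mem by (fastforce simp: algebra_simps)

lemma eqv_minus: "a \<approx>[J] b \<Longrightarrow> - a \<approx>[J] - b"
  unfolding eqm_def using minus_mem by (fastforce simp: algebra_simps)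

lemma eqv_mult:
  assumes "a \<approx>[J] b" "c \<approx>[J] d" shows "a * c \<approx>[J] b * d"
proof -
  have "a * c - b * d = (a - b) * c + b * (c - d)" by (simp add: algebra_simps)
  then show ?thesis
    using assms unfolding eqm_def by (auto intro: add_mem mult_left_mem mult_right_mem)
qed

lemma eqv_mult_left: "c \<approx>[J] d \<Longrightarrow> a * c \<approx>[J] a * d"
  and eqv_mult_right: "c \<approx>[J] d \<Longrightarrow> c * a \<approx>[J] d * a"
  by (simp_all add: eqv_mult)

lemma eqv_sum: "(\<And>i. i \<in> S \<Longrightarrow> f i \<approx>[J] g i) \<Longrightarrow> sum f S \<approx>[J] sum g S"
  by (induction S rule: infinite_finite_induct) (auto intro: eqv_add)

lemma eqv_power: "a \<approx>[J] b \<Longrightarrow> a ^ n \<approx>[J] b ^ n"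
  by (induction n) (auto intro: eqv_mult)

lemma eqv_PS: "(\<And>n. f n \<approx>[J] g n) \<Longrightarrow> PS f \<approx>[J] PS g"
  using PS_mem[of "\<lambda>n. f n - g n"] by (simp add: eqm_def PS_diff)

lemma klinear_eqvI:
  assumes L: "klinear L" and M: "klinear M" and "\<And>u. L (monom u) \<approx>[J] M (monom u)"
  shows "L a \<approx>[J] M a"
proof -
  have "L (fps_const p) \<approx>[J] M (fps_const p)" for p
    unfolding const_expansion[of p]
    by (simp add: klinear_sum klinear_scalar L M assms(3) eqv_sum eqv_mult_left)
  then have "PS (\<lambda>n. L (fps_const (fps_nth a n))) \<approx>[J] PS (\<lambda>n. M (fps_const (fps_nth a n)))"
    by (intro eqv_PS)
  then show ?thesis
    by (metis calg_expansion klinear_PS L M)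
qed

end

text \<open>Equality is congruence modulo the zero ideal, so every congruence lemma also yields an
  exact identity in the algebra itself.\<close>

lemma cideal_zero: "cideal {0}"
  by unfold_locales auto

lemma eqm_zero [simp]: "a \<approx>[{0}] b \<longleftrightarrow> a = b"
  by (simp add: eqm_def)

lemma klinear_unique:
  assumes "klinear L" "klinear M" "\<And>u. L (monom u) = M (monom u)"
  shows "L a = M a"
  using cideal.klinear_eqvI[OF cideal_zero assms(1,2)] assms(3) by simp

text \<open>With minimality of \<open>closed_ideal\<close>, this reduces the inclusion of one closed
  ideal into another under a homomorphism to a check on generators
  (\<open>khom_closed_ideal\<close>).\<close>

lemma cideal_vimage:
  assumes "khom L" "cideal J"
  shows "cideal (L -` J)"
proof -
  interpret cideal J by fact
  show ?thesis
    by unfold_locales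
      (auto simp: khom_0 khom_add khom_mult assms(1) add_mem mult_left_mem mult_right_mem
        intro: closed_vimage_klinear[OF khom_klinear[OF assms(1)]] closed_J)
qed

section \<open>Two-sided ideals in the full ring and their closures\<close>

lemma ring_full_ring: "ring (full_ring :: 'a::ring_1 ring)"
proof (rule ringI)
  show "abelian_group (full_ring :: 'a ring)"
  proof (rule abelian_groupI)
    fix x :: 'a assume "x \<in> carrier full_ring"
    show "\<exists>y\<in>carrier full_ring. y \<oplus>\<^bsub>full_ring\<^esub> x = \<zero>\<^bsub>full_ring\<^esub>"
      by (rule bexI[of _ "-x"]) (simp_all add: full_ring_def)
  qed (simp_all add: full_ring_def algebra_simps)
  show "Group.monoid (full_ring :: 'a ring)"
    by unfold_locales (simp_all add: full_ring_def algebra_simps)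
qed (simp_all add: full_ring_def algebra_simps)

lemma full_ring_simps [simp]:
  "carrier full_ring = UNIV" "mult full_ring = (*)" "one full_ring = 1"
  "zero full_ring = 0" "add full_ring = (+)"
  by (simp_all add: full_ring_def)

lemma ideal_full_ringI:
  fixes I :: "'a::ring_1 set"
  assumes "0 \<in> I" "\<And>a b. a \<in> I \<Longrightarrow> b \<in> I \<Longrightarrow> a + b \<in> I"
    "\<And>a x. a \<in> I \<Longrightarrow> x * a \<in> I" "\<And>a x. a \<in> I \<Longrightarrow> a * x \<in> I"
  shows "ideal I full_ring"
proof (rule idealI[OF ring_full_ring])
  have grp: "group (add_monoid (full_ring :: 'a ring))"
    using abelian_group.a_group[OF ring.is_abelian_group[OF ring_full_ring]] .
  have inv: "inv\<^bsub>add_monoid full_ring\<^esub> a = - a" for a :: 'a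
    by (rule group.inv_equality[OF grp]) simp_all
  have "- a \<in> I" if "a \<in> I" for a
    using assms(3)[OF that, of "-1"] by simp
  then show "subgroup I (add_monoid full_ring)"
    using assms(1,2) by (intro group.subgroupI[OF grp]) (auto simp: inv[simplified])
qed (use assms in auto)

lemma (in cideal) ideal_J: "ideal J full_ring"
  by (rule ideal_full_ringI) (auto intro: add_mem mult_left_mem mult_right_mem)

lemma closed_ideal_superset: "S \<subseteq> closed_ideal S"
  unfolding closed_ideal_def
  using ring.genideal_self[OF ring_full_ring, of S] closure_subset by force

lemma closed_ideal_minimal:
  assumes "cideal I" "S \<subseteq> I"
  shows "closed_ideal S \<subseteq> I"
  unfolding closed_ideal_def
  using ring.genideal_minimal[OF ring_full_ring cideal.ideal_J[OF assms(1)] assms(2)]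
  by (rule closure_minimal) (rule cideal.closed_J[OF assms(1)])

lemma cideal_closed_ideal: "cideal (closed_ideal S)"
proof -
  let ?I = "Idl\<^bsub>full_ring\<^esub> S"
  interpret I: ideal ?I full_ring
    by (rule ring.genideal_ideal[OF ring_full_ring]) simp
  have mem: "0 \<in> ?I" "\<And>a b. a \<in> ?I \<Longrightarrow> b \<in> ?I \<Longrightarrow> a + b \<in> ?I"
    "\<And>a x. a \<in> ?I \<Longrightarrow> x * a \<in> ?I" "\<And>a x. a \<in> ?I \<Longrightarrow> a * x \<in> ?I"
    using additive_subgroup.zero_closed[OF I.additive_subgroup_axioms]
      additive_subgroup.a_closed[OF I.additive_subgroup_axioms] I.I_l_closed I.I_r_closed by simp_all
  show ?thesis
  proof
    show "0 \<in> closed_ideal S"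
      unfolding closed_ideal_def using mem(1) closure_subset by auto
    fix a x assume a: "a \<in> closed_ideal S"
    show "a + b \<in> closed_ideal S" if b: "b \<in> closed_ideal S" for b
      unfolding closed_ideal_def closure_fps_iff
    proof
      fix n
      obtain s t where "s \<in> ?I" "\<forall>k<n. fps_nth a k = fps_nth s k" "t \<in> ?I" "\<forall>k<n. fps_nth b k = fps_nth t k"
        using a b unfolding closed_ideal_def closure_fps_iff by meson
      then show "\<exists>s\<in>?I. \<forall>k<n. fps_nth (a + b) k = fps_nth s k"
        using mem(2) by (intro bexI[of _ "s + t"]) auto
    qed
    have "\<exists>s\<in>?I. \<forall>k<n. fps_nth (x * a) k = fps_nth s k" "\<exists>s\<in>?I. \<forall>k<n. fps_nth (a * x) k = fps_nth s k" for n
    proof -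
      obtain s where s: "s \<in> ?I" "\<forall>k<n. fps_nth a k = fps_nth s k"
        using a unfolding closed_ideal_def closure_fps_iff by meson
      then show "\<exists>s\<in>?I. \<forall>k<n. fps_nth (x * a) k = fps_nth s k"
        using mem(3) klinear_agree[OF klinear_mult_left[OF klinear_id, of x] s(2)] by blast
      show "\<exists>s\<in>?I. \<forall>k<n. fps_nth (a * x) k = fps_nth s k"
        using s mem(4) klinear_agree[OF klinear_mult_right[OF klinear_id, of x] s(2)] by blast
    qed
    then show "x * a \<in> closed_ideal S" "a * x \<in> closed_ideal S"
      unfolding closed_ideal_def closure_fps_iff by auto
  qed (simp add: closed_ideal_def)
qed

lemma khom_closed_ideal:
  assumes "khom L" "cideal J" "L ` S \<subseteq> J"
  shows "L ` closed_ideal S \<subseteq> J"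
  using closed_ideal_minimal[OF cideal_vimage[OF assms(1,2)], of S] assms(3) by auto

section \<open>Homomorphisms out of monoid algebras and free algebras\<close>

text \<open>Both sides of the product rule are linear in each argument, so monomials suffice, one
  argument at a time.\<close>

lemma khom_lin_ext:
  assumes "\<beta> 0 = 1" "\<And>u v. \<beta> (u + v) = \<beta> u * \<beta> v"
  shows "khom (lin_ext \<beta>)"
proof -
  let ?L = "lin_ext \<beta>"
  have L: "klinear ?L" by (rule klinear_lin_ext)
  have "?L (monom u * b) = ?L (monom u) * ?L b" for u b
    by (rule klinear_unique[where L = "\<lambda>b. ?L (monom u * b)" and M = "\<lambda>b. ?L (monom u) * ?L b"])
      (rule klinear_comp[OF L klinear_mult_left[OF klinear_id]], rule klinear_mult_left[OF L],
        simp add: assms flip: monom_add)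
  note this [simp]
  have "?L (a * b) = ?L a * ?L b" for a b
    by (rule klinear_unique[where L = "\<lambda>a. ?L (a * b)" and M = "\<lambda>a. ?L a * ?L b"])
      (rule klinear_comp[OF L klinear_mult_right[OF klinear_id]], rule klinear_mult_right[OF L], simp)
  moreover have "?L 1 = 1"
    using lin_ext_monom[of \<beta> 0] by (simp add: assms(1))
  ultimately show ?thesis
    by (simp add: khom_def L)
qed

lemma kantihom_lin_ext:
  assumes "\<beta> 0 = 1" "\<And>u v. \<beta> (u + v) = \<beta> v * \<beta> u"
  shows "kantihom (lin_ext \<beta>)"
proof -
  let ?L = "lin_ext \<beta>"
  have L: "klinear ?L" by (rule klinear_lin_ext)
  have "?L (monom u * b) = ?L b * ?L (monom u)" for u b
    by (rule klinear_unique[where L = "\<lambda>b. ?L (monom u * b)" and M = "\<lambda>b. ?L b * ?L (monom u)"])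
      (rule klinear_comp[OF L klinear_mult_left[OF klinear_id]], rule klinear_mult_right[OF L],
        simp add: assms flip: monom_add)
  note this [simp]
  have "?L (a * b) = ?L b * ?L a" for a b
    by (rule klinear_unique[where L = "\<lambda>a. ?L (a * b)" and M = "\<lambda>a. ?L b * ?L a"])
      (rule klinear_comp[OF L klinear_mult_right[OF klinear_id]], rule klinear_mult_left[OF L], simp)
  moreover have "?L 1 = 1"
    using lin_ext_monom[of \<beta> 0] by (simp add: assms(1))
  ultimately show ?thesis
    by (simp add: kantihom_def L)
qed

lemma letters_0 [simp]: "letters 0 = []"
  and letters_add [simp]: "letters (u + v) = letters u @ letters v"
  by (simp_all add: zero_free_monoid_def plus_free_monoid_def)

lemma khom_alg_ext: "khom (alg_ext g)"
  unfolding alg_ext_def by (rule khom_lin_ext) simp_all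

lemma kantihom_antialg_ext: "kantihom (antialg_ext g)"
  unfolding antialg_ext_def by (rule kantihom_lin_ext) simp_all

lemma alg_ext_gen [simp]: "alg_ext g (monom (Word [x])) = g x"
  by (simp add: alg_ext_def)

lemma antialg_ext_gen [simp]: "antialg_ext g (monom (Word [x])) = g x"
  by (simp add: antialg_ext_def)

lemma monom_Nil: "monom (Word []) = 1"
  by (metis monom_0 zero_free_monoid_def)

lemma monom_Cons: "monom (Word (x # xs)) = monom (Word [x]) * monom (Word xs)"
  by (simp flip: monom_add add: plus_free_monoid_def)

lemma (in cideal) khom_eqvI:
  fixes L :: "('x free_monoid, 'k) calg \<Rightarrow> ('m, 'k) calg"
  assumes "klinear L" "klinear M" "L 1 \<approx>[J] 1" "M 1 \<approx>[J] 1"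
    and "\<And>a b. L (a * b) \<approx>[J] L a * L b" "\<And>a b. M (a * b) \<approx>[J] M a * M b"
    and "\<And>x. L (monom (Word [x])) \<approx>[J] M (monom (Word [x]))"
  shows "L a \<approx>[J] M a"
proof (rule klinear_eqvI[OF assms(1,2)])
  fix u :: "'x free_monoid"
  have "L (monom (Word ls)) \<approx>[J] M (monom (Word ls))" for ls
  proof (induction ls)
    case Nil
    then show ?case using assms(3,4) by (metis monom_Nil eqv_sym eqv_trans)
  next
    case (Cons x ls)
    have "L (monom (Word (x # ls))) \<approx>[J] L (monom (Word [x])) * L (monom (Word ls))"
      by (subst monom_Cons) (rule assms(5))
    also have "\<dots> \<approx>[J] M (monom (Word [x])) * M (monom (Word ls))"
      by (intro eqv_mult Cons assms)
    also have "\<dots> \<approx>[J] M (monom (Word (x # ls)))"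
      by (subst monom_Cons) (rule eqv_sym, rule assms(6))
    finally show ?case .
  qed
  then show "L (monom u) \<approx>[J] M (monom u)" by (cases u) auto
qed

lemma (in cideal) kantihom_eqvI:
  fixes L :: "('x free_monoid, 'k) calg \<Rightarrow> ('m, 'k) calg"
  assumes "kantihom L" "kantihom M" "\<And>x. L (monom (Word [x])) \<approx>[J] M (monom (Word [x]))"
  shows "L a \<approx>[J] M a"
proof (rule klinear_eqvI[OF assms(1,2)[THEN kantihom_klinear]])
  fix u :: "'x free_monoid"
  have "L (monom (Word ls)) \<approx>[J] M (monom (Word ls))" for ls
  proof (induction ls)
    case Nil
    then show ?case using assms(1,2) by (simp add: monom_Nil kantihom_1)
  next
    case (Cons x ls)
    then show ?case
      by (subst (1 2) monom_Cons) (simp add: kantihom_mult assms eqv_mult)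
  qed
  then show "L (monom u) \<approx>[J] M (monom u)" by (cases u) auto
qed

lemma khom_unique:
  fixes L :: "('x free_monoid, 'k) calg \<Rightarrow> ('m::monoid_add, 'k::field_char_0) calg"
  assumes "khom L" "khom M" "\<And>x. L (monom (Word [x])) = M (monom (Word [x]))"
  shows "L a = M a"
  using cideal.khom_eqvI[OF cideal_zero, of L M a] assms by (simp add: khom_def)

section \<open>Formal exponentials\<close>

text \<open>Divided powers a^n/n!, for which the binomial theorem has no binomial coefficients
  (\<open>dp_add\<close>).\<close>

definition dp :: "('m::monoid_add, 'k::field_char_0) calg \<Rightarrow> nat \<Rightarrow> ('m, 'k) calg" where
  "dp a n = scalar (fps_const (1 / fact n)) * a ^ n"

text \<open>This is e^(\<hbar>a). As \<open>PS\<close> supplies the powers of \<hbar>, it exists for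
  every \<open>a\<close>.\<close>

definition hexp :: "('m::monoid_add, 'k::field_char_0) calg \<Rightarrow> ('m, 'k) calg" where
  "hexp a = PS (dp a)"

text \<open>\<open>(e\<^bsup>\<hbar>a\<^esup> - 1)/\<hbar>\<close>, kept as a series of its own because the quotient algebras may have \<open>\<hbar>\<close>-torsion.\<close>

definition hexp1 :: "('m::monoid_add, 'k::field_char_0) calg \<Rightarrow> ('m, 'k) calg" where
  "hexp1 a = PS (\<lambda>n. dp a (Suc n))"

lemma X_mult_power: "(fps_X * a) ^ n = fps_X ^ n * (a ^ n :: ('m::monoid_add, 'k::field_char_0) calg)"
  by (induction n) (simp_all add: mult.assoc X_power_left_commute)

lemma cexp_X_mult: "cexp (fps_X * a) = hexp a"
  by (simp add: cexp_def hexp_def PS_suminf dp_def X_mult_power X_power_left_commute)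

lemma dp_0 [simp]: "dp a 0 = 1"
  by (simp add: dp_def)

lemma hexp_hexp1: "hexp a = 1 + fps_X * hexp1 a"
  unfolding hexp_def hexp1_def by (subst PS_Suc) simp

lemma fps_const_of_nat_scalar: "scalar (fps_const (of_nat n)) = of_nat n"
  by (metis fps_of_nat scalar_of_nat)

lemma dp_Suc: "of_nat (Suc n) * dp a (Suc n) = a * dp a n"
proof -
  have "of_nat (Suc n) * dp a (Suc n) = scalar (fps_const (of_nat (Suc n))) * dp a (Suc n)"
    by (simp only: fps_const_of_nat_scalar)
  also have "\<dots> = scalar (fps_const (of_nat (Suc n) * (1 / fact (Suc n)))) * a ^ Suc n"
    by (simp only: dp_def mult.assoc[symmetric] scalar_mult[symmetric] fps_const_mult)
  also have "of_nat (Suc n) * (1 / fact (Suc n)) = (1 / fact n :: 'b)"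
    by (simp add: field_simps del: of_nat_Suc)
  also have "scalar (fps_const (1 / fact n)) * a ^ Suc n = a * dp a n"
    by (simp add: dp_def scalar_left_commute)
  finally show ?thesis .
qed

lemma khom_dp: "khom L \<Longrightarrow> L (dp a n) = dp (L a) n"
  by (simp add: dp_def khom_scalar_mult khom_power)

lemma khom_hexp: "khom L \<Longrightarrow> L (hexp a) = hexp (L a)"
  by (simp add: hexp_def klinear_PS khom_klinear khom_dp)

lemma khom_hexp1: "khom L \<Longrightarrow> L (hexp1 a) = hexp1 (L a)"
  by (simp add: hexp1_def klinear_PS khom_klinear khom_dp)

lemma kantihom_hexp: "kantihom L \<Longrightarrow> L (hexp a) = hexp (L a)"
  by (simp add: hexp_def klinear_PS kantihom_klinear dp_def[abs_def] klinear_scalar kantihom_power)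

context cideal
begin

text \<open>Positive integers are invertible scalars in characteristic zero, so cancelling them is
  legitimate modulo any ideal, in contrast to cancelling \<hbar>.\<close>

lemma of_nat_cancel:
  assumes "of_nat (Suc n) * a \<approx>[J] of_nat (Suc n) * b"
  shows "a \<approx>[J] b"
proof -
  have "scalar (fps_const (1 / of_nat (Suc n))) * (of_nat (Suc n) * c) = c" for c :: "('m, 'k) calg"
  proof -
    have "scalar (fps_const (1 / of_nat (Suc n))) * (of_nat (Suc n) * c) =
        scalar (fps_const (1 / of_nat (Suc n) * of_nat (Suc n))) * c"
      by (simp only: fps_const_of_nat_scalar[symmetric] mult.assoc[symmetric] scalar_mult[symmetric] fps_const_mult)
    then show ?thesis by (simp del: of_nat_Suc)
  qed
  then show ?thesis
    using eqv_mult_left[OF assms, of "scalar (fps_const (1 / of_nat (Suc n)))"] by simp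
qed

lemma power_intertwine: 
  assumes "a * e \<approx>[J] e * b" shows "a ^ n * e \<approx>[J] e * b ^ n"
proof (induction n)
  case (Suc n)
  have "a ^ Suc n * e = a * (a ^ n * e)" by (simp add: mult.assoc)
  also have "\<dots> \<approx>[J] a * (e * b ^ n)" by (intro eqv_mult_left Suc)
  also have "\<dots> = (a * e) * b ^ n" by (simp add: mult.assoc)
  also have "\<dots> \<approx>[J] (e * b) * b ^ n" by (intro eqv_mult_right assms)
  finally show ?case by (simp add: mult.assoc)
qed simp

lemma dp_intertwine:
  assumes "a * e \<approx>[J] e * b" shows "dp a n * e \<approx>[J] e * dp b n"
  using eqv_mult_left[OF power_intertwine[OF assms, of n], of "scalar (fps_const (1 / fact n))"]
  by (simp add: dp_def mult.assoc scalar_left_commute)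

text \<open>The intertwining passes to powers and then termwise to the series. With b = a + (a
  scalar) it yields the rule for moving toral exponentials past weight vectors.\<close>

lemma hexp_intertwine:
  assumes "a * e \<approx>[J] e * b" shows "hexp a * e \<approx>[J] e * hexp b"
  unfolding hexp_def PS_mult_left PS_mult_right by (intro eqv_PS dp_intertwine assms)

lemma dp_cong: "a \<approx>[J] b \<Longrightarrow> dp a n \<approx>[J] dp b n"
  unfolding dp_def by (intro eqv_mult_left eqv_power)

lemma hexp_cong: "a \<approx>[J] b \<Longrightarrow> hexp a \<approx>[J] hexp b"
  unfolding hexp_def by (intro eqv_PS dp_cong)

lemma hexp1_cong: "a \<approx>[J] b \<Longrightarrow> hexp1 a \<approx>[J] hexp1 b"
  unfolding hexp1_def by (intro eqv_PS dp_cong)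

text \<open>\<open>a\<close> and \<open>b\<close> commute only modulo the ideal. After
  multiplication by n + 1, \<open>dp_Suc\<close> gives the terms of the two sums the weights i and n
  + 1 - i, which add up to n + 1; this integer is then cancelled.\<close>

lemma dp_add:
  assumes "a * b \<approx>[J] b * a"
  shows "dp (a + b) n \<approx>[J] (\<Sum>i\<le>n. dp a i * dp b (n - i))"
proof (induction n)
  case (Suc n)
  have "of_nat (Suc n) * dp (a + b) (Suc n) = (a + b) * dp (a + b) n"
    by (rule dp_Suc)
  also have "\<dots> \<approx>[J] (a + b) * (\<Sum>i\<le>n. dp a i * dp b (n - i))"
    by (intro eqv_mult_left Suc)
  also have "\<dots> = (\<Sum>i\<le>n. a * dp a i * dp b (n - i)) + (\<Sum>i\<le>n. b * dp a i * dp b (n - i))"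
    by (simp add: distrib_right sum_distrib_left mult.assoc sum.distrib)
  also have "\<dots> \<approx>[J] (\<Sum>i\<le>n. a * dp a i * dp b (n - i)) + (\<Sum>i\<le>n. dp a i * b * dp b (n - i))"
    by (intro eqv_add eqv_refl eqv_sum eqv_mult_right eqv_sym[OF dp_intertwine] assms)
  also have "(\<Sum>i\<le>n. a * dp a i * dp b (n - i)) = (\<Sum>i\<le>Suc n. of_nat i * dp a i * dp b (Suc n - i))"
    by (subst sum.atMost_Suc_shift) (simp add: dp_Suc del: of_nat_Suc)
  also have "(\<Sum>i\<le>n. dp a i * b * dp b (n - i)) = (\<Sum>i\<le>Suc n. dp a i * (of_nat (Suc n - i) * dp b (Suc n - i)))"
  proof -
    have "dp a i * b * dp b (n - i) = dp a i * (of_nat (Suc n - i) * dp b (Suc n - i))" if "i \<le> n" for i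
      by (simp only: Suc_diff_le[OF that] dp_Suc mult.assoc)
    then show ?thesis by simp
  qed
  also have "(\<Sum>i\<le>Suc n. of_nat i * dp a i * dp b (Suc n - i)) + \<dots> =
      of_nat (Suc n) * (\<Sum>i\<le>Suc n. dp a i * dp b (Suc n - i))"
  proof -
    have "of_nat i * dp a i * dp b (Suc n - i) + dp a i * (of_nat (Suc n - i) * dp b (Suc n - i)) =
        of_nat (Suc n) * (dp a i * dp b (Suc n - i))" if "i \<le> Suc n" for i
    proof -
      have "of_nat i * dp a i * dp b (Suc n - i) + dp a i * (of_nat (Suc n - i) * dp b (Suc n - i)) =
        (of_nat i + of_nat (Suc n - i)) * (dp a i * dp b (Suc n - i))"
        by (simp only: distrib_right mult.assoc[symmetric] mult_of_nat_commute[of _ "dp a i"])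
      also have "of_nat i + of_nat (Suc n - i) = (of_nat (Suc n) :: ('m, 'k) calg)"
        using that by (metis le_add_diff_inverse of_nat_add)
      finally show ?thesis .
    qed
    then show ?thesis
      unfolding sum.distrib[symmetric] sum_distrib_left by (intro sum.cong refl) simp
  qed
  finally show ?case by (rule of_nat_cancel)
qed simp

lemma hexp_add:
  assumes "a * b \<approx>[J] b * a"
  shows "hexp (a + b) \<approx>[J] hexp a * hexp b"
  unfolding hexp_def PS_mult by (intro eqv_PS dp_add assms)

text \<open>This is e^(\<hbar>(a+b)) - 1 = (e^(\<hbar>a) - 1) + e^(\<hbar>a) (e^(\<hbar>b) - 1)
  divided by \<hbar>. The division is done on the divided powers of index n + 1, since the
  congruence \<open>hexp_add\<close> itself cannot be divided.\<close>

lemma hexp1_add: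
  assumes "a * b \<approx>[J] b * a"
  shows "hexp1 (a + b) \<approx>[J] hexp1 a + hexp a * hexp1 b"
proof -
  have "hexp1 (a + b) \<approx>[J] PS (\<lambda>n. dp a (Suc n) + (\<Sum>i\<le>n. dp a i * dp b (Suc (n - i))))"
    unfolding hexp1_def
  proof (rule eqv_PS)
    fix n
    have "(\<Sum>i\<le>Suc n. dp a i * dp b (Suc n - i)) = dp a (Suc n) + (\<Sum>i\<le>n. dp a i * dp b (Suc (n - i)))"
      by (simp add: Suc_diff_le add.commute)
    then show "dp (a + b) (Suc n) \<approx>[J] dp a (Suc n) + (\<Sum>i\<le>n. dp a i * dp b (Suc (n - i)))"
      using dp_add[OF assms, of "Suc n"] by (simp only:)
  qed
  then show ?thesis
    by (simp add: hexp_def hexp1_def PS_mult PS_add)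
qed

end

lemmas hexp_add_exact = cideal.hexp_add[OF cideal_zero, unfolded eqm_zero]

lemma hexp_0 [simp]: "hexp 0 = 1"
proof -
  have "dp (0 :: ('a, 'b) calg) (Suc n) = 0" for n by (simp add: dp_def)
  moreover have "PS (\<lambda>n. 0 :: ('a, 'b) calg) = 0" by (simp add: PS_def fps_eq_iff)
  ultimately have "hexp1 (0 :: ('a, 'b) calg) = 0" by (simp add: hexp1_def)
  then show ?thesis by (simp add: hexp_hexp1)
qed

lemma hexp_minus [simp]: "hexp (- a) * hexp a = 1" "hexp a * hexp (- a) = 1"
  using hexp_add_exact[of "- a" a] hexp_add_exact[of a "- a"] by simp_all

lemma hexp_minus_mult [simp]: "hexp (- a) * (hexp a * b) = b" "hexp a * (hexp (- a) * b) = b"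
  by (simp_all flip: mult.assoc)

text \<open>The scalar series e^(\<hbar>c); substitution into the exponential is sound because
  \<hbar>c has no constant term.\<close>

definition kexp :: "'k::field_char_0 fps \<Rightarrow> 'k fps" where
  "kexp c = fps_compose (fps_exp 1) (fps_X * c)"

lemma scalar_kexp: "(scalar (kexp c) :: ('m::monoid_add, 'k::field_char_0) calg) = hexp (scalar c)"
proof -
  have pow: "(fps_X * c) ^ i = fps_X ^ i * c ^ i" for i by (simp add: power_mult_distrib)
  have dp: "dp (scalar c :: ('m, 'k) calg) n = scalar (fps_const (1 / fact n) * c ^ n)" for n
    by (simp add: dp_def scalar_mult scalar_power)
  have "fps_nth (scalar (kexp c) :: ('m, 'k) calg) k = fps_nth (hexp (scalar c)) k" for k
    by (simp add: kexp_def hexp_def PS_def dp fps_compose_nth pow fps_X_power_mult_nth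
        single_zero_sum atLeast0AtMost)
  then show ?thesis by (rule fps_ext)
qed

lemma kexp_add: "kexp (a + b) = kexp a * kexp b"
proof -
  \<comment> \<open>The monoid \<open>nat\<close> is an arbitrary choice: any algebra in which the
    scalars embed transfers the law from \<open>hexp\<close>.\<close>
  have "(scalar (kexp (a + b)) :: (nat, 'a) calg) = scalar (kexp a * kexp b)"
    by (simp only: scalar_kexp scalar_add scalar_mult hexp_add_exact[OF scalar_commute])
  then show ?thesis by (simp only: scalar_inject)
qed

lemma kexp_0 [simp]: "kexp 0 = 1"
  by (simp add: kexp_def)

lemma kexp_minus: "inverse (kexp a) = kexp (- a)"
proof -
  have "kexp a * kexp (- a) = 1" by (simp flip: kexp_add)
  then show ?thesis by (rule fps_inverse_unique)
qed

lemma q_half_kexp: "q_half p = kexp (fps_const (1 / 2) * p)"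
  by (simp add: q_half_def kexp_def mult.assoc)

section \<open>Tensor squares\<close>

definition lft :: "('m::monoid_add, 'k::field_char_0) calg \<Rightarrow> ('m \<times> 'm, 'k) calg" where
  "lft = lin_ext (\<lambda>u. monom (u, 0))"

definition rgt :: "('m::monoid_add, 'k::field_char_0) calg \<Rightarrow> ('m \<times> 'm, 'k) calg" where
  "rgt = lin_ext (\<lambda>u. monom (0, u))"

lemma monom_0_0 [simp]: "monom (0, 0) = 1"
  by (metis monom_0 zero_prod_def)

lemma khom_lft: "khom lft" and khom_rgt: "khom rgt"
  unfolding lft_def rgt_def by (rule khom_lin_ext; simp flip: monom_add)+

text \<open>As \<open>lft a\<close> is a \<otimes> 1 and \<open>rgt b\<close> is 1 \<otimes> b,
  tensor calculations become products of two commuting homomorphic images.\<close>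

lemma tens_lft_rgt: "tens a b = lft a * rgt b"
  by (simp add: tens_def lft_def rgt_def)

lemma tens_1_right: "tens a 1 = lft a" and tens_1_left: "tens 1 a = rgt a"
  by (simp_all add: tens_lft_rgt khom_1 khom_lft khom_rgt)

lemma tens_monom: "tens (monom u) (monom v) = monom (u, v)"
  by (simp add: tens_lft_rgt lft_def rgt_def flip: monom_add)

lemma lft_rgt_commute: "rgt b * lft a = lft a * rgt b"
proof -
  have *: "rgt (monom v) * lft (monom u) = lft (monom u) * rgt (monom v)" for u v :: 'a
    by (simp add: lft_def rgt_def flip: monom_add)
  have "rgt b * lft (monom u) = lft (monom u) * rgt b" for u
    by (rule klinear_unique[where L = "\<lambda>b. rgt b * lft (monom u)" and M = "\<lambda>b. lft (monom u) * rgt b"])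
      (rule klinear_mult_right[OF khom_klinear[OF khom_rgt]],
       rule klinear_mult_left[OF khom_klinear[OF khom_rgt]], rule *)
  then show ?thesis
    by (rule klinear_unique[where L = "\<lambda>a. rgt b * lft a" and M = "\<lambda>a. lft a * rgt b",
        OF klinear_mult_left[OF khom_klinear[OF khom_lft]] klinear_mult_right[OF khom_klinear[OF khom_lft]]])
qed

lemma lft_rgt_left_commute: "rgt b * (lft a * c) = lft a * (rgt b * c)"
  by (simp only: mult.assoc[symmetric] lft_rgt_commute)

lemma tens_mult: "tens a b * tens c d = tens (a * c) (b * d)"
  by (simp add: tens_lft_rgt khom_mult khom_lft khom_rgt mult.assoc lft_rgt_left_commute)

lemma klinear_tens_left: "klinear (\<lambda>a. tens a b)"
  unfolding tens_lft_rgt by (rule klinear_mult_right[OF khom_klinear[OF khom_lft]])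

lemma klinear_tens_right: "klinear (\<lambda>b. tens a b)"
  unfolding tens_lft_rgt by (rule klinear_mult_left[OF khom_klinear[OF khom_rgt]])

lemma monom_pair: "monom u = tens (monom (fst u)) (monom (snd u))"
  by (simp add: tens_monom)

definition tens_map ::
  "(('m::monoid_add, 'k::field_char_0) calg \<Rightarrow> ('m'::monoid_add, 'k) calg)
    \<Rightarrow> ('m \<times> 'm, 'k) calg \<Rightarrow> ('m' \<times> 'm', 'k) calg" where
  "tens_map L = lin_ext (\<lambda>u. tens (L (monom (fst u))) (L (monom (snd u))))"

lemma khom_tens_map: "khom L \<Longrightarrow> khom (tens_map L)"
  unfolding tens_map_def
  by (rule khom_lin_ext)
    (simp_all add: khom_1 khom_mult monom_add tens_mult tens_1_left khom_rgt)

lemma tens_map_tens: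
  assumes "khom L" shows "tens_map L (tens a b) = tens (L a) (L b)"
proof -
  note T = khom_klinear[OF khom_tens_map[OF assms]] and L = khom_klinear[OF assms]
  have *: "tens_map L (tens (monom u) (monom v)) = tens (L (monom u)) (L (monom v))" for u v
    by (simp add: tens_monom tens_map_def)
  have "tens_map L (tens (monom u) b) = tens (L (monom u)) (L b)" for u
    by (rule klinear_unique[where L = "\<lambda>b. tens_map L (tens (monom u) b)" and M = "\<lambda>b. tens (L (monom u)) (L b)"])
      (rule klinear_comp[OF T klinear_tens_right], rule klinear_comp[OF klinear_tens_right L], rule *)
  then show ?thesis
    by (rule klinear_unique[where L = "\<lambda>a. tens_map L (tens a b)" and M = "\<lambda>a. tens (L a) (L b)",
        OF klinear_comp[OF T klinear_tens_left] klinear_comp[OF klinear_tens_left L]])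
qed

lemma tens_map_lft: "khom L \<Longrightarrow> tens_map L (lft a) = lft (L a)"
  and tens_map_rgt: "khom L \<Longrightarrow> tens_map L (rgt a) = rgt (L a)"
  using tens_map_tens[of L a 1] tens_map_tens[of L 1 a] by (simp_all add: khom_1 tens_1_left tens_1_right)

lemma tens_map_inverse:
  assumes "khom L" "khom M" "\<And>x. L (M x) = x"
  shows "tens_map L (tens_map M x) = x"
proof (rule klinear_unique[where L = "\<lambda>x. tens_map L (tens_map M x)" and M = "\<lambda>x. x"])
  show "klinear (\<lambda>x. tens_map L (tens_map M x))"
    by (rule khom_klinear[OF khom_comp[OF khom_tens_map[OF assms(1)] khom_tens_map[OF assms(2)]]])
  show "tens_map L (tens_map M (monom u)) = monom u" for u
    by (subst (1 2) monom_pair) (simp add: tens_map_tens assms)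
qed (rule klinear_id)

lemma cideal_tensor_ideal: "cideal (tensor_ideal J)"
  unfolding tensor_ideal_def by (rule cideal_closed_ideal)

lemma tensor_ideal_eqv:
  assumes "cideal J" "a \<approx>[J] b" "c \<approx>[J] d"
  shows "tens a c \<approx>[tensor_ideal J] tens b d"
proof -
  interpret cideal "tensor_ideal J" by (rule cideal_tensor_ideal)
  have "lft x \<in> tensor_ideal J" "rgt x \<in> tensor_ideal J" if "x \<in> J" for x
    using that closed_ideal_superset[of "{tens a 1 |a. a \<in> J} \<union> {tens 1 a |a. a \<in> J}"]
    unfolding tensor_ideal_def tens_1_left tens_1_right by blast+
  then have "lft a \<approx>[tensor_ideal J] lft b" "rgt c \<approx>[tensor_ideal J] rgt d"
    using assms(2,3) unfolding eqm_def by (metis khom_diff khom_lft khom_rgt)+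
  then show ?thesis
    unfolding tens_lft_rgt by (rule eqv_mult)
qed

lemma tens_map_tensor_ideal:
  assumes "khom L" "L ` J' \<subseteq> J"
  shows "tens_map L ` tensor_ideal J' \<subseteq> tensor_ideal J"
proof -
  have "tens_map L ` ({tens a 1 |a. a \<in> J'} \<union> {tens 1 a |a. a \<in> J'}) \<subseteq> {tens a 1 |a. a \<in> J} \<union> {tens 1 a |a. a \<in> J}"
  proof (rule image_subsetI)
    fix x assume "x \<in> {tens a 1 |a. a \<in> J'} \<union> {tens 1 a |a. a \<in> J'}"
    then obtain a where "a \<in> J'" "x = tens a 1 \<or> x = tens 1 a" by blast
    then have "L a \<in> J" "tens_map L x = tens (L a) 1 \<or> tens_map L x = tens 1 (L a)"
      using assms by (auto simp: tens_map_tens khom_1)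
    then show "tens_map L x \<in> {tens a 1 |a. a \<in> J} \<union> {tens 1 a |a. a \<in> J}" by blast
  qed
  also have "\<dots> \<subseteq> tensor_ideal J"
    unfolding tensor_ideal_def by (rule closed_ideal_superset)
  finally show ?thesis
    unfolding tensor_ideal_def[of J']
    by (intro khom_closed_ideal khom_tens_map assms cideal_tensor_ideal)
qed

section \<open>Quotient algebras\<close>

lemma cls_image: "cls J a = (\<lambda>j. j + a) ` J"
  by (auto simp: a_r_coset_def r_coset_def)

lemma quot_algebra_simps:
  "carrier (quot_algebra J) = range (cls J)"
  "mult (quot_algebra J) = rcoset_mult full_ring J"
  "one (quot_algebra J) = cls J 1"
  "zero (quot_algebra J) = J"
  "add (quot_algebra J) = set_add full_ring"
  "smult (quot_algebra J) c X = rcoset_mult full_ring J (cls J (scalar c)) X"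
  by (auto simp: quot_algebra_def ring.defs module.defs FactRing_def A_RCOSETS_def RCOSETS_def a_r_coset_def)

context cideal
begin

lemma mem_cls: "x \<in> cls J a \<longleftrightarrow> x \<approx>[J] a"
  unfolding cls_image eqm_def by (auto intro: image_eqI[of _ _ "x - a"])

lemma cls_self: "a \<in> cls J a"
  by (simp add: mem_cls)

lemma cls_eq_iff: "cls J a = cls J b \<longleftrightarrow> a \<approx>[J] b"
proof
  assume "cls J a = cls J b"
  then show "a \<approx>[J] b" using cls_self[of a] unfolding mem_cls[symmetric] by simp
next
  assume ab: "a \<approx>[J] b"
  show "cls J a = cls J b"
  proof (rule Set.set_eqI)
    show "x \<in> cls J a \<longleftrightarrow> x \<in> cls J b" for x
      unfolding mem_cls using ab eqv_trans[of x a b] eqv_trans[of x b a] eqv_sym[of a b] by blast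
  qed
qed

lemma cls_eqI: "x \<in> cls J a \<Longrightarrow> cls J x = cls J a"
  by (simp add: mem_cls cls_eq_iff)

lemma cls_0: "cls J 0 = J"
  by (simp add: cls_image)

lemma cls_mult: "rcoset_mult full_ring J (cls J a) (cls J b) = cls J (a * b)"
proof -
  have *: "cls J (x * y) = cls J (a * b)" if "x \<in> cls J a" "y \<in> cls J b" for x y
    using that by (simp add: cls_eq_iff mem_cls eqv_mult)
  have "rcoset_mult full_ring J (cls J a) (cls J b) = (\<Union>x\<in>cls J a. \<Union>y\<in>cls J b. cls J (a * b))"
    unfolding rcoset_mult_def full_ring_simps by (intro SUP_cong refl *)
  moreover have "cls J a \<noteq> {}" "cls J b \<noteq> {}"
    using cls_self by blast+
  ultimately show ?thesis by (simp only: UN_constant if_False)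
qed

lemma cls_add: "set_add full_ring (cls J a) (cls J b) = cls J (a + b)"
proof
  show "set_add full_ring (cls J a) (cls J b) \<subseteq> cls J (a + b)"
    by (auto simp: set_add_def set_mult_def mem_cls eqv_add)
  show "cls J (a + b) \<subseteq> set_add full_ring (cls J a) (cls J b)"
  proof
    fix x assume "x \<in> cls J (a + b)"
    then have "x - b \<in> cls J a" by (simp add: mem_cls eqm_def algebra_simps)
    then show "x \<in> set_add full_ring (cls J a) (cls J b)"
      using cls_self[of b] by (simp add: set_add_def set_mult_def) (metis diff_add_cancel)
  qed
qed

text \<open>Coproduct and antipode of a coset are unions over its representatives. Distributing the
  product over the union makes it unnecessary to know that the union is a single coset.\<close>

lemma rcoset_mult_UN_right:
  "rcoset_mult full_ring J (cls J a) (\<Union>x\<in>X. cls J (f x)) = (\<Union>x\<in>X. cls J (a * f x))"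
proof -
  have "rcoset_mult full_ring J (cls J a) (\<Union>x\<in>X. cls J (f x)) =
      (\<Union>x\<in>X. rcoset_mult full_ring J (cls J a) (cls J (f x)))"
    by (auto simp: rcoset_mult_def)
  then show ?thesis by (simp add: cls_mult)
qed

lemma rcoset_mult_UN_left:
  "rcoset_mult full_ring J (\<Union>x\<in>X. cls J (f x)) (cls J a) = (\<Union>x\<in>X. cls J (f x * a))"
proof -
  have "rcoset_mult full_ring J (\<Union>x\<in>X. cls J (f x)) (cls J a) =
      (\<Union>x\<in>X. rcoset_mult full_ring J (cls J (f x)) (cls J a))"
    by (auto simp: rcoset_mult_def)
  then show ?thesis by (simp add: cls_mult)
qed

end

lemma ring_quot_algebra:
  assumes "cideal J"
  shows "ring (quot_algebra J)"
proof -
  interpret cideal J by fact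
  have zero: "\<zero>\<^bsub>quot_algebra J\<^esub> = cls J 0"
    by (simp add: quot_algebra_simps cls_0)
  have ac: "abelian_group (quot_algebra J)"
  proof (rule abelian_groupI)
    fix X assume "X \<in> carrier (quot_algebra J)"
    then obtain x where "X = cls J x" by (auto simp: quot_algebra_simps)
    then have "cls J (- x) \<oplus>\<^bsub>quot_algebra J\<^esub> X = cls J 0"
      by (simp add: quot_algebra_simps cls_add)
    then show "\<exists>Y\<in>carrier (quot_algebra J). Y \<oplus>\<^bsub>quot_algebra J\<^esub> X = \<zero>\<^bsub>quot_algebra J\<^esub>"
      unfolding zero by (rule bexI) (simp add: quot_algebra_simps)
  qed (unfold zero, auto simp: quot_algebra_simps cls_add add_ac)
  moreover have "Group.monoid (quot_algebra J)"
    by (rule monoidI) (auto simp: quot_algebra_simps cls_mult mult.assoc)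
  ultimately show ?thesis
    by (rule ringI) (auto simp: quot_algebra_simps cls_mult cls_add algebra_simps)
qed

section \<open>Closed subalgebras\<close>

locale closed_alg =
  fixes U :: "('m::monoid_add, 'k::field_char_0) calg set"
  assumes one_mem: "1 \<in> U"
    and plus_mem: "a \<in> U \<Longrightarrow> b \<in> U \<Longrightarrow> a + b \<in> U"
    and times_mem: "a \<in> U \<Longrightarrow> b \<in> U \<Longrightarrow> a * b \<in> U"
    and scalar_mult_mem: "a \<in> U \<Longrightarrow> scalar c * a \<in> U"
    and closed_U: "closed U"
begin

lemma null_mem: "0 \<in> U"
  using scalar_mult_mem[OF one_mem, of 0] by simp

lemma uminus_mem: "a \<in> U \<Longrightarrow> - a \<in> U"
  using scalar_mult_mem[of a "-1"] by (simp add: scalar_minus)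

lemma sums_mem: "(\<And>i. i \<in> S \<Longrightarrow> f i \<in> U) \<Longrightarrow> sum f S \<in> U"
  by (induction S rule: infinite_finite_induct) (auto intro: plus_mem null_mem)

lemma power_mem: "a \<in> U \<Longrightarrow> a ^ n \<in> U"
  by (induction n) (auto intro: one_mem times_mem)

lemma PS_in: assumes "\<And>n. f n \<in> U" shows "PS f \<in> U"
proof -
  have "fps_X ^ n * f n \<in> U" for n
    using scalar_mult_mem[OF assms[of n], of "fps_X ^ n"] by (simp add: scalar_power)
  then have "\<exists>s\<in>U. \<forall>k<N. fps_nth (PS f) k = fps_nth s k" for N
    unfolding agree_iff using PS_truncate[of f N] sums_mem[of "{..<N}" "\<lambda>n. fps_X ^ n * f n"] by blast
  then show ?thesis
    using closed_U unfolding closed_fps_iff by blast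
qed

lemma hexp_mem: "a \<in> U \<Longrightarrow> hexp a \<in> U"
  unfolding hexp_def dp_def by (intro PS_in scalar_mult_mem power_mem)

end

lemma closed_alg_UNIV: "closed_alg UNIV"
  by unfold_locales auto

lemma closed_alg_vimage:
  assumes "khom L" "closed_alg U"
  shows "closed_alg (L -` U)"
proof -
  interpret closed_alg U by fact
  show ?thesis
    by unfold_locales (auto simp: khom_1 khom_add khom_mult khom_scalar assms(1)
      one_mem plus_mem times_mem scalar_mult_mem
      intro: closed_vimage_klinear[OF khom_klinear[OF assms(1)]] closed_U)
qed

definition closed_alg_hull :: "('m::monoid_add, 'k::field_char_0) calg set \<Rightarrow> ('m, 'k) calg set" where
  "closed_alg_hull S = \<Inter>{U. closed_alg U \<and> S \<subseteq> U}"

lemma closed_alg_hull: "closed_alg (closed_alg_hull S)"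
  unfolding closed_alg_hull_def
  by unfold_locales (auto intro: closed_alg.one_mem closed_alg.plus_mem closed_alg.times_mem
      closed_alg.scalar_mult_mem closed_alg.closed_U closed_Inter)

lemma closed_alg_hull_superset: "S \<subseteq> closed_alg_hull S"
  unfolding closed_alg_hull_def by auto

lemma closed_alg_hull_minimal: "closed_alg U \<Longrightarrow> S \<subseteq> U \<Longrightarrow> closed_alg_hull S \<subseteq> U"
  unfolding closed_alg_hull_def by auto

lemma khom_closed_alg_hull:
  assumes "khom L" "L ` S \<subseteq> closed_alg_hull T"
  shows "L ` closed_alg_hull S \<subseteq> closed_alg_hull T"
  using closed_alg_hull_minimal[OF closed_alg_vimage[OF assms(1) closed_alg_hull[of T]], of S] assms(2)
  by auto

context cideal
begin

text \<open>A subalgebra containing \<open>J\<close> is a union of cosets, so membership can be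
  tested on any representative.\<close>

lemma cls_mem_image_iff:
  assumes "closed_alg U" "J \<subseteq> U"
  shows "cls J a \<in> cls J ` U \<longleftrightarrow> a \<in> U"
proof
  interpret closed_alg U by fact
  assume "cls J a \<in> cls J ` U"
  then obtain u where "u \<in> U" "a \<approx>[J] u" by (auto simp: cls_eq_iff)
  then have "(a - u) + u \<in> U"
    using assms(2) by (intro plus_mem) (auto simp: eqm_def)
  then show "a \<in> U" by simp
qed auto

lemma Union_cls_image:
  assumes "closed_alg U" "J \<subseteq> U"
  shows "\<Union>(cls J ` U) = U"
proof
  show "\<Union>(cls J ` U) \<subseteq> U"
  proof
    fix x assume "x \<in> \<Union>(cls J ` U)"
    then obtain u where "u \<in> U" "cls J x = cls J u" using cls_eqI by auto
    then show "x \<in> U" using cls_mem_image_iff[OF assms, of x] by simp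
  qed
qed (use cls_self in auto)

lemma subring_cls_image:
  assumes "closed_alg U" "J \<subseteq> U"
  shows "subring (cls J ` U) (quot_algebra J)"
proof (rule ring.subringI[OF ring_quot_algebra[OF cideal_axioms]])
  interpret U: closed_alg U by fact
  interpret Q: ring "quot_algebra J" by (rule ring_quot_algebra[OF cideal_axioms])
  fix X Y assume X: "X \<in> cls J ` U" and Y: "Y \<in> cls J ` U"
  then obtain x y where xy: "X = cls J x" "Y = cls J y" "x \<in> U" "y \<in> U" by auto
  then show "X \<otimes>\<^bsub>quot_algebra J\<^esub> Y \<in> cls J ` U" "X \<oplus>\<^bsub>quot_algebra J\<^esub> Y \<in> cls J ` U"
    by (auto simp: quot_algebra_simps cls_mult cls_add U.times_mem U.plus_mem)
  have "\<ominus>\<^bsub>quot_algebra J\<^esub> X = cls J (- x)"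
    by (rule Q.minus_equality) (auto simp: quot_algebra_simps cls_add cls_0 xy)
  then show "\<ominus>\<^bsub>quot_algebra J\<^esub> X \<in> cls J ` U"
    using xy U.uminus_mem by auto
qed (use closed_alg.one_mem[OF assms(1)] in \<open>auto simp: quot_algebra_simps\<close>)

text \<open>Closed subalgebras of the quotient correspond to closed subalgebras of the covering
  algebra that contain \<open>J\<close>, by B \<mapsto> \<Union>B; hence \<open>J\<close> is
  adjoined to the generators.\<close>

lemma closed_subalgebra_cls:
  "closed_subalgebra (quot_algebra J) (cls J ` S) = cls J ` closed_alg_hull (S \<union> J)"
proof
  let ?U = "closed_alg_hull (S \<union> J)"
  interpret U: closed_alg ?U by (rule closed_alg_hull)
  have sub: "S \<union> J \<subseteq> ?U" by (rule closed_alg_hull_superset)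
  then have J: "J \<subseteq> ?U" by simp
  have "subring (cls J ` ?U) (quot_algebra J)"
    by (rule subring_cls_image[OF closed_alg_hull J])
  moreover have "c \<odot>\<^bsub>quot_algebra J\<^esub> x \<in> cls J ` ?U" if "x \<in> cls J ` ?U" for c x
    using that by (auto simp: quot_algebra_simps cls_mult U.scalar_mult_mem)
  moreover have "closed (\<Union>(cls J ` ?U))"
    unfolding Union_cls_image[OF closed_alg_hull J] by (rule U.closed_U)
  moreover have "cls J ` S \<subseteq> cls J ` ?U"
    using sub by auto
  ultimately show "closed_subalgebra (quot_algebra J) (cls J ` S) \<subseteq> cls J ` ?U"
    unfolding closed_subalgebra_def by blast
  show "cls J ` ?U \<subseteq> closed_subalgebra (quot_algebra J) (cls J ` S)"
    unfolding closed_subalgebra_def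
  proof (rule Inter_greatest)
    fix B assume "B \<in> {B. subring B (quot_algebra J) \<and> (\<forall>c. \<forall>x\<in>B. c \<odot>\<^bsub>quot_algebra J\<^esub> x \<in> B) \<and> closed (\<Union> B) \<and> cls J ` S \<subseteq> B}"
    then have B: "subring B (quot_algebra J)" "\<And>c x. x \<in> B \<Longrightarrow> c \<odot>\<^bsub>quot_algebra J\<^esub> x \<in> B"
      "closed (\<Union> B)" "cls J ` S \<subseteq> B"
      by auto
    have car: "B \<subseteq> range (cls J)"
      using subringE(1)[OF B(1)] by (simp add: quot_algebra_simps)
    have mem: "a \<in> \<Union>B \<longleftrightarrow> cls J a \<in> B" for a
    proof
      assume "a \<in> \<Union>B"
      then obtain X where X: "X \<in> B" "a \<in> X" by auto
      then obtain x where "X = cls J x" using car by auto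
      with X show "cls J a \<in> B" using cls_eqI[of a x] by simp
    qed (use cls_self in auto)
    have zero: "cls J 0 \<in> B"
      using subringE(2)[OF B(1)] by (simp add: quot_algebra_simps cls_0)
    have "closed_alg (\<Union>B)"
    proof
      show "1 \<in> \<Union>B"
        unfolding mem using subringE(3)[OF B(1)] by (simp add: quot_algebra_simps)
      fix a assume a: "a \<in> \<Union>B"
      show "a + b \<in> \<Union>B" "a * b \<in> \<Union>B" if b: "b \<in> \<Union>B" for b
        using a b subringE(6,7)[OF B(1), of "cls J a" "cls J b"]
        unfolding mem by (simp_all add: quot_algebra_simps cls_mult cls_add)
      show "scalar c * a \<in> \<Union>B" for c
        using a B(2)[of "cls J a" c] unfolding mem by (simp add: quot_algebra_simps cls_mult)
    qed (rule B(3))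
    moreover have "S \<union> J \<subseteq> \<Union>B"
    proof
      fix a assume "a \<in> S \<union> J"
      then show "a \<in> \<Union>B"
        using B(4) zero cls_eq_iff[of a 0] unfolding mem by (auto simp: eqv_0_iff)
    qed
    ultimately have "?U \<subseteq> \<Union>B"
      by (rule closed_alg_hull_minimal)
    then show "cls J ` ?U \<subseteq> B"
      using mem by auto
  qed
qed

end

section \<open>Calculus in the quantised enveloping algebra\<close>

lemma (in cideal) eqv_assoc: "a * b \<approx>[J] c * d \<Longrightarrow> a * (b * z) \<approx>[J] c * (d * z)"
  using eqv_mult_right[of "a * b" "c * d" z] by (simp add: mult.assoc)

lemma exp_tor_hexp: "exp_tor x = hexp (gen (Tor x))"
  by (simp add: exp_tor_def cexp_X_mult)

lemma exp_neg_tor_hexp: "exp_neg_tor x = hexp (- gen (Tor x))"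
  using cexp_X_mult[of "- gen (Tor x)"] by (simp add: exp_neg_tor_def)

text \<open>Both exponentials are 1 plus a multiple of \<hbar>, so the shift divides their
  difference exactly. This happens in the free algebra, where torsion cannot interfere.\<close>

lemma cartan_quotient_hexp1:
  "(cartan_quotient q x y :: ('n, 'h, 'k::field_char_0) qfree) =
    (hexp1 (gen (Tor x)) - hexp1 (- gen (Tor y))) * scalar (inverse (fps_shift 1 (q - inverse q)))"
proof -
  have "hexp a - hexp b = fps_X * (hexp1 a - hexp1 b)" for a b :: "('n, 'h, 'k) qfree"
    by (simp add: hexp_hexp1 right_diff_distrib)
  then have "fps_shift 1 (hexp a - hexp b) = hexp1 a - hexp1 b" for a b :: "('n, 'h, 'k) qfree"
    by (simp add: fps_eq_iff del: fps_sub_nth)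
  then show ?thesis
    by (simp add: cartan_quotient_def exp_tor_hexp exp_neg_tor_hexp)
qed

lemma (in cideal) commute_power_scalar:
  assumes "x * e \<approx>[J] scalar a * (e * x)"
  shows "x ^ p * e \<approx>[J] scalar (a ^ p) * (e * x ^ p)"
proof (induction p)
  case (Suc p)
  have "x ^ Suc p * e = x * (x ^ p * e)" by (simp add: mult.assoc)
  also have "\<dots> \<approx>[J] x * (scalar (a ^ p) * (e * x ^ p))" by (rule eqv_mult_left[OF Suc])
  also have "\<dots> = scalar (a ^ p) * (x * e * x ^ p)" by (simp add: scalar_left_commute mult.assoc)
  also have "\<dots> \<approx>[J] scalar (a ^ p) * (scalar a * (e * x) * x ^ p)"
    by (intro eqv_mult_left eqv_mult_right assms)
  also have "\<dots> = scalar (a ^ Suc p) * (e * x ^ Suc p)"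
    by (simp only: power_Suc2[of a] scalar_mult power_Suc[of x] mult.assoc)
  finally show ?case .
qed simp

lemma (in cideal) commute_scalar_power:
  assumes "x * e \<approx>[J] scalar a * (e * x)"
  shows "x * e ^ p \<approx>[J] scalar (a ^ p) * (e ^ p * x)"
proof (induction p)
  case (Suc p)
  have "x * e ^ Suc p = x * e * e ^ p" by (simp add: mult.assoc)
  also have "\<dots> \<approx>[J] scalar a * (e * x) * e ^ p" by (rule eqv_mult_right[OF assms])
  also have "\<dots> = scalar a * (e * (x * e ^ p))" by (simp add: mult.assoc)
  also have "\<dots> \<approx>[J] scalar a * (e * (scalar (a ^ p) * (e ^ p * x)))" by (intro eqv_mult_left Suc)
  also have "\<dots> = scalar (a ^ Suc p) * (e ^ Suc p * x)"
    by (simp only: scalar_left_commute[of e] power_Suc scalar_mult mult.assoc)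
  finally show ?case .
qed simp

lemma (in cideal) product_power:
  assumes "x * e \<approx>[J] e * x"
  shows "(e * x) ^ p \<approx>[J] e ^ p * x ^ p"
proof (induction p)
  case (Suc p)
  have xe: "x * e ^ p \<approx>[J] e ^ p * x"
    using commute_scalar_power[of x e 1 p] assms by simp
  have "(e * x) ^ Suc p \<approx>[J] e * x * (e ^ p * x ^ p)"
    using eqv_mult_left[OF Suc] by simp
  also have "\<dots> = e * (x * e ^ p) * x ^ p" by (simp add: mult.assoc)
  also have "\<dots> \<approx>[J] e * (e ^ p * x) * x ^ p" by (intro eqv_mult_right eqv_mult_left xe)
  finally show ?case by (simp add: mult.assoc)
qed simp

text \<open>All \<open>e\<close> and \<open>e'\<close> are moved to the left. Only two kinds of
  crossing cost a scalar: \<open>e'\<close> passes p copies of \<open>x\<close>, with factor a each,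
  and r copies of \<open>e\<close> pass \<open>x'\<close>, with factor b each.\<close>

lemma (in cideal) twisted_word:
  assumes xe: "x * e \<approx>[J] e * x" and xe': "x * e' \<approx>[J] scalar a * (e' * x)"
    and x'e: "x' * e \<approx>[J] scalar b * (e * x')" and ee': "e' * e \<approx>[J] e * e'"
  shows "(e * x) ^ p * (e' * x') * (e * x) ^ r \<approx>[J]
    scalar (a ^ p * b ^ r) * (e ^ (p + r) * e' * (x ^ p * x' * x ^ r))"
proof -
  have xer: "x ^ p * e ^ r \<approx>[J] e ^ r * x ^ p"
    using commute_power_scalar[of x "e ^ r" 1 p] commute_scalar_power[of x e 1 r] xe by simp
  have e'r: "e' * e ^ r \<approx>[J] e ^ r * e'"
    using commute_scalar_power[of e' e 1 r] ee' by simp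
  have "(e * x) ^ p * (e' * x') * (e * x) ^ r \<approx>[J] e ^ p * x ^ p * (e' * x') * (e ^ r * x ^ r)"
    by (intro eqv_mult product_power xe eqv_refl)
  also have "\<dots> = e ^ p * (x ^ p * e') * (x' * e ^ r) * x ^ r" by (simp add: mult.assoc)
  also have "\<dots> \<approx>[J] e ^ p * (scalar (a ^ p) * (e' * x ^ p)) * (scalar (b ^ r) * (e ^ r * x')) * x ^ r"
    by (intro eqv_mult eqv_refl commute_power_scalar commute_scalar_power xe' x'e)
  also have "\<dots> = scalar (a ^ p) * scalar (b ^ r) * (e ^ p * e' * (x ^ p * e ^ r) * x' * x ^ r)"
    by (simp only: scalar_left_commute[of "e ^ p"] scalar_left_commute[of "x ^ p"]
        scalar_left_commute[of "e'"] mult.assoc)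
  also have "\<dots> \<approx>[J] scalar (a ^ p) * scalar (b ^ r) * (e ^ p * e' * (e ^ r * x ^ p) * x' * x ^ r)"
    by (intro eqv_mult_left eqv_mult_right xer)
  also have "\<dots> = scalar (a ^ p) * scalar (b ^ r) * (e ^ p * (e' * e ^ r) * (x ^ p * x' * x ^ r))"
    by (simp only: mult.assoc)
  also have "\<dots> \<approx>[J] scalar (a ^ p) * scalar (b ^ r) * (e ^ p * (e ^ r * e') * (x ^ p * x' * x ^ r))"
    by (intro eqv_mult_left eqv_mult_right e'r)
  also have "\<dots> = scalar (a ^ p * b ^ r) * (e ^ (p + r) * e' * (x ^ p * x' * x ^ r))"
    by (simp only: scalar_mult power_add mult.assoc)
  finally show ?thesis .
qed

section \<open>Commutation rules drawn from the defining relations\<close>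

locale quea_calculus =
  fixes A :: "int ^ 'n ^ 'n" and d :: "'n::finite \<Rightarrow> nat" and P :: "'k::field_char_0 fps ^ 'n ^ 'n"
    and R :: "('n, 'k, 'h::ab_group_add) realization"
  assumes real: "is_realization P R"
begin

abbreviation J :: "('n, 'h, 'k) qfree set" where "J \<equiv> quea_ideal A d P R"
abbreviation T :: "'h \<Rightarrow> ('n, 'h, 'k) qfree" where "T x \<equiv> gen (Tor x)"
abbreviation E :: "'n \<Rightarrow> ('n, 'h, 'k) qfree" where "E i \<equiv> gen (Egen i)"
abbreviation F :: "'n \<Rightarrow> ('n, 'h, 'k) qfree" where "F i \<equiv> gen (Fgen i)"

sublocale cideal J
  unfolding quea_ideal_def by (rule cideal_closed_ideal)

lemma module_R: "Modules.module (scale R)"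
  and root_hom: "module_hom (scale R) (*) (root R j)"
  and root_Tplus: "root R j (Tplus R i) = P $ i $ j"
  and root_Tminus: "root R j (Tminus R i) = P $ j $ i"
  using real by (auto simp: is_realization_def)

sublocale h: Modules.module "scale R" by (rule module_R)

lemma root_add: "root R j (x + y) = root R j x + root R j y"
  and root_scale: "root R j (scale R c x) = c * root R j x"
  using root_hom[of j] by (auto simp: module_hom.add module_hom.scale)

lemma root_0: "root R j 0 = 0"
  using root_scale[of j 0 0] by simp

lemma root_minus: "root R j (- x) = - root R j x"
  using root_add[of j x "-x"] root_0[of j] by (simp add: eq_neg_iff_add_eq_0 add.commute)

lemma rel: "a \<in> quea_relations A d P R \<Longrightarrow> a \<in> J"
  unfolding quea_ideal_def using closed_ideal_superset by blast

lemma T_add: "T (x + y) \<approx>[J] T x + T y"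
  unfolding eqm_def by (rule rel) (auto simp: quea_relations_def)

lemma T_scale: "T (scale R c x) \<approx>[J] scalar c * T x"
  unfolding eqm_def by (rule rel) (auto simp: quea_relations_def)

lemma T_commute: "T x * T y \<approx>[J] T y * T x"
  unfolding eqm_def by (rule rel) (auto simp: quea_relations_def)

text \<open>With the root value placed beside \<open>T\<close>, the relation has the intertwining
  form a e = e b and can be exponentiated.\<close>

lemma T_E: "T x * E j \<approx>[J] E j * (T x + scalar (root R j x))"
proof -
  have "T x * E j - E j * T x - scalar (root R j x) * E j \<in> J"
    by (rule rel) (auto simp: quea_relations_def)
  then show ?thesis
    by (simp add: eqm_def distrib_left scalar_commute[of _ "E j"] diff_diff_eq)
qed

lemma T_F: "T x * F j \<approx>[J] F j * (T x + scalar (- root R j x))"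
proof -
  have "T x * F j - F j * T x + scalar (root R j x) * F j \<in> J"
    by (rule rel) (auto simp: quea_relations_def)
  then show ?thesis
    by (simp add: eqm_def distrib_left scalar_commute[of _ "F j"] scalar_minus algebra_simps)
qed

lemma E_F: "E i * F j - F j * E i \<approx>[J]
    (if i = j then cartan_quotient (q_param (d i)) (Tplus R i) (Tminus R i) else 0)"
  unfolding eqm_def by (rule rel) (auto simp: quea_relations_def)

lemma serre: "i \<noteq> j \<Longrightarrow> serre_E A d P i j \<approx>[J] 0" "i \<noteq> j \<Longrightarrow> serre_F A d P i j \<approx>[J] 0"
  unfolding eqv_0_iff by (rule rel; auto simp: quea_relations_def)+

lemma T_0: "T 0 \<approx>[J] 0"
  using T_scale[of 0 0] by simp

lemma T_minus: "T (- x) \<approx>[J] - T x"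
  using T_scale[of "-1" x] by (simp add: scalar_minus)

lemma T_sum: "T (\<Sum>i\<in>S. f i) \<approx>[J] (\<Sum>i\<in>S. T (f i))"
proof (induction S rule: infinite_finite_induct)
  case (insert i S)
  have "T (sum f (insert i S)) \<approx>[J] T (f i) + T (sum f S)"
    using insert T_add by simp
  also have "\<dots> \<approx>[J] T (f i) + (\<Sum>i\<in>S. T (f i))"
    by (intro eqv_add eqv_refl insert)
  finally show ?case using insert by simp
qed (simp_all add: T_0)

definition e :: "'h \<Rightarrow> ('n, 'h, 'k) qfree" where
  "e x = hexp (T x)"

lemma e_add: "e (x + y) \<approx>[J] e x * e y"
  unfolding e_def by (rule eqv_trans[OF hexp_cong[OF T_add] hexp_add[OF T_commute]])

lemma e_0: "e 0 \<approx>[J] 1"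
  unfolding e_def using hexp_cong[OF T_0] by simp

lemma e_commute: "e x * e y \<approx>[J] e y * e x"
  using eqv_trans[OF eqv_sym[OF e_add[of x y]]] e_add[of y x] by (simp add: add.commute)

lemma e_inverse: "e x * e (- x) \<approx>[J] 1"
  using eqv_trans[OF eqv_sym[OF e_add[of x "-x"]]] e_0 by simp

lemma T_e: "T x * e y \<approx>[J] e y * T x"
  using hexp_intertwine[OF T_commute[of y x]] unfolding e_def by (rule eqv_sym)

lemma hexp_minus_T: "hexp (- T x) \<approx>[J] e (- x)"
  unfolding e_def by (rule hexp_cong[OF eqv_sym[OF T_minus]])

text \<open>A common setting for E (weight \<alpha>_j), F (weight -\<alpha>_j) and toral elements
  (weight 0), so that each commutation rule is proved once.\<close>

definition weight_vec :: "('h \<Rightarrow> 'k fps) \<Rightarrow> ('n, 'h, 'k) qfree \<Rightarrow> bool" where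
  "weight_vec w X \<longleftrightarrow> (\<forall>x. T x * X \<approx>[J] X * (T x + scalar (w x)))"

lemma weight_vec_E: "weight_vec (root R j) (E j)"
  by (simp add: weight_vec_def T_E)

lemma weight_vec_F: "weight_vec (\<lambda>x. - root R j x) (F j)"
  by (simp add: weight_vec_def T_F)

lemma weight_vec_e_mult:
  assumes "weight_vec w X" shows "weight_vec w (e y * X)"
  unfolding weight_vec_def
proof
  fix x
  have "T x * (e y * X) \<approx>[J] e y * (T x * X)" by (rule eqv_assoc[OF T_e])
  also have "\<dots> \<approx>[J] e y * (X * (T x + scalar (w x)))"
    using assms by (intro eqv_mult_left) (simp add: weight_vec_def)
  finally show "T x * (e y * X) \<approx>[J] e y * X * (T x + scalar (w x))" by (simp add: mult.assoc)
qed

text \<open>Exponentiate T X = X (T + w): the scalar w is central, so it splits off as the factor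
  e^(\<hbar>w).\<close>

lemma weight_vec_e:
  assumes "weight_vec w X"
  shows "e x * X \<approx>[J] scalar (kexp (w x)) * (X * e x)"
proof -
  have "e x * X \<approx>[J] X * hexp (T x + scalar (w x))"
    unfolding e_def using assms by (intro hexp_intertwine) (simp add: weight_vec_def)
  also have "hexp (T x + scalar (w x)) = scalar (kexp (w x)) * e x"
    by (subst hexp_add_exact[OF scalar_commute[symmetric]])
      (simp add: e_def scalar_kexp[symmetric] scalar_commute[of _ "hexp (T x)"])
  finally show ?thesis by (simp only: scalar_left_commute)
qed

lemma weight_vec_e':
  assumes "weight_vec w X"
  shows "X * e x \<approx>[J] scalar (kexp (- w x)) * (e x * X)"
proof -
  have "X * e x = scalar (kexp (- w x) * kexp (w x)) * (X * e x)"
    by (simp flip: kexp_add)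
  also have "\<dots> = scalar (kexp (- w x)) * (scalar (kexp (w x)) * (X * e x))"
    by (simp only: scalar_mult mult.assoc)
  also have "\<dots> \<approx>[J] scalar (kexp (- w x)) * (e x * X)"
    by (intro eqv_mult_left eqv_sym[OF weight_vec_e] assms)
  finally show ?thesis .
qed

end

section \<open>The rescaled generators and the relations they satisfy\<close>

text \<open>
  The rescaling of generators is an automorphism of the free algebras already, since \<open>e\<^bsup>\<hbar>y\<^esup>\<close> is
  invertible there. Hence cosets can be transported as images of sets, and it is never necessary to
  know that coproduct and antipode respect the defining ideal. The elements \<open>y i\<close> are only required
  to represent \<open>Z i\<close> modulo that ideal: the inverse rescaling uses \<open>- T (Z i)\<close>, which differs from
  \<open>T (- Z i)\<close> in the free algebra.
\<close>

locale quea_iso =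
  R: quea_calculus A d P R + R': quea_calculus A d P' R'
  for A :: "int ^ 'n ^ 'n" and d :: "'n::finite \<Rightarrow> nat"
    and P :: "'k::field_char_0 fps ^ 'n ^ 'n" and R :: "('n, 'k, 'h::ab_group_add) realization"
    and P' :: "'k fps ^ 'n ^ 'n" and R' :: "('n, 'k, 'h'::ab_group_add) realization" +
  fixes f :: "'h' \<Rightarrow> 'h" and Z :: "'n \<Rightarrow> 'h" and y :: "'n \<Rightarrow> ('n, 'h, 'k) qfree"
  assumes f_hom: "module_hom (scale R') (scale R) f"
    and root_f: "root R j (f x) = root R' j x"
    and f_Tplus: "f (Tplus R' i) = Tplus R i + (Z i + Z i)"
    and f_Tminus: "f (Tminus R' i) = Tminus R i - (Z i + Z i)"
    and Z_antisym: "root R j (Z i) = - root R i (Z j)"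
    and y_Z: "y i \<approx>[R.J] R.T (Z i)"
begin

fun gen_image :: "('n, 'h') gen \<Rightarrow> ('n, 'h, 'k) qfree" where
  "gen_image (Tor x) = gen (Tor (f x))"
| "gen_image (Egen i) = hexp (y i) * gen (Egen i)"
| "gen_image (Fgen i) = hexp (y i) * gen (Fgen i)"

definition \<phi> :: "('n, 'h', 'k) qfree \<Rightarrow> ('n, 'h, 'k) qfree" where
  "\<phi> = alg_ext gen_image"

lemma khom_\<phi>: "khom \<phi>"
  unfolding \<phi>_def by (rule khom_alg_ext)

lemma \<phi>_gen [simp]: "\<phi> (gen x) = gen_image x"
  by (simp add: \<phi>_def)

lemma root_Z_self: "root R i (Z i) = 0"
  using Z_antisym[of i i] by simp

text \<open>Evaluate \<alpha>_j on f(T_i'^+) = T_i^+ + 2 Z_i. Antisymmetry then exchanges the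
  indices, because \<alpha>_i(Z_j) is the scalar that occurs in the reordering of words.\<close>

lemma P'_P: "P' $ i $ j = P $ i $ j - 2 * root R i (Z j)"
proof -
  have "P' $ i $ j = root R j (f (Tplus R' i))"
    by (simp add: root_f R'.root_Tplus)
  also have "\<dots> = P $ i $ j + (root R j (Z i) + root R j (Z i))"
    by (simp add: f_Tplus R.root_add R.root_Tplus)
  finally show ?thesis by (simp add: Z_antisym[of j i])
qed

lemma \<phi>_E: "hexp (y i) * R.E i \<approx>[R.J] R.e (Z i) * R.E i"
  and \<phi>_F: "hexp (y i) * R.F i \<approx>[R.J] R.e (Z i) * R.F i"
  unfolding R.e_def by (intro R.eqv_mult_right R.hexp_cong y_Z)+

lemma \<phi>_weight:
  assumes X: "R.weight_vec w X" "X' \<approx>[R.J] X" and w: "w (f x) = c"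
  shows "R.T (f x) * X' - X' * R.T (f x) - scalar c * X' \<approx>[R.J] 0"
proof -
  have "R.T (f x) * X' - X' * R.T (f x) - scalar c * X' \<approx>[R.J]
      R.T (f x) * X - X * R.T (f x) - scalar c * X"
    by (intro R.eqv_diff R.eqv_mult R.eqv_refl X)
  also have "\<dots> \<approx>[R.J] X * (R.T (f x) + scalar c) - X * R.T (f x) - scalar c * X"
    using X(1) w by (intro R.eqv_diff R.eqv_refl) (auto simp: R.weight_vec_def)
  finally show ?thesis by (simp add: distrib_left scalar_commute)
qed

text \<open>Moving e^(\<hbar>Z_j) past E_i costs e^(-\<hbar>\<alpha>_i(Z_j)), and moving
  e^(\<hbar>Z_i) past F_j costs e^(\<hbar>\<alpha>_j(Z_i)). The weights have opposite signs and the
  pairing is antisymmetric, so the two scalars coincide and the commutator factors.\<close>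

lemma \<phi>_E_F:
  "\<phi> (gen (Egen i)) * \<phi> (gen (Fgen j)) - \<phi> (gen (Fgen j)) * \<phi> (gen (Egen i)) \<approx>[R.J]
     scalar (kexp (- root R i (Z j))) * (R.e (Z i) * R.e (Z j) * (R.E i * R.F j - R.F j * R.E i))"
proof -
  let ?s = "scalar (kexp (- root R i (Z j))) :: ('n, 'h, 'k) qfree"
  have 1: "R.e (Z i) * R.E i * (R.e (Z j) * R.F j) \<approx>[R.J] ?s * (R.e (Z i) * R.e (Z j) * (R.E i * R.F j))"
  proof -
    have "R.e (Z i) * R.E i * (R.e (Z j) * R.F j) = R.e (Z i) * (R.E i * R.e (Z j)) * R.F j"
      by (simp add: mult.assoc)
    also have "\<dots> \<approx>[R.J] R.e (Z i) * (?s * (R.e (Z j) * R.E i)) * R.F j"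
      by (intro R.eqv_mult_left R.eqv_mult_right R.weight_vec_e' R.weight_vec_E)
    finally show ?thesis by (simp only: scalar_left_commute mult.assoc)
  qed
  have 2: "R.e (Z j) * R.F j * (R.e (Z i) * R.E i) \<approx>[R.J] ?s * (R.e (Z i) * R.e (Z j) * (R.F j * R.E i))"
  proof -
    have "R.e (Z j) * R.F j * (R.e (Z i) * R.E i) = R.e (Z j) * (R.F j * R.e (Z i)) * R.E i"
      by (simp add: mult.assoc)
    also have "\<dots> \<approx>[R.J] R.e (Z j) * (scalar (kexp (- (- root R j (Z i)))) * (R.e (Z i) * R.F j)) * R.E i"
      by (intro R.eqv_mult_left R.eqv_mult_right R.weight_vec_e'[OF R.weight_vec_F])
    also have "- (- root R j (Z i)) = - root R i (Z j)"
      by (simp add: Z_antisym[of j i])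
    also have "R.e (Z j) * (?s * (R.e (Z i) * R.F j)) * R.E i = ?s * ((R.e (Z j) * R.e (Z i)) * (R.F j * R.E i))"
      by (simp only: scalar_left_commute mult.assoc)
    also have "\<dots> \<approx>[R.J] ?s * ((R.e (Z i) * R.e (Z j)) * (R.F j * R.E i))"
      by (intro R.eqv_mult_left R.eqv_mult_right R.e_commute)
    finally show ?thesis .
  qed
  have "\<phi> (gen (Egen i)) * \<phi> (gen (Fgen j)) - \<phi> (gen (Fgen j)) * \<phi> (gen (Egen i)) \<approx>[R.J]
      R.e (Z i) * R.E i * (R.e (Z j) * R.F j) - R.e (Z j) * R.F j * (R.e (Z i) * R.E i)"
    unfolding \<phi>_gen gen_image.simps by (intro R.eqv_diff R.eqv_mult \<phi>_E \<phi>_F)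
  also have "\<dots> \<approx>[R.J] ?s * (R.e (Z i) * R.e (Z j) * (R.E i * R.F j)) - ?s * (R.e (Z i) * R.e (Z j) * (R.F j * R.E i))"
    by (intro R.eqv_diff 1 2)
  finally show ?thesis by (simp add: right_diff_distrib)
qed

lemma f_add: "f (x + x') = f x + f x'"
  and f_scale: "f (scale R' c x) = scale R c (f x)"
  using f_hom by (auto simp: module_hom.add module_hom.scale)

lemma T_Tplus: "R.T (f (Tplus R' i)) \<approx>[R.J] (R.T (Z i) + R.T (Z i)) + R.T (Tplus R i)"
proof -
  have "R.T (f (Tplus R' i)) \<approx>[R.J] R.T (Tplus R i) + R.T (Z i + Z i)"
    unfolding f_Tplus by (rule R.T_add)
  also have "\<dots> \<approx>[R.J] R.T (Tplus R i) + (R.T (Z i) + R.T (Z i))"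
    by (intro R.eqv_add R.T_add R.eqv_refl)
  finally show ?thesis by (simp add: add.commute)
qed

lemma T_Tminus: "- R.T (f (Tminus R' i)) \<approx>[R.J] (R.T (Z i) + R.T (Z i)) + (- R.T (Tminus R i))"
proof -
  have "R.T (f (Tminus R' i)) \<approx>[R.J] R.T (Tminus R i) + R.T (- (Z i + Z i))"
    unfolding f_Tminus diff_conv_add_uminus by (rule R.T_add)
  also have "\<dots> \<approx>[R.J] R.T (Tminus R i) + (- R.T (Z i + Z i))"
    by (intro R.eqv_add R.T_minus R.eqv_refl)
  also have "\<dots> \<approx>[R.J] R.T (Tminus R i) + (- (R.T (Z i) + R.T (Z i)))"
    by (intro R.eqv_add R.eqv_minus R.T_add R.eqv_refl)
  finally show ?thesis
    using R.eqv_minus by fastforce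
qed

text \<open>With W = 2 Z_i the exponents become W + T_i^+ and W - T_i^-. By \<open>hexp1_add\<close>
  the common term \<open>hexp1 W\<close> cancels and the common factor e^(\<hbar>W) remains, the
  same factor that the commutator acquires for i = j.\<close>

lemma \<phi>_cartan_quotient:
  "\<phi> (cartan_quotient q (Tplus R' i) (Tminus R' i)) \<approx>[R.J]
     R.e (Z i) * R.e (Z i) * cartan_quotient q (Tplus R i) (Tminus R i)"
proof -
  let ?W = "R.T (Z i) + R.T (Z i)"
  let ?u = "scalar (inverse (fps_shift 1 (q - inverse q))) :: ('n, 'h, 'k) qfree"
  have comm: "?W * R.T x \<approx>[R.J] R.T x * ?W" for x
    by (simp add: distrib_left distrib_right R.eqv_add R.T_commute)
  have comm': "?W * (- R.T x) \<approx>[R.J] - R.T x * ?W" for x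
    using R.eqv_minus[OF comm[of x]] by simp
  have W: "hexp ?W \<approx>[R.J] R.e (Z i) * R.e (Z i)"
    unfolding R.e_def by (rule R.hexp_add[OF R.eqv_refl])
  have "\<phi> (cartan_quotient q (Tplus R' i) (Tminus R' i)) =
      (hexp1 (R.T (f (Tplus R' i))) - hexp1 (- R.T (f (Tminus R' i)))) * ?u"
    by (simp add: cartan_quotient_hexp1 khom_mult khom_diff khom_hexp1 khom_minus khom_scalar khom_\<phi>)
  also have "\<dots> \<approx>[R.J] (hexp1 (?W + R.T (Tplus R i)) - hexp1 (?W + (- R.T (Tminus R i)))) * ?u"
    by (intro R.eqv_mult_right R.eqv_diff R.hexp1_cong T_Tplus T_Tminus)
  also have "\<dots> \<approx>[R.J] ((hexp1 ?W + hexp ?W * hexp1 (R.T (Tplus R i))) -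
      (hexp1 ?W + hexp ?W * hexp1 (- R.T (Tminus R i)))) * ?u"
    by (intro R.eqv_mult_right R.eqv_diff R.hexp1_add comm comm')
  also have "\<dots> = hexp ?W * cartan_quotient q (Tplus R i) (Tminus R i)"
    by (simp add: cartan_quotient_hexp1 right_diff_distrib left_diff_distrib mult.assoc)
  also have "\<dots> \<approx>[R.J] R.e (Z i) * R.e (Z i) * cartan_quotient q (Tplus R i) (Tminus R i)"
    by (intro R.eqv_mult_right W)
  finally show ?thesis .
qed

text \<open>Let s = \<alpha>_i(Z_j). Passing from P to P' multiplies each of the two half powers of
  q by e^(-\<hbar>s) per unit of k, and reordering contributes the exponents -s(m - k) + sk.
  Altogether -2sk - s(m - k) + sk = -sm, independent of k.\<close>

lemma serre_coeff_twist:
  assumes "k \<le> m"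
  shows "serre_coeff A d P' i j k * (kexp (- root R i (Z j)) ^ (m - k) * kexp (root R i (Z j)) ^ k) =
    serre_coeff A d P i j k * kexp (- root R i (Z j)) ^ m"
proof -
  define s where "s = root R i (Z j)"
  have half: "fps_const (1 / 2) * (2 * s) = s"
  proof -
    have "fps_const (1 / 2 :: 'k) * 2 = 1"
      by (simp flip: numeral_fps_const)
    then show ?thesis by (simp only: mult.assoc[symmetric] mult_1_left)
  qed
  have s': "root R j (Z i) = - s"
    by (simp add: s_def Z_antisym[of j i])
  have "q_half (P' $ i $ j) = q_half (P $ i $ j) * kexp (- s)"
    by (simp add: q_half_kexp P'_P s_def[symmetric] right_diff_distrib half flip: kexp_add)
  moreover have "inverse (q_half (P' $ j $ i)) = inverse (q_half (P $ j $ i)) * kexp (- s)"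
    by (simp add: q_half_kexp P'_P s' distrib_left kexp_minus half flip: kexp_add)
  moreover have "kexp (- s) ^ k * kexp s ^ k = 1"
    by (simp flip: power_mult_distrib kexp_add)
  moreover have "kexp (- s) ^ m = kexp (- s) ^ (m - k) * kexp (- s) ^ k"
    using assms by (simp flip: power_add)
  ultimately show ?thesis
    unfolding s_def[symmetric] serre_coeff_def by (simp add: power_mult_distrib algebra_simps)
qed

text \<open>Serves E and F at once: \<open>\<sigma>\<close> is the sign of the weight, and (p, r) is
  (m - k, k) for E but (k, m - k) for F. Sign and exponents are exchanged together, so
  \<open>pow\<close> holds in both cases.\<close>

lemma serre_word:
  assumes w: "\<And>l. R.weight_vec (\<lambda>z. \<sigma> * root R l z) (x l)" and x': "\<And>l. x' l \<approx>[R.J] R.e (Z l) * x l"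
    and k: "k \<le> m" and pr: "p + r = m"
    and pow: "kexp (- (\<sigma> * root R i (Z j))) ^ p * kexp (\<sigma> * root R i (Z j)) ^ r =
      kexp (- root R i (Z j)) ^ (m - k) * kexp (root R i (Z j)) ^ k"
  shows "scalar (serre_coeff A d P' i j k) * (x' i ^ p * x' j * x' i ^ r) \<approx>[R.J]
    scalar (kexp (- root R i (Z j)) ^ m) * (R.e (Z i) ^ m * R.e (Z j) *
      (scalar (serre_coeff A d P i j k) * (x i ^ p * x j * x i ^ r)))"
proof -
  let ?s = "root R i (Z j)" and ?e = "R.e (Z i) ^ m * R.e (Z j)"
  have "x' i ^ p * x' j * x' i ^ r \<approx>[R.J] (R.e (Z i) * x i) ^ p * (R.e (Z j) * x j) * (R.e (Z i) * x i) ^ r"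
    by (intro R.eqv_mult R.eqv_power x')
  also have "\<dots> \<approx>[R.J] scalar (kexp (- (\<sigma> * ?s)) ^ p * kexp (\<sigma> * ?s) ^ r) *
      (R.e (Z i) ^ (p + r) * R.e (Z j) * (x i ^ p * x j * x i ^ r))"
  proof (rule R.twisted_word)
    show "x i * R.e (Z i) \<approx>[R.J] R.e (Z i) * x i"
      using R.weight_vec_e'[OF w, of i "Z i"] by (simp add: root_Z_self)
    show "x i * R.e (Z j) \<approx>[R.J] scalar (kexp (- (\<sigma> * ?s))) * (R.e (Z j) * x i)"
      by (rule R.weight_vec_e'[OF w])
    show "x j * R.e (Z i) \<approx>[R.J] scalar (kexp (\<sigma> * ?s)) * (R.e (Z i) * x j)"
      using R.weight_vec_e'[OF w, of j "Z i"] by (simp add: Z_antisym[of j i])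
  qed (rule R.e_commute)
  finally have "scalar (serre_coeff A d P' i j k) * (x' i ^ p * x' j * x' i ^ r) \<approx>[R.J]
      scalar (serre_coeff A d P' i j k) * (scalar (kexp (- ?s) ^ (m - k) * kexp ?s ^ k) *
        (?e * (x i ^ p * x j * x i ^ r)))"
    unfolding pow pr by (rule R.eqv_mult_left)
  also have "\<dots> = scalar (serre_coeff A d P i j k * kexp (- ?s) ^ m) * (?e * (x i ^ p * x j * x i ^ r))"
    unfolding serre_coeff_twist[OF k, symmetric] by (simp only: scalar_mult mult.assoc)
  also have "\<dots> = scalar (kexp (- ?s) ^ m) * (?e * (scalar (serre_coeff A d P i j k) * (x i ^ p * x j * x i ^ r)))"
    by (simp only: mult.commute[of "serre_coeff A d P i j k"] scalar_mult scalar_left_commute[of ?e]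
        mult.assoc[of "scalar (kexp (- ?s) ^ m)"])
  finally show ?thesis .
qed

lemma \<phi>_serre:
  assumes "i \<noteq> j"
  shows "\<phi> (serre_E A d P' i j) \<approx>[R.J] 0" "\<phi> (serre_F A d P' i j) \<approx>[R.J] 0"
proof -
  define m where "m = nat (1 - A $ i $ j)"
  let ?c = "scalar (kexp (- root R i (Z j)) ^ m) * (R.e (Z i) ^ m * R.e (Z j))"
  note hom = khom_sum[OF khom_\<phi>] khom_mult[OF khom_\<phi>] khom_scalar[OF khom_\<phi>] khom_power[OF khom_\<phi>]
  have "\<phi> (serre_E A d P' i j) = (\<Sum>k=0..m. scalar (serre_coeff A d P' i j k) *
      ((hexp (y i) * R.E i) ^ (m - k) * (hexp (y j) * R.E j) * (hexp (y i) * R.E i) ^ k))"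
    by (simp add: serre_E_def Let_def m_def hom mult.assoc)
  also have "\<dots> \<approx>[R.J] (\<Sum>k=0..m. scalar (kexp (- root R i (Z j)) ^ m) * (R.e (Z i) ^ m * R.e (Z j) *
      (scalar (serre_coeff A d P i j k) * (R.E i ^ (m - k) * R.E j * R.E i ^ k))))"
    by (intro R.eqv_sum serre_word[where \<sigma> = 1 and x = R.E and x' = "\<lambda>l. hexp (y l) * R.E l"] \<phi>_E)
      (simp_all add: R.weight_vec_E)
  also have "\<dots> = ?c * serre_E A d P i j"
    by (simp add: serre_E_def Let_def m_def sum_distrib_left mult.assoc)
  also have "\<dots> \<approx>[R.J] ?c * 0"
    by (intro R.eqv_mult_left R.serre assms)
  finally show "\<phi> (serre_E A d P' i j) \<approx>[R.J] 0" by simp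
  have "\<phi> (serre_F A d P' i j) = (\<Sum>k=0..m. scalar (serre_coeff A d P' i j k) *
      ((hexp (y i) * R.F i) ^ k * (hexp (y j) * R.F j) * (hexp (y i) * R.F i) ^ (m - k)))"
    by (simp add: serre_F_def Let_def m_def hom mult.assoc)
  also have "\<dots> \<approx>[R.J] (\<Sum>k=0..m. scalar (kexp (- root R i (Z j)) ^ m) * (R.e (Z i) ^ m * R.e (Z j) *
      (scalar (serre_coeff A d P i j k) * (R.F i ^ k * R.F j * R.F i ^ (m - k)))))"
    by (intro R.eqv_sum serre_word[where \<sigma> = "- 1" and x = R.F and x' = "\<lambda>l. hexp (y l) * R.F l"] \<phi>_F)
      (simp_all add: R.weight_vec_F mult.commute)
  also have "\<dots> = ?c * serre_F A d P i j"
    by (simp add: serre_F_def Let_def m_def sum_distrib_left mult.assoc)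
  also have "\<dots> \<approx>[R.J] ?c * 0"
    by (intro R.eqv_mult_left R.serre assms)
  finally show "\<phi> (serre_F A d P' i j) \<approx>[R.J] 0" by simp
qed

lemma \<phi>_relations: "\<phi> ` quea_relations A d P' R' \<subseteq> R.J"
proof (rule image_subsetI)
  note hom = khom_add[OF khom_\<phi>] khom_diff[OF khom_\<phi>] khom_mult[OF khom_\<phi>] khom_scalar[OF khom_\<phi>]
  fix r assume "r \<in> quea_relations A d P' R'"
  then consider
    (add) x x' where "r = gen (Tor (x + x')) - (gen (Tor x) + gen (Tor x'))"
  | (scale) c x where "r = gen (Tor (scale R' c x)) - scalar c * gen (Tor x)"
  | (TE) x j where "r = gen (Tor x) * gen (Egen j) - gen (Egen j) * gen (Tor x) - scalar (root R' j x) * gen (Egen j)"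
  | (TF) x j where "r = gen (Tor x) * gen (Fgen j) - gen (Fgen j) * gen (Tor x) + scalar (root R' j x) * gen (Fgen j)"
  | (TT) x x' where "r = gen (Tor x) * gen (Tor x') - gen (Tor x') * gen (Tor x)"
  | (EF) i j where "r = gen (Egen i) * gen (Fgen j) - gen (Fgen j) * gen (Egen i)
        - (if i = j then cartan_quotient (q_param (d i)) (Tplus R' i) (Tminus R' i) else 0)"
  | (SE) i j where "r = serre_E A d P' i j" "i \<noteq> j"
  | (SF) i j where "r = serre_F A d P' i j" "i \<noteq> j"
    unfolding quea_relations_def by blast
  then have "\<phi> r \<approx>[R.J] 0"
  proof cases
    case add
    then show ?thesis
      using R.T_add[of "f x" "f x'"] by (simp add: hom f_add eqm_def)
  next
    case scale
    then show ?thesis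
      using R.T_scale[of c "f x"] by (simp add: hom f_scale eqm_def)
  next
    case TE
    then show ?thesis
      using \<phi>_weight[OF R.weight_vec_e_mult[OF R.weight_vec_E] \<phi>_E[of j], of x] by (simp add: hom root_f)
  next
    case TF
    then show ?thesis
      using \<phi>_weight[OF R.weight_vec_e_mult[OF R.weight_vec_F] \<phi>_F[of j], of x]
      by (simp add: hom root_f scalar_minus)
  next
    case TT
    then show ?thesis
      using R.T_commute[of "f x" "f x'"] by (simp add: hom eqm_def)
  next
    case EF
    let ?c = "if i = j then cartan_quotient (q_param (d i)) (Tplus R' i) (Tminus R' i) else 0"
    have "\<phi> (gen (Egen i)) * \<phi> (gen (Fgen j)) - \<phi> (gen (Fgen j)) * \<phi> (gen (Egen i)) \<approx>[R.J]
       scalar (kexp (- root R i (Z j))) * (R.e (Z i) * R.e (Z j) *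
         (if i = j then cartan_quotient (q_param (d i)) (Tplus R i) (Tminus R i) else 0))"
      by (rule R.eqv_trans[OF \<phi>_E_F]) (intro R.eqv_mult_left R.E_F)
    \<comment> \<open>For i = j the scalar is 1 because \<alpha>_i(Z_i) = 0; for i \<noteq> j both
      sides vanish.\<close>
    also have "\<dots> \<approx>[R.J] \<phi> ?c"
      using R.eqv_sym[OF \<phi>_cartan_quotient[of "q_param (d i)" i]]
      by (cases "i = j") (auto simp: root_Z_self khom_0[OF khom_\<phi>])
    finally show ?thesis
      unfolding EF by (simp only: hom eqm_def diff_zero)
  next
    case SE
    then show ?thesis by (simp add: \<phi>_serre)
  next
    case SF
    then show ?thesis by (simp add: \<phi>_serre)
  qed
  then show "\<phi> r \<in> R.J" by (simp add: R.eqv_0_iff)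
qed

lemma \<phi>_ideal: "\<phi> ` R'.J \<subseteq> R.J"
  unfolding quea_ideal_def[of A d P' R']
  by (rule khom_closed_ideal[OF khom_\<phi> R.cideal_axioms \<phi>_relations])

end

section \<open>Toral twists\<close>

lemma free_counit_add: "free_counit (a + b) = free_counit a + free_counit b"
  by (simp add: free_counit_def fps_eq_iff lookup_add)

lemma free_counit_scalar_mult: "free_counit (scalar c * a) = c * free_counit a"
  by (simp add: free_counit_def fps_eq_iff fps_mult_nth lookup_sum lookup_single_zero_mult)

text \<open>Composed with the embedding of scalars, the counit is a homomorphism into an algebra, so
  \<open>khom_unique\<close> can compare counits on generators.\<close>

lemma free_counit_alg_ext:
  "(scalar (free_counit a) :: ('m::monoid_add, 'k::field_char_0) calg) = alg_ext (\<lambda>_. 0) a"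
proof (rule klinear_unique[OF _ khom_klinear[OF khom_alg_ext]])
  show "klinear (\<lambda>a. scalar (free_counit a) :: ('m, 'k) calg)"
    by (rule klinearI) (simp_all add: free_counit_add free_counit_scalar_mult scalar_add scalar_mult)
  fix u :: "('a, 'b) gen free_monoid"
  have "free_counit (monom u) = (if u = 0 then 1 else (0 :: 'k fps))"
    by (auto simp: free_counit_def monom_def fps_eq_iff lookup_single when_def)
  moreover have "(if u = 0 then 1 else 0) = (alg_ext (\<lambda>_. 0) (monom u) :: ('m, 'k) calg)"
    by (cases u; cases "letters u") (auto simp: alg_ext_def zero_free_monoid_def)
  ultimately show "scalar (free_counit (monom u)) = (alg_ext (\<lambda>_. 0) (monom u) :: ('m, 'k) calg)"
    by (simp split: if_splits)
qed

lemma (in quea_iso) free_counit_\<phi>: "free_counit (\<phi> x) = free_counit x"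
proof -
  have "(alg_ext (\<lambda>_. 0) (\<phi> x) :: (nat, 'k) calg) = alg_ext (\<lambda>_. 0) x"
  proof (rule khom_unique[OF khom_comp[OF khom_alg_ext khom_\<phi>] khom_alg_ext])
    show "alg_ext (\<lambda>_. 0) (\<phi> (gen z)) = (alg_ext (\<lambda>_. 0) (gen z) :: (nat, 'k) calg)" for z
      by (cases z) (simp_all add: khom_mult[OF khom_alg_ext])
  qed
  then have "(scalar (free_counit (\<phi> x)) :: (nat, 'k) calg) = scalar (free_counit x)"
    by (simp only: free_counit_alg_ext)
  then show ?thesis by (simp only: scalar_inject)
qed

lemma kantihom_khom_comp: "kantihom L \<Longrightarrow> khom M \<Longrightarrow> kantihom (\<lambda>a. L (M a))"
  by (simp add: khom_def kantihom_def klinear_comp)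

lemma khom_kantihom_comp: "khom M \<Longrightarrow> kantihom L \<Longrightarrow> kantihom (\<lambda>a. M (L a))"
  by (simp_all add: khom_def kantihom_def klinear_comp)

section \<open>The twist as an exponential and conjugation by it\<close>

locale quea_twist =
  quea_iso A d P R P' R' f Z "\<lambda>i. gen (Tor (Z i))"
  for A :: "int ^ 'n ^ 'n" and d :: "'n::finite \<Rightarrow> nat"
    and P :: "'k::field_char_0 fps ^ 'n ^ 'n" and R :: "('n, 'k, 'h::ab_group_add) realization"
    and P' :: "'k fps ^ 'n ^ 'n" and R' :: "('n, 'k, 'h'::ab_group_add) realization"
    and f :: "'h' \<Rightarrow> 'h" and Z :: "'n \<Rightarrow> 'h" +
  fixes t :: nat and H :: "nat \<Rightarrow> 'h" and \<Phi> :: "nat \<Rightarrow> nat \<Rightarrow> 'k fps"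
  assumes antisym: "\<Phi> \<in> antisymmetric t"
    and contraction: "(\<Sum>g<t. \<Sum>k<t. scale R (fps_const (1 / 2) * \<Phi> g k * root R i (H g)) (H k)) = - Z i"
begin

lemma \<Phi>_antisym: "g < t \<Longrightarrow> k < t \<Longrightarrow> \<Phi> g k = - \<Phi> k g"
  using antisym unfolding antisymmetric_def by blast

abbreviation J2 where "J2 \<equiv> tensor_ideal R.J"

sublocale J2: cideal J2
  by (rule cideal_tensor_ideal)

lemma tens_eqv: "a \<approx>[R.J] b \<Longrightarrow> c \<approx>[R.J] c' \<Longrightarrow> tens a c \<approx>[J2] tens b c'"
  by (rule tensor_ideal_eqv[OF R.cideal_axioms])

lemma lft_eqv: "a \<approx>[R.J] b \<Longrightarrow> lft a \<approx>[J2] lft b"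
  and rgt_eqv: "a \<approx>[R.J] b \<Longrightarrow> rgt a \<approx>[J2] rgt b"
  using tens_eqv[of a b 1 1] tens_eqv[of 1 1 a b] by (simp_all add: tens_1_left tens_1_right)

text \<open>The exponent of the twist without its factor \<hbar>, so that the twist is
  \<open>hexp \<omega>\<close>.\<close>

definition \<omega> where
  "\<omega> = (\<Sum>g<t. \<Sum>k<t. scalar (fps_const (1 / 2) * \<Phi> g k) * tens (R.T (H g)) (R.T (H k)))"

lemma toral_element_hexp: "toral_element t H \<Phi> = hexp \<omega>"
  by (simp add: toral_element_def \<omega>_def cexp_X_mult)

text \<open>The contraction (w \<otimes> id)(\<omega>) as a vector of \<hh>. Contracting the other
  leg gives its negative (\<open>Y_transpose\<close>).\<close>

definition Y :: "('h \<Rightarrow> 'k fps) \<Rightarrow> 'h" where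
  "Y w = (\<Sum>g<t. \<Sum>k<t. scale R (fps_const (1 / 2) * \<Phi> g k * w (H g)) (H k))"

lemma Y_root: "Y (root R i) = - Z i"
  unfolding Y_def by (rule contraction)

lemma Y_minus: "Y (\<lambda>x. - w x) = - Y w"
  by (simp add: Y_def sum_negf R.h.scale_minus_left)

lemma Y_transpose: "(\<Sum>g<t. \<Sum>k<t. scale R (fps_const (1 / 2) * \<Phi> g k * w (H k)) (H g)) = - Y w"
proof -
  have "(\<Sum>g<t. \<Sum>k<t. scale R (fps_const (1 / 2) * \<Phi> g k * w (H k)) (H g)) =
      (\<Sum>k<t. \<Sum>g<t. scale R (fps_const (1 / 2) * \<Phi> g k * w (H k)) (H g))"
    by (rule sum.swap)
  also have "\<dots> = (\<Sum>k<t. \<Sum>g<t. - scale R (fps_const (1 / 2) * \<Phi> k g * w (H k)) (H g))"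
  proof (intro sum.cong refl)
    fix k g assume "k \<in> {..<t}" "g \<in> {..<t}"
    then have "\<Phi> g k = - \<Phi> k g" by (intro \<Phi>_antisym) auto
    then show "scale R (fps_const (1 / 2) * \<Phi> g k * w (H k)) (H g) = - scale R (fps_const (1 / 2) * \<Phi> k g * w (H k)) (H g)"
      by (simp add: R.h.scale_minus_left)
  qed
  finally show ?thesis by (simp add: Y_def sum_negf)
qed

lemma T_double_sum: "R.T (\<Sum>g<t. \<Sum>k<t. scale R (c g k) (x g k)) \<approx>[R.J] (\<Sum>g<t. \<Sum>k<t. scalar (c g k) * R.T (x g k))"
proof -
  have "R.T (\<Sum>g<t. \<Sum>k<t. scale R (c g k) (x g k)) \<approx>[R.J] (\<Sum>g<t. R.T (\<Sum>k<t. scale R (c g k) (x g k)))"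
    by (rule R.T_sum)
  also have "\<dots> \<approx>[R.J] (\<Sum>g<t. \<Sum>k<t. R.T (scale R (c g k) (x g k)))"
    by (intro R.eqv_sum R.T_sum)
  also have "\<dots> \<approx>[R.J] (\<Sum>g<t. \<Sum>k<t. scalar (c g k) * R.T (x g k))"
    by (intro R.eqv_sum R.T_scale)
  finally show ?thesis .
qed

text \<open>Moving H_g \<otimes> H_k past X \<otimes> 1 leaves the extra term w(H_g) (X \<otimes>
  H_k); the weighted sum of these is X \<otimes> Y(w).\<close>

lemma \<omega>_lft:
  assumes "R.weight_vec w X"
  shows "\<omega> * lft X \<approx>[J2] lft X * (\<omega> + rgt (R.T (Y w)))"
proof -
  let ?c = "\<lambda>g k. fps_const (1 / 2) * \<Phi> g k"
  have "\<omega> * lft X = (\<Sum>g<t. \<Sum>k<t. scalar (?c g k) * tens (R.T (H g) * X) (R.T (H k)))"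
    by (simp add: \<omega>_def sum_distrib_right mult.assoc tens_mult flip: tens_1_right)
  also have "\<dots> \<approx>[J2] (\<Sum>g<t. \<Sum>k<t. scalar (?c g k) * tens (X * (R.T (H g) + scalar (w (H g)))) (R.T (H k)))"
    using assms by (intro J2.eqv_sum J2.eqv_mult_left tens_eqv R.eqv_refl) (simp add: R.weight_vec_def)
  also have "\<dots> = (\<Sum>g<t. \<Sum>k<t. lft X * (scalar (?c g k) * tens (R.T (H g)) (R.T (H k)) +
      scalar (?c g k * w (H g)) * rgt (R.T (H k))))"
  proof (intro sum.cong refl)
    fix g k
    have "tens (X * (R.T (H g) + scalar (w (H g)))) (R.T (H k)) =
        lft X * (tens (R.T (H g)) (R.T (H k)) + scalar (w (H g)) * rgt (R.T (H k)))"
      by (simp add: tens_lft_rgt khom_mult[OF khom_lft] khom_add[OF khom_lft] khom_scalar[OF khom_lft]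
          distrib_left distrib_right mult.assoc)
    then show "scalar (?c g k) * tens (X * (R.T (H g) + scalar (w (H g)))) (R.T (H k)) =
        lft X * (scalar (?c g k) * tens (R.T (H g)) (R.T (H k)) + scalar (?c g k * w (H g)) * rgt (R.T (H k)))"
      by (simp only: distrib_left scalar_left_commute[of "lft X"] scalar_mult mult.assoc)
  qed
  also have "\<dots> = lft X * (\<omega> + rgt (\<Sum>g<t. \<Sum>k<t. scalar (?c g k * w (H g)) * R.T (H k)))"
    by (simp add: \<omega>_def sum_distrib_left sum.distrib distrib_left khom_sum[OF khom_rgt] khom_mult[OF khom_rgt] khom_scalar[OF khom_rgt])
  also have "\<dots> \<approx>[J2] lft X * (\<omega> + rgt (R.T (Y w)))"
    unfolding Y_def by (intro J2.eqv_mult_left J2.eqv_add J2.eqv_refl rgt_eqv R.eqv_sym[OF T_double_sum])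
  finally show ?thesis .
qed

lemma \<omega>_rgt:
  assumes "R.weight_vec w X"
  shows "\<omega> * rgt X \<approx>[J2] rgt X * (\<omega> + lft (R.T (- Y w)))"
proof -
  let ?c = "\<lambda>g k. fps_const (1 / 2) * \<Phi> g k"
  have "\<omega> * rgt X = (\<Sum>g<t. \<Sum>k<t. scalar (?c g k) * tens (R.T (H g)) (R.T (H k) * X))"
    by (simp add: \<omega>_def sum_distrib_right mult.assoc tens_mult flip: tens_1_left)
  also have "\<dots> \<approx>[J2] (\<Sum>g<t. \<Sum>k<t. scalar (?c g k) * tens (R.T (H g)) (X * (R.T (H k) + scalar (w (H k)))))"
    using assms by (intro J2.eqv_sum J2.eqv_mult_left tens_eqv R.eqv_refl) (simp add: R.weight_vec_def)
  also have "\<dots> = (\<Sum>g<t. \<Sum>k<t. rgt X * (scalar (?c g k) * tens (R.T (H g)) (R.T (H k)) +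
      scalar (?c g k * w (H k)) * lft (R.T (H g))))"
  proof (intro sum.cong refl)
    fix g k
    have "tens (R.T (H g)) (X * (R.T (H k) + scalar (w (H k)))) =
        rgt X * (tens (R.T (H g)) (R.T (H k)) + scalar (w (H k)) * lft (R.T (H g)))"
      by (simp add: tens_lft_rgt khom_mult[OF khom_rgt] khom_add[OF khom_rgt] khom_scalar[OF khom_rgt]
          distrib_left mult.assoc lft_rgt_left_commute lft_rgt_commute scalar_commute[of _ "lft (R.T (H g))"])
    then show "scalar (?c g k) * tens (R.T (H g)) (X * (R.T (H k) + scalar (w (H k)))) =
        rgt X * (scalar (?c g k) * tens (R.T (H g)) (R.T (H k)) + scalar (?c g k * w (H k)) * lft (R.T (H g)))"
      by (simp only: distrib_left scalar_left_commute[of "rgt X"] scalar_mult mult.assoc)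
  qed
  also have "\<dots> = rgt X * (\<omega> + lft (\<Sum>g<t. \<Sum>k<t. scalar (?c g k * w (H k)) * R.T (H g)))"
    by (simp add: \<omega>_def sum_distrib_left sum.distrib distrib_left khom_sum[OF khom_lft] khom_mult[OF khom_lft] khom_scalar[OF khom_lft])
  also have "\<dots> \<approx>[J2] rgt X * (\<omega> + lft (R.T (- Y w)))"
    unfolding Y_transpose[symmetric]
    by (intro J2.eqv_mult_left J2.eqv_add J2.eqv_refl lft_eqv R.eqv_sym[OF T_double_sum])
  finally show ?thesis .
qed

lemma Y_0: "Y (\<lambda>_. 0) = 0"
  by (simp add: Y_def)

lemma weight_vec_T: "R.weight_vec (\<lambda>_. 0) (R.T x)"
  by (simp add: R.weight_vec_def R.T_commute)

lemma weight_vec_e_self: "R.weight_vec (\<lambda>_. 0) (R.e x)"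
  by (simp add: R.weight_vec_def R.T_e)

lemma \<omega>_commute_lft:
  assumes "R.weight_vec (\<lambda>_. 0) X" shows "\<omega> * lft X \<approx>[J2] lft X * \<omega>"
proof -
  have "\<omega> * lft X \<approx>[J2] lft X * (\<omega> + rgt (R.T 0))"
    using \<omega>_lft[OF assms] by (simp add: Y_0)
  also have "\<dots> \<approx>[J2] lft X * (\<omega> + rgt 0)"
    by (intro J2.eqv_mult_left J2.eqv_add J2.eqv_refl rgt_eqv R.T_0)
  finally show ?thesis by (simp add: khom_0[OF khom_rgt])
qed

lemma \<omega>_commute_rgt:
  assumes "R.weight_vec (\<lambda>_. 0) X" shows "\<omega> * rgt X \<approx>[J2] rgt X * \<omega>"
proof -
  have "\<omega> * rgt X \<approx>[J2] rgt X * (\<omega> + lft (R.T 0))"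
    using \<omega>_rgt[OF assms] by (simp add: Y_0)
  also have "\<dots> \<approx>[J2] rgt X * (\<omega> + lft 0)"
    by (intro J2.eqv_mult_left J2.eqv_add J2.eqv_refl lft_eqv R.T_0)
  finally show ?thesis by (simp add: khom_0[OF khom_lft])
qed

text \<open>Conjugation takes place before passing to the quotient, where
  \<open>hexp \<omega>\<close> is already invertible, so \<open>Ad\<close> is an exact
  homomorphism.\<close>

definition Ad where "Ad a = hexp \<omega> * a * hexp (- \<omega>)"

lemma khom_Ad: "khom Ad"
proof -
  have "klinear Ad"
    unfolding Ad_def by (rule klinear_mult_right[OF klinear_mult_left[OF klinear_id]])
  then show ?thesis
    by (simp add: khom_def Ad_def mult.assoc)
qed

lemma Ad_eqvI:
  assumes "hexp \<omega> * a \<approx>[J2] b * hexp \<omega>" shows "Ad a \<approx>[J2] b"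
  using J2.eqv_mult_right[OF assms, of "hexp (- \<omega>)"] by (simp add: Ad_def mult.assoc)

lemma Ad_cong: "a \<approx>[J2] b \<Longrightarrow> Ad a \<approx>[J2] Ad b"
  unfolding Ad_def by (intro J2.eqv_mult_left J2.eqv_mult_right)

text \<open>Intertwining turns \<omega> into \<omega> + 1 \<otimes> Y(w). These summands commute
  modulo the ideal, so e^(\<hbar>\<omega>) splits off and is cancelled by the right half of the
  conjugation.\<close>

lemma Ad_lft:
  assumes "R.weight_vec w X"
  shows "Ad (lft X) \<approx>[J2] tens X (R.e (Y w))"
proof (rule Ad_eqvI)
  have "hexp \<omega> * lft X \<approx>[J2] lft X * hexp (\<omega> + rgt (R.T (Y w)))"
    by (rule J2.hexp_intertwine[OF \<omega>_lft[OF assms]])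
  also have "hexp (\<omega> + rgt (R.T (Y w))) = hexp (rgt (R.T (Y w)) + \<omega>)"
    by (simp add: add.commute)
  also have "lft X * \<dots> \<approx>[J2] lft X * (hexp (rgt (R.T (Y w))) * hexp \<omega>)"
    by (intro J2.eqv_mult_left J2.hexp_add J2.eqv_sym[OF \<omega>_commute_rgt[OF weight_vec_T]])
  also have "\<dots> = tens X (R.e (Y w)) * hexp \<omega>"
    by (simp add: tens_lft_rgt R.e_def khom_hexp[OF khom_rgt] mult.assoc)
  finally show "hexp \<omega> * lft X \<approx>[J2] tens X (R.e (Y w)) * hexp \<omega>" .
qed

lemma Ad_rgt:
  assumes "R.weight_vec w X"
  shows "Ad (rgt X) \<approx>[J2] tens (R.e (- Y w)) X"
proof (rule Ad_eqvI)
  have "hexp \<omega> * rgt X \<approx>[J2] rgt X * hexp (\<omega> + lft (R.T (- Y w)))"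
    by (rule J2.hexp_intertwine[OF \<omega>_rgt[OF assms]])
  also have "hexp (\<omega> + lft (R.T (- Y w))) = hexp (lft (R.T (- Y w)) + \<omega>)"
    by (simp add: add.commute)
  also have "rgt X * \<dots> \<approx>[J2] rgt X * (hexp (lft (R.T (- Y w))) * hexp \<omega>)"
    by (intro J2.eqv_mult_left J2.hexp_add J2.eqv_sym[OF \<omega>_commute_lft[OF weight_vec_T]])
  also have "\<dots> = tens (R.e (- Y w)) X * hexp \<omega>"
    by (simp add: tens_lft_rgt R.e_def khom_hexp[OF khom_lft, symmetric] lft_rgt_left_commute mult.assoc)
  finally show "hexp \<omega> * rgt X \<approx>[J2] tens (R.e (- Y w)) X * hexp \<omega>" .
qed

lemma Ad_lft_0:
  assumes "R.weight_vec (\<lambda>_. 0) X" shows "Ad (lft X) \<approx>[J2] lft X"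
  by (rule J2.eqv_trans[OF Ad_lft[OF assms]])
    (use tens_eqv[OF R.eqv_refl R.e_0, of X] in \<open>simp add: Y_0 tens_1_right\<close>)

lemma Ad_rgt_0:
  assumes "R.weight_vec (\<lambda>_. 0) X" shows "Ad (rgt X) \<approx>[J2] rgt X"
  by (rule J2.eqv_trans[OF Ad_rgt[OF assms]])
    (use tens_eqv[OF R.e_0 R.eqv_refl, of X] in \<open>simp add: Y_0 tens_1_left\<close>)

lemma Ad_E: "Ad (lft (R.E i)) \<approx>[J2] tens (R.E i) (R.e (- Z i))"
  "Ad (rgt (R.E i)) \<approx>[J2] tens (R.e (Z i)) (R.E i)"
  using Ad_lft[OF R.weight_vec_E, of i] Ad_rgt[OF R.weight_vec_E, of i] by (simp_all add: Y_root)

lemma Ad_F: "Ad (lft (R.F i)) \<approx>[J2] tens (R.F i) (R.e (Z i))"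
  "Ad (rgt (R.F i)) \<approx>[J2] tens (R.e (- Z i)) (R.F i)"
  using Ad_lft[OF R.weight_vec_F, of i] Ad_rgt[OF R.weight_vec_F, of i] by (simp_all add: Y_minus Y_root)

text \<open>Toral exponentials are group-like already in the free algebra, since x \<otimes> 1 and 1
  \<otimes> x commute exactly.\<close>

lemma comult_e: "alg_ext (gen_comult R) (R.e x) = tens (R.e x) (R.e x)"
proof -
  have "alg_ext (gen_comult R) (R.e x) = hexp (lft (R.T x) + rgt (R.T x))"
    by (simp add: R.e_def khom_hexp[OF khom_alg_ext] tens_1_left tens_1_right)
  also have "\<dots> = lft (R.e x) * rgt (R.e x)"
    by (subst hexp_add_exact[OF lft_rgt_commute[symmetric]])
      (simp add: R.e_def khom_hexp[OF khom_lft] khom_hexp[OF khom_rgt])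
  finally show ?thesis by (simp add: tens_lft_rgt)
qed

lemma Ad_comult_e: "Ad (tens (R.e x) (R.e x)) \<approx>[J2] tens (R.e x) (R.e x)"
  unfolding tens_lft_rgt khom_mult[OF khom_Ad]
  by (intro J2.eqv_mult Ad_lft_0 Ad_rgt_0 weight_vec_e_self)

lemma e_f_Tplus: "R.e (Z i) * (R.e (Tplus R i) * R.e (Z i)) \<approx>[R.J] hexp (R.T (f (Tplus R' i)))"
proof -
  have "R.e (Z i) * (R.e (Tplus R i) * R.e (Z i)) \<approx>[R.J] R.e (Z i) * R.e (Tplus R i + Z i)"
    by (intro R.eqv_mult_left R.eqv_sym[OF R.e_add])
  also have "\<dots> \<approx>[R.J] R.e (Z i + (Tplus R i + Z i))"
    by (rule R.eqv_sym[OF R.e_add])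
  also have "Z i + (Tplus R i + Z i) = f (Tplus R' i)"
    by (simp add: f_Tplus)
  finally show ?thesis by (simp add: R.e_def)
qed

lemma e_f_Tminus: "R.e (Z i) * (R.e (Z i) * R.e (- Tminus R i)) \<approx>[R.J] hexp (- R.T (f (Tminus R' i)))"
proof -
  have "R.e (Z i) * (R.e (Z i) * R.e (- Tminus R i)) \<approx>[R.J] R.e (Z i) * R.e (Z i + - Tminus R i)"
    by (intro R.eqv_mult_left R.eqv_sym[OF R.e_add])
  also have "\<dots> \<approx>[R.J] R.e (Z i + (Z i + - Tminus R i))"
    by (rule R.eqv_sym[OF R.e_add])
  also have "Z i + (Z i + - Tminus R i) = - f (Tminus R' i)"
    by (simp add: f_Tminus)
  also have "R.e \<dots> \<approx>[R.J] hexp (- R.T (f (Tminus R' i)))"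
    by (rule R.eqv_sym[OF R.hexp_minus_T])
  finally show ?thesis .
qed

text \<open>Both sides are homomorphisms on the free algebra, so generators suffice;
  \<open>Ad\<close> is what makes the right-hand coproduct the twisted one.\<close>

lemma comult_\<phi>:
  "tens_map \<phi> (alg_ext (gen_comult R') x) \<approx>[J2] Ad (alg_ext (gen_comult R) (\<phi> x))"
proof -
  let ?L = "\<lambda>x. tens_map \<phi> (alg_ext (gen_comult R') x)"
  let ?M = "\<lambda>x. Ad (alg_ext (gen_comult R) (\<phi> x))"
  have L: "khom ?L" by (rule khom_comp[OF khom_tens_map[OF khom_\<phi>] khom_alg_ext])
  have M: "khom ?M" by (rule khom_comp[OF khom_Ad khom_comp[OF khom_alg_ext khom_\<phi>]])
  have gens: "?L (gen z) \<approx>[J2] ?M (gen z)" for z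
  proof (cases z)
    case (Tor x)
    have "?M (gen z) \<approx>[J2] lft (R.T (f x)) + rgt (R.T (f x))"
      unfolding Tor \<phi>_gen gen_image.simps alg_ext_gen gen_comult.simps tens_1_left tens_1_right khom_add[OF khom_Ad]
      by (intro J2.eqv_add Ad_lft_0 Ad_rgt_0 weight_vec_T)
    moreover have "?L (gen z) = lft (R.T (f x)) + rgt (R.T (f x))"
      by (simp add: Tor khom_add[OF khom_tens_map[OF khom_\<phi>]] tens_1_left tens_1_right
          tens_map_lft[OF khom_\<phi>] tens_map_rgt[OF khom_\<phi>])
    ultimately show ?thesis by (simp add: J2.eqv_sym)
  next
    case (Egen i)
    let ?e = "R.e (Z i)" and ?E = "R.E i" and ?K = "R.e (Tplus R i)"
    have "?M (gen z) = Ad (tens ?e ?e) * (Ad (lft ?E) + Ad (lft ?K) * Ad (rgt ?E))"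
      by (simp add: Egen khom_mult[OF khom_alg_ext] khom_mult[OF khom_Ad] khom_add[OF khom_Ad]
          R.e_def[symmetric] comult_e exp_tor_hexp tens_lft_rgt khom_1[OF khom_rgt] khom_1[OF khom_Ad])
    also have "\<dots> \<approx>[J2] tens ?e ?e * (tens ?E (R.e (- Z i)) + lft ?K * tens ?e ?E)"
      by (intro J2.eqv_mult J2.eqv_add Ad_comult_e Ad_E Ad_lft_0 weight_vec_e_self)
    \<comment> \<open>In the first term the exponentials of the second leg cancel; in the second
      term Z_i is added twice to \<open>Tplus R i\<close> in the first leg.\<close>
    also have "\<dots> = tens (?e * ?E) (?e * R.e (- Z i)) + tens (?e * (?K * ?e)) (?e * ?E)"
      by (simp add: distrib_left tens_mult flip: tens_1_right)
    also have "\<dots> \<approx>[J2] tens (?e * ?E) 1 + tens (hexp (R.T (f (Tplus R' i)))) (?e * ?E)"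
      by (intro J2.eqv_add tens_eqv R.eqv_refl R.e_inverse e_f_Tplus)
    also have "\<dots> = ?L (gen z)"
      by (simp add: Egen khom_add[OF khom_tens_map[OF khom_\<phi>]] tens_map_tens[OF khom_\<phi>]
          exp_tor_hexp khom_hexp[OF khom_\<phi>] khom_1[OF khom_\<phi>] R.e_def)
    finally show ?thesis by (rule J2.eqv_sym)
  next
    case (Fgen i)
    let ?e = "R.e (Z i)" and ?F = "R.F i"
    have "?M (gen z) = Ad (tens ?e ?e) * (Ad (lft ?F) * Ad (rgt (hexp (- R.T (Tminus R i)))) + Ad (rgt ?F))"
      by (simp add: Fgen khom_mult[OF khom_alg_ext] khom_mult[OF khom_Ad] khom_add[OF khom_Ad]
          R.e_def[symmetric] comult_e exp_neg_tor_hexp tens_lft_rgt khom_1[OF khom_lft] khom_1[OF khom_Ad])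
    also have "\<dots> \<approx>[J2] Ad (tens ?e ?e) * (Ad (lft ?F) * Ad (rgt (R.e (- Tminus R i))) + Ad (rgt ?F))"
      by (intro J2.eqv_mult_left J2.eqv_add J2.eqv_refl Ad_cong rgt_eqv R.hexp_minus_T)
    also have "\<dots> \<approx>[J2] tens ?e ?e * (tens ?F ?e * rgt (R.e (- Tminus R i)) + tens (R.e (- Z i)) ?F)"
      by (intro J2.eqv_mult J2.eqv_add Ad_comult_e Ad_F Ad_rgt_0 weight_vec_e_self)
    \<comment> \<open>The weight of F has the opposite sign: here the doubling occurs in the second
      leg of the first term, and the cancellation in the first leg of the second.\<close>
    also have "\<dots> = tens (?e * ?F) (?e * (?e * R.e (- Tminus R i))) + tens (?e * R.e (- Z i)) (?e * ?F)"
      by (simp add: distrib_left tens_mult flip: tens_1_left)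
    also have "\<dots> \<approx>[J2] tens (?e * ?F) (hexp (- R.T (f (Tminus R' i)))) + tens 1 (?e * ?F)"
      by (intro J2.eqv_add tens_eqv R.eqv_refl R.e_inverse e_f_Tminus)
    also have "\<dots> = ?L (gen z)"
      by (simp add: Fgen khom_add[OF khom_tens_map[OF khom_\<phi>]] tens_map_tens[OF khom_\<phi>]
          exp_neg_tor_hexp khom_hexp[OF khom_\<phi>] khom_minus[OF khom_\<phi>] khom_1[OF khom_\<phi>] R.e_def)
    finally show ?thesis by (rule J2.eqv_sym)
  qed
  show ?thesis
    by (rule J2.khom_eqvI[OF L[THEN khom_klinear] M[THEN khom_klinear] _ _ _ _ gens])
      (simp_all add: khom_1[OF L] khom_1[OF M] khom_mult[OF L] khom_mult[OF M])
qed

section \<open>The antipode and the triviality of its conjugating element\<close>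

abbreviation antipode_R where "antipode_R \<equiv> antialg_ext (gen_antipode R)"

lemma antipode_e: "antipode_R (R.e x) = hexp (- R.T x)"
  by (simp add: R.e_def kantihom_hexp[OF kantihom_antialg_ext])

lemma weight_e_commute:
  assumes "R.weight_vec w X" "w x = 0"
  shows "X * R.e x \<approx>[R.J] R.e x * X"
  using R.weight_vec_e'[OF assms(1), of x] assms(2) by simp

text \<open>An antihomomorphism sends e^(\<hbar>Z_i) E_i to S(E_i) e^(-\<hbar>Z_i). As
  \<alpha>_i(Z_i) = 0, that exponential commutes with E_i, and both sides carry the exponent -T_i^+
  - Z_i; for F_i it is T_i^- - Z_i.\<close>

lemma antipode_\<phi>: "\<phi> (antialg_ext (gen_antipode R') x) \<approx>[R.J] antipode_R (\<phi> x)"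
proof (rule R.kantihom_eqvI[where L = "\<lambda>x. \<phi> (antialg_ext (gen_antipode R') x)" and M = "\<lambda>x. antipode_R (\<phi> x)"])
  show "kantihom (\<lambda>x. \<phi> (antialg_ext (gen_antipode R') x))"
    by (rule khom_kantihom_comp[OF khom_\<phi> kantihom_antialg_ext])
  show "kantihom (\<lambda>x. antipode_R (\<phi> x))"
    by (rule kantihom_khom_comp[OF kantihom_antialg_ext khom_\<phi>])
  fix z
  show "\<phi> (antialg_ext (gen_antipode R') (gen z)) \<approx>[R.J] antipode_R (\<phi> (gen z))"
  proof (cases z)
    case (Tor x)
    then show ?thesis by (simp add: khom_minus[OF khom_\<phi>])
  next
    case (Egen i)
    let ?e = "R.e (Z i)" and ?E = "R.E i"
    have "\<phi> (antialg_ext (gen_antipode R') (gen z)) = - (hexp (- R.T (f (Tplus R' i))) * ?e * ?E)"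
      by (simp add: Egen khom_minus[OF khom_\<phi>] khom_mult[OF khom_\<phi>] exp_neg_tor_hexp
          khom_hexp[OF khom_\<phi>] mult.assoc R.e_def)
    also have "\<dots> \<approx>[R.J] - (R.e (- f (Tplus R' i)) * ?e * ?E)"
      by (intro R.eqv_minus R.eqv_mult_right R.hexp_minus_T)
    also have "\<dots> \<approx>[R.J] - (R.e (- f (Tplus R' i) + Z i) * ?E)"
      by (intro R.eqv_minus R.eqv_mult_right R.eqv_sym[OF R.e_add])
    also have "- f (Tplus R' i) + Z i = - Tplus R i + - Z i"
      by (simp add: f_Tplus)
    also have "- (R.e \<dots> * ?E) \<approx>[R.J] - (R.e (- Tplus R i) * R.e (- Z i) * ?E)"
      by (intro R.eqv_minus R.eqv_mult_right R.e_add)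
    also have "\<dots> = - (R.e (- Tplus R i) * (R.e (- Z i) * ?E))"
      by (simp add: mult.assoc)
    also have "\<dots> \<approx>[R.J] - (R.e (- Tplus R i) * (?E * R.e (- Z i)))"
      by (intro R.eqv_minus R.eqv_mult_left R.eqv_sym[OF weight_e_commute[OF R.weight_vec_E]])
        (simp add: R.root_minus root_Z_self)
    also have "\<dots> \<approx>[R.J] - (hexp (- R.T (Tplus R i)) * (?E * hexp (- R.T (Z i))))"
      by (intro R.eqv_minus R.eqv_mult R.eqv_refl R.eqv_sym[OF R.hexp_minus_T])
    also have "\<dots> = antipode_R (\<phi> (gen z))"
      by (simp add: Egen kantihom_mult[OF kantihom_antialg_ext] antipode_e exp_neg_tor_hexp mult.assoc
          flip: R.e_def)
    finally show ?thesis .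
  next
    case (Fgen i)
    let ?e = "R.e (Z i)" and ?F = "R.F i"
    have "\<phi> (antialg_ext (gen_antipode R') (gen z)) = - (?e * ?F * R.e (f (Tminus R' i)))"
      by (simp add: Fgen khom_minus[OF khom_\<phi>] khom_mult[OF khom_\<phi>] exp_tor_hexp
          khom_hexp[OF khom_\<phi>] R.e_def)
    also have "\<dots> \<approx>[R.J] - (?F * ?e * R.e (f (Tminus R' i)))"
      by (intro R.eqv_minus R.eqv_mult_right R.eqv_sym[OF weight_e_commute[OF R.weight_vec_F]])
        (simp add: root_Z_self)
    also have "\<dots> = - (?F * (?e * R.e (f (Tminus R' i))))"
      by (simp add: mult.assoc)
    also have "\<dots> \<approx>[R.J] - (?F * R.e (Z i + f (Tminus R' i)))"
      by (intro R.eqv_minus R.eqv_mult_left R.eqv_sym[OF R.e_add])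
    also have "Z i + f (Tminus R' i) = Tminus R i + - Z i"
      by (simp add: f_Tminus)
    also have "- (?F * R.e \<dots>) \<approx>[R.J] - (?F * (R.e (Tminus R i) * R.e (- Z i)))"
      by (intro R.eqv_minus R.eqv_mult_left R.e_add)
    also have "\<dots> \<approx>[R.J] - (?F * (R.e (Tminus R i) * hexp (- R.T (Z i))))"
      by (intro R.eqv_minus R.eqv_mult_left R.eqv_sym[OF R.hexp_minus_T])
    also have "\<dots> = antipode_R (\<phi> (gen z))"
      by (simp add: Fgen kantihom_mult[OF kantihom_antialg_ext] antipode_e exp_tor_hexp mult.assoc
          flip: R.e_def)
    finally show ?thesis .
  qed
qed

definition mult_antipode where
  "mult_antipode = lin_ext (\<lambda>(u, w). monom u * antipode_R (monom w))"

lemma klinear_mult_antipode: "klinear mult_antipode"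
  unfolding mult_antipode_def by (rule klinear_lin_ext)

lemma mult_antipode_tens: "mult_antipode (tens a b) = a * antipode_R b"
proof -
  note M = klinear_mult_antipode and S = kantihom_klinear[OF kantihom_antialg_ext]
  have *: "mult_antipode (tens (monom u) (monom v)) = monom u * antipode_R (monom v)" for u v
    by (simp add: tens_monom mult_antipode_def)
  have "mult_antipode (tens (monom u) b) = monom u * antipode_R b" for u
    by (rule klinear_unique[where L = "\<lambda>b. mult_antipode (tens (monom u) b)" and M = "\<lambda>b. monom u * antipode_R b"])
      (rule klinear_comp[OF M klinear_tens_right], rule klinear_mult_left[OF S], rule *)
  then show ?thesis
    by (rule klinear_unique[where L = "\<lambda>a. mult_antipode (tens a b)" and M = "\<lambda>a. a * antipode_R b",
        OF klinear_comp[OF M klinear_tens_left] klinear_mult_right[OF klinear_id]])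
qed

text \<open>The antipode reverses products, so a left factor a \<otimes> b ends up around the value.
  Powers of \<omega> can thus be peeled off from outside.\<close>

lemma mult_antipode_mult: "mult_antipode (tens a b * z) = a * mult_antipode z * antipode_R b"
proof (rule klinear_unique[where L = "\<lambda>z. mult_antipode (tens a b * z)" and M = "\<lambda>z. a * mult_antipode z * antipode_R b"])
  show "klinear (\<lambda>z. mult_antipode (tens a b * z))"
    by (rule klinear_comp[OF klinear_mult_antipode klinear_mult_left[OF klinear_id]])
  show "klinear (\<lambda>z. a * mult_antipode z * antipode_R b)"
    by (rule klinear_mult_right[OF klinear_mult_left[OF klinear_mult_antipode]])
  show "mult_antipode (tens a b * monom u) = a * mult_antipode (monom u) * antipode_R b" for u
    by (subst (1 2) monom_pair)
      (simp add: tens_mult mult_antipode_tens kantihom_mult[OF kantihom_antialg_ext] mult.assoc)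
qed

text \<open>Commutativity of \<hh> and antisymmetry of \<Phi> make the sum congruent to its own
  negative, and 2 is invertible.\<close>

lemma \<Phi>_symmetrization:
  "(\<Sum>g<t. \<Sum>k<t. scalar (fps_const (1 / 2) * \<Phi> g k) * (R.T (H g) * R.T (H k))) \<approx>[R.J] 0"
    (is "?Q \<approx>[R.J] 0")
proof -
  have "?Q \<approx>[R.J] (\<Sum>g<t. \<Sum>k<t. scalar (fps_const (1 / 2) * \<Phi> g k) * (R.T (H k) * R.T (H g)))"
    by (intro R.eqv_sum R.eqv_mult_left R.T_commute)
  also have "\<dots> = (\<Sum>k<t. \<Sum>g<t. scalar (fps_const (1 / 2) * \<Phi> g k) * (R.T (H k) * R.T (H g)))"
    by (rule sum.swap)
  also have "\<dots> = (\<Sum>k<t. \<Sum>g<t. - (scalar (fps_const (1 / 2) * \<Phi> k g) * (R.T (H k) * R.T (H g))))"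
  proof (intro sum.cong refl)
    fix k g assume "k \<in> {..<t}" "g \<in> {..<t}"
    then have "\<Phi> g k = - \<Phi> k g" by (intro \<Phi>_antisym) auto
    then show "scalar (fps_const (1 / 2) * \<Phi> g k) * (R.T (H k) * R.T (H g)) =
        - (scalar (fps_const (1 / 2) * \<Phi> k g) * (R.T (H k) * R.T (H g)))"
      by (simp add: scalar_minus)
  qed
  also have "\<dots> = - ?Q" by (simp add: sum_negf)
  finally have "?Q \<approx>[R.J] - ?Q" .
  then have "of_nat (Suc 1) * ?Q \<approx>[R.J] of_nat (Suc 1) * 0"
    by (simp add: eqm_def mult_2)
  then show ?thesis by (rule R.of_nat_cancel)
qed

text \<open>A value that is scalar modulo the ideal can be pulled out from between the two toral
  factors. The induction over powers of \<omega> starts with c = 1 and continues with c = 0.\<close>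

lemma mult_antipode_\<omega>_mult:
  assumes "mult_antipode z \<approx>[R.J] scalar c"
  shows "mult_antipode (\<omega> * z) \<approx>[R.J] 0"
proof -
  have "mult_antipode (\<omega> * z) = (\<Sum>g<t. \<Sum>k<t. scalar (fps_const (1 / 2) * \<Phi> g k) *
      (R.T (H g) * mult_antipode z * (- R.T (H k))))"
    by (simp add: \<omega>_def sum_distrib_right mult.assoc klinear_sum[OF klinear_mult_antipode]
        klinear_scalar[OF klinear_mult_antipode] mult_antipode_mult)
  also have "\<dots> \<approx>[R.J] (\<Sum>g<t. \<Sum>k<t. scalar (fps_const (1 / 2) * \<Phi> g k) *
      (R.T (H g) * scalar c * (- R.T (H k))))"
    by (intro R.eqv_sum R.eqv_mult_left R.eqv_mult_right assms)
  also have "\<dots> = - scalar c * (\<Sum>g<t. \<Sum>k<t. scalar (fps_const (1 / 2) * \<Phi> g k) * (R.T (H g) * R.T (H k)))"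
    unfolding sum_distrib_left
  proof (intro sum.cong refl)
    fix g k
    let ?s = "scalar (fps_const (1 / 2) * \<Phi> g k) :: ('n, 'h, 'k) qfree"
    have "?s * (R.T (H g) * scalar c * (- R.T (H k))) = ?s * (scalar c * (- (R.T (H g) * R.T (H k))))"
      by (simp add: scalar_commute[of c "R.T (H g)", symmetric] mult.assoc)
    also have "\<dots> = - scalar c * (?s * (R.T (H g) * R.T (H k)))"
      by (simp add: scalar_left_commute[of ?s c])
    finally show "?s * (R.T (H g) * scalar c * (- R.T (H k))) = - scalar c * (?s * (R.T (H g) * R.T (H k)))" .
  qed
  also have "\<dots> \<approx>[R.J] - scalar c * 0"
    by (intro R.eqv_mult_left \<Phi>_symmetrization)
  finally show ?thesis by simp
qed

lemma mult_antipode_\<omega>_power: "mult_antipode (\<omega> ^ Suc n) \<approx>[R.J] 0"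
proof (induction n)
  case 0
  have "mult_antipode 1 = 1"
    using mult_antipode_tens[of 1 1] by (simp add: tens_1_left khom_1[OF khom_rgt] kantihom_1[OF kantihom_antialg_ext])
  then show ?case using mult_antipode_\<omega>_mult[of 1 1] by simp
next
  case (Suc n)
  then show ?case using mult_antipode_\<omega>_mult[of "\<omega> ^ Suc n" 0] by simp
qed

lemma mult_antipode_toral_element: "mult_antipode (hexp \<omega>) \<approx>[R.J] 1"
proof -
  have "mult_antipode (hexp1 \<omega>) = PS (\<lambda>n. scalar (fps_const (1 / fact (Suc n))) * mult_antipode (\<omega> ^ Suc n))"
    by (simp only: hexp1_def klinear_PS[OF klinear_mult_antipode] dp_def klinear_scalar[OF klinear_mult_antipode])
  also have "\<dots> \<approx>[R.J] PS (\<lambda>n. scalar (fps_const (1 / fact (Suc n))) * 0)"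
    by (intro R.eqv_PS R.eqv_mult_left mult_antipode_\<omega>_power)
  also have "\<dots> = 0"
    by (simp add: PS_def fps_eq_iff)
  finally have 1: "mult_antipode (hexp1 \<omega>) \<approx>[R.J] 0" .
  have "mult_antipode 1 = 1"
    using mult_antipode_tens[of 1 1] by (simp add: tens_1_left khom_1[OF khom_rgt] kantihom_1[OF kantihom_antialg_ext])
  then have "mult_antipode (hexp \<omega>) = 1 + fps_X * mult_antipode (hexp1 \<omega>)"
    by (simp add: hexp_hexp1 klinear_add[OF klinear_mult_antipode] klinear_X[OF klinear_mult_antipode])
  also have "\<dots> \<approx>[R.J] 1 + fps_X * 0"
    by (intro R.eqv_add R.eqv_refl R.eqv_mult_left 1)
  finally show ?thesis by simp
qed

end

section \<open>The isomorphism of topological Hopf algebras\<close>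

fun part_gens :: "part \<Rightarrow> ('n, 'h, 'k::field_char_0) qfree set" where
  "part_gens Whole = UNIV"
| "part_gens Positive_Borel = range (\<lambda>x. gen (Tor x)) \<union> range (\<lambda>i. gen (Egen i))"
| "part_gens Negative_Borel = range (\<lambda>x. gen (Tor x)) \<union> range (\<lambda>i. gen (Fgen i))"

text \<open>The full preimage, in the free algebra, of the selected part; \<open>J\<close> is
  adjoined to make it a union of cosets.\<close>

definition part_alg :: "part \<Rightarrow> ('n, 'h, 'k::field_char_0) qfree set \<Rightarrow> ('n, 'h, 'k) qfree set" where
  "part_alg X J = closed_alg_hull (part_gens X \<union> J)"

text \<open>\<open>Whole\<close> is a separate case because its tensor square is by definition the
  entire quotient, not a closed subalgebra generated by tensors.\<close>

definition part_alg2 :: "part \<Rightarrow> ('n, 'h, 'k::field_char_0) qfree set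
    \<Rightarrow> (('n, 'h) gen free_monoid \<times> ('n, 'h) gen free_monoid, 'k) calg set" where
  "part_alg2 X J = (if X = Whole then UNIV
     else closed_alg_hull ({tens a b | a b. a \<in> part_alg X J \<and> b \<in> part_alg X J} \<union> tensor_ideal J))"

lemma part_alg_Whole: "part_alg Whole J = UNIV"
  using closed_alg_hull_superset[of "UNIV \<union> J"] by (auto simp: part_alg_def)

lemma closed_alg_part_alg: "closed_alg (part_alg X J)"
  unfolding part_alg_def by (rule closed_alg_hull)

lemma closed_alg_part_alg2: "closed_alg (part_alg2 X J)"
  unfolding part_alg2_def by (simp add: closed_alg_hull closed_alg_UNIV)

lemma part_gens_mem: "a \<in> part_gens X \<Longrightarrow> a \<in> part_alg X J"
  unfolding part_alg_def using closed_alg_hull_superset by blast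

lemma Tor_mem: "gen (Tor x) \<in> part_alg X J"
  by (rule part_gens_mem) (cases X; auto)

lemma tens_mem_part_alg2: "a \<in> part_alg X J \<Longrightarrow> b \<in> part_alg X J \<Longrightarrow> tens a b \<in> part_alg2 X J"
  unfolding part_alg2_def
  using closed_alg_hull_superset[of "{tens a b | a b. a \<in> part_alg X J \<and> b \<in> part_alg X J} \<union> tensor_ideal J"]
  by auto

lemma image_Union_cls: "f ` (\<Union>x\<in>S. C x) = (\<Union>x\<in>S. f ` C x)"
  by auto

text \<open>\<open>quea\<close> and \<open>quot_algebra\<close> are records of different types, but
  subrings depend on the ring fields alone.\<close>

lemma subring_cong:
  assumes "carrier M = carrier N" "mult M = mult N" "one M = one N" "zero M = zero N" "add M = add N"
  shows "subring B M \<longleftrightarrow> subring B N"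
  unfolding subring_def submonoid_def subgroup_def m_inv_def by (simp add: assms)

lemma closed_subalgebra_cong:
  assumes "carrier M = carrier N" "mult M = mult N" "one M = one N" "zero M = zero N" "add M = add N"
    "smult M = smult N"
  shows "closed_subalgebra M S = closed_subalgebra N S"
  unfolding closed_subalgebra_def by (simp add: subring_cong[OF assms(1-5)] assms(6))

lemma restrict_fields:
  fixes H :: "('k, 'a, 'b) top_hopf"
  shows "carrier (H\<lparr>carrier := B, tensor_square := C\<rparr>) = B"
    "mult (H\<lparr>carrier := B, tensor_square := C\<rparr>) = mult H"
    "one (H\<lparr>carrier := B, tensor_square := C\<rparr>) = one H"
    "zero (H\<lparr>carrier := B, tensor_square := C\<rparr>) = zero H"
    "add (H\<lparr>carrier := B, tensor_square := C\<rparr>) = add H"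
    "smult (H\<lparr>carrier := B, tensor_square := C\<rparr>) = smult H"
    "tensor_square (H\<lparr>carrier := B, tensor_square := C\<rparr>) = C"
    "tensor (H\<lparr>carrier := B, tensor_square := C\<rparr>) = tensor H"
    "comult (H\<lparr>carrier := B, tensor_square := C\<rparr>) = comult H"
    "counit (H\<lparr>carrier := B, tensor_square := C\<rparr>) = counit H"
    "antipode (H\<lparr>carrier := B, tensor_square := C\<rparr>) = antipode H"
  by (cases H; simp)+

lemma quea_fields:
  "carrier (quea A d P R) = carrier (quot_algebra (quea_ideal A d P R))"
  "mult (quea A d P R) = mult (quot_algebra (quea_ideal A d P R))"
  "one (quea A d P R) = one (quot_algebra (quea_ideal A d P R))"
  "zero (quea A d P R) = zero (quot_algebra (quea_ideal A d P R))"
  "add (quea A d P R) = add (quot_algebra (quea_ideal A d P R))"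
  "smult (quea A d P R) = smult (quot_algebra (quea_ideal A d P R))"
  "tensor_square (quea A d P R) = quot_algebra (tensor_ideal (quea_ideal A d P R))"
  "tensor (quea A d P R) X Y = (\<Union>x\<in>X. \<Union>y\<in>Y. cls (tensor_ideal (quea_ideal A d P R)) (tens x y))"
  "comult (quea A d P R) X = (\<Union>x\<in>X. cls (tensor_ideal (quea_ideal A d P R)) (alg_ext (gen_comult R) x))"
  "counit (quea A d P R) X = the_elem (free_counit ` X)"
  "antipode (quea A d P R) X = (\<Union>x\<in>X. cls (quea_ideal A d P R) (antialg_ext (gen_antipode R) x))"
  by (simp_all add: quea_def Let_def module.defs top_hopf.defs)

lemma (in quea_calculus) tensor_cls:
  "tensor (quea A d P R) (cls J a) (cls J b) = cls (tensor_ideal J) (tens a b)"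
proof -
  interpret J2: cideal "tensor_ideal J" by (rule cideal_tensor_ideal)
  have *: "cls (tensor_ideal J) (tens x y) = cls (tensor_ideal J) (tens a b)"
    if "x \<in> cls J a" "y \<in> cls J b" for x y
    using that by (simp add: J2.cls_eq_iff mem_cls tensor_ideal_eqv cideal_axioms)
  have "tensor (quea A d P R) (cls J a) (cls J b) = (\<Union>x\<in>cls J a. \<Union>y\<in>cls J b. cls (tensor_ideal J) (tens a b))"
    unfolding quea_fields by (intro SUP_cong refl *)
  moreover have "cls J a \<noteq> {}" "cls J b \<noteq> {}"
    using cls_self by blast+
  ultimately show ?thesis by (simp only: UN_constant if_False)
qed

lemma (in quea_calculus) hopf_subalgebra_quea:
  assumes "X \<noteq> Whole"
  shows "hopf_subalgebra (quea A d P R) (cls J ` part_gens X) = (quea A d P R)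
    \<lparr>carrier := cls J ` part_alg X J,
     tensor_square := (quot_algebra (tensor_ideal J))\<lparr>carrier := cls (tensor_ideal J) ` part_alg2 X J\<rparr>\<rparr>"
proof -
  interpret J2: cideal "tensor_ideal J" by (rule cideal_tensor_ideal)
  have 1: "closed_subalgebra (quea A d P R) (cls J ` part_gens X) = cls J ` part_alg X J"
    unfolding part_alg_def closed_subalgebra_cls[symmetric]
    by (rule closed_subalgebra_cong) (simp_all only: quea_fields)
  have "{tensor (quea A d P R) x y |x y. x \<in> cls J ` part_alg X J \<and> y \<in> cls J ` part_alg X J} =
      cls (tensor_ideal J) ` {tens a b | a b. a \<in> part_alg X J \<and> b \<in> part_alg X J}"
  proof (intro Set.set_eqI iffI)
    fix s assume "s \<in> {tensor (quea A d P R) x y |x y. x \<in> cls J ` part_alg X J \<and> y \<in> cls J ` part_alg X J}"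
    then obtain a b where "a \<in> part_alg X J" "b \<in> part_alg X J" "s = tensor (quea A d P R) (cls J a) (cls J b)"
      by blast
    then show "s \<in> cls (tensor_ideal J) ` {tens a b | a b. a \<in> part_alg X J \<and> b \<in> part_alg X J}"
      unfolding tensor_cls by blast
  next
    fix s assume "s \<in> cls (tensor_ideal J) ` {tens a b | a b. a \<in> part_alg X J \<and> b \<in> part_alg X J}"
    then obtain a b where "a \<in> part_alg X J" "b \<in> part_alg X J" "s = tensor (quea A d P R) (cls J a) (cls J b)"
      unfolding tensor_cls by blast
    then show "s \<in> {tensor (quea A d P R) x y |x y. x \<in> cls J ` part_alg X J \<and> y \<in> cls J ` part_alg X J}"
      by blast
  qed
  then have 2: "closed_subalgebra (tensor_square (quea A d P R))
      {tensor (quea A d P R) x y |x y. x \<in> cls J ` part_alg X J \<and> y \<in> cls J ` part_alg X J} =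
      cls (tensor_ideal J) ` part_alg2 X J"
    using assms by (simp only: quea_fields J2.closed_subalgebra_cls part_alg2_def if_False)
  show ?thesis
    unfolding hopf_subalgebra_def Let_def 1 2 by (simp only: quea_fields)
qed

text \<open>One record shape for all three parts, so that the isomorphism can be proved for
  arbitrary \<open>X\<close>.\<close>

lemma quantum_algebra_eq:
  assumes "is_realization P R"
  shows "quantum_algebra X A d P R = (quea A d P R)
    \<lparr>carrier := cls (quea_ideal A d P R) ` part_alg X (quea_ideal A d P R),
     tensor_square := (quot_algebra (tensor_ideal (quea_ideal A d P R)))
       \<lparr>carrier := cls (tensor_ideal (quea_ideal A d P R)) ` part_alg2 X (quea_ideal A d P R)\<rparr>\<rparr>"
proof -
  interpret quea_calculus A d P R by standard (rule assms)
  show ?thesis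
  proof (cases X)
    case Whole
    have "(quot_algebra (tensor_ideal J))\<lparr>carrier := range (cls (tensor_ideal J))\<rparr> = quot_algebra (tensor_ideal J)"
      using quot_algebra_simps(1)[of "tensor_ideal J"] by (cases "quot_algebra (tensor_ideal J)") simp
    moreover have "(quea A d P R)\<lparr>carrier := range (cls J), tensor_square := quot_algebra (tensor_ideal J)\<rparr> = quea A d P R"
      using quea_fields(1,7)[of A d P R] quot_algebra_simps(1)[of J] by (cases "quea A d P R") simp
    ultimately show ?thesis
      by (simp add: Whole part_alg_Whole part_alg2_def)
  next
    case Positive_Borel
    then show ?thesis
      using hopf_subalgebra_quea[of X] by (simp add: borel_plus_def)
  next
    case Negative_Borel
    then show ?thesis
      using hopf_subalgebra_quea[of X] by (simp add: borel_minus_def)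
  qed
qed

text \<open>The inverse is a definite description over the carrier of \<open>M\<close>, so
  uniqueness is needed as well. For a Borel part that carrier is smaller than the quotient, whence
  the condition that the class of \<open>b\<close> belongs to it.\<close>

lemma (in cideal) inv_cls:
  assumes "carrier M \<subseteq> range (cls J)" "mult M = rcoset_mult full_ring J" "one M = cls J 1"
    and "cls J b \<in> carrier M" "a * b = 1" "b * a = 1"
  shows "inv\<^bsub>M\<^esub> (cls J a) = cls J b"
  unfolding m_inv_def
proof (rule the_equality)
  show "cls J b \<in> carrier M \<and> cls J a \<otimes>\<^bsub>M\<^esub> cls J b = \<one>\<^bsub>M\<^esub> \<and> cls J b \<otimes>\<^bsub>M\<^esub> cls J a = \<one>\<^bsub>M\<^esub>"
    by (simp add: assms cls_mult)
  fix Y assume "Y \<in> carrier M \<and> cls J a \<otimes>\<^bsub>M\<^esub> Y = \<one>\<^bsub>M\<^esub> \<and> Y \<otimes>\<^bsub>M\<^esub> cls J a = \<one>\<^bsub>M\<^esub>"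
  then have Y: "Y \<in> range (cls J)" "rcoset_mult full_ring J (cls J a) Y = cls J 1"
    using assms(1-3) by auto
  then obtain c where c: "Y = cls J c" by blast
  with Y(2) have ac: "a * c \<approx>[J] 1" by (simp add: cls_mult cls_eq_iff)
  have "c = b * (a * c)" using assms(6) by (simp flip: mult.assoc)
  also have "\<dots> \<approx>[J] b" using eqv_mult_left[OF ac, of b] by simp
  finally show "Y = cls J b" by (simp add: c cls_eq_iff)
qed

text \<open>The maps are inverse to each other on the nose and exchange the ideals, so taking direct
  images of cosets as sets is the induced map on quotients.\<close>

locale calg_iso =
  J: cideal J + J': cideal J' for J :: "('m::monoid_add, 'k::field_char_0) calg set"
    and J' :: "('m'::monoid_add, 'k) calg set" +
  fixes \<phi> :: "('m', 'k) calg \<Rightarrow> ('m, 'k) calg" and \<psi> :: "('m, 'k) calg \<Rightarrow> ('m', 'k) calg"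
  assumes hom: "khom \<phi>" and hom': "khom \<psi>"
    and \<phi>_\<psi>: "\<phi> (\<psi> x) = x" and \<psi>_\<phi>: "\<psi> (\<phi> z) = z"
    and image_J': "\<phi> ` J' \<subseteq> J" and image_J: "\<psi> ` J \<subseteq> J'"
begin

lemma image_eq: "\<phi> ` U' \<subseteq> U \<Longrightarrow> \<psi> ` U \<subseteq> U' \<Longrightarrow> \<phi> ` U' = U"
proof (rule equalityI)
  assume "\<psi> ` U \<subseteq> U'"
  then have "\<phi> ` \<psi> ` U \<subseteq> \<phi> ` U'" by (rule image_mono)
  then show "U \<subseteq> \<phi> ` U'" by (simp add: image_image \<phi>_\<psi>)
qed

lemma image_cls: "\<phi> ` cls J' a = cls J (\<phi> a)"
proof -
  have "\<phi> ` J' = J" by (rule image_eq[OF image_J' image_J])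
  then show ?thesis
    by (auto simp: cls_image image_image khom_add[OF hom])
qed

lemma algebra_iso_image:
  assumes "\<phi> ` U' = U"
    and M: "carrier M = cls J' ` U'" "mult M = rcoset_mult full_ring J'" "one M = cls J' 1"
      "add M = set_add full_ring" "\<And>c X. smult M c X = rcoset_mult full_ring J' (cls J' (scalar c)) X"
    and N: "carrier N = cls J ` U" "mult N = rcoset_mult full_ring J" "one N = cls J 1"
      "add N = set_add full_ring" "\<And>c X. smult N c X = rcoset_mult full_ring J (cls J (scalar c)) X"
  shows "(\<lambda>X. \<phi> ` X) \<in> algebra_iso M N"
proof -
  have "(\<lambda>X. \<phi> ` X) \<in> ring_hom M N"
  proof (rule ring_hom_memI)
    fix X Y assume "X \<in> carrier M" "Y \<in> carrier M"
    then obtain a b where "X = cls J' a" "Y = cls J' b" "a \<in> U'" by (auto simp: M)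
    then show "\<phi> ` X \<in> carrier N" "\<phi> ` (X \<otimes>\<^bsub>M\<^esub> Y) = \<phi> ` X \<otimes>\<^bsub>N\<^esub> \<phi> ` Y"
      "\<phi> ` (X \<oplus>\<^bsub>M\<^esub> Y) = \<phi> ` X \<oplus>\<^bsub>N\<^esub> \<phi> ` Y"
      using assms(1) by (simp_all add: M N image_cls J.cls_mult J'.cls_mult J.cls_add J'.cls_add
          khom_mult[OF hom] khom_add[OF hom]) blast
  qed (simp add: M N image_cls khom_1[OF hom])
  moreover have "bij_betw (\<lambda>X. \<phi> ` X) (carrier M) (carrier N)"
  proof (rule bij_betw_byWitness[where f' = "\<lambda>Y. \<psi> ` Y"])
    show "\<forall>X\<in>carrier M. \<psi> ` \<phi> ` X = X" "\<forall>Y\<in>carrier N. \<phi> ` \<psi> ` Y = Y"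
      by (simp_all add: image_image \<phi>_\<psi> \<psi>_\<phi>)
    show "(\<lambda>X. \<phi> ` X) ` carrier M \<subseteq> carrier N"
      using assms(1) by (auto simp: M N image_cls)
    show "(\<lambda>Y. \<psi> ` Y) ` carrier N \<subseteq> carrier M"
    proof (rule image_subsetI)
      fix Y assume "Y \<in> carrier N"
      then obtain u' where "u' \<in> U'" "Y = \<phi> ` cls J' u'"
        using assms(1) by (auto simp: N image_cls)
      then show "\<psi> ` Y \<in> carrier M"
        by (simp add: M image_image \<psi>_\<phi>)
    qed
  qed
  moreover have "\<phi> ` (c \<odot>\<^bsub>M\<^esub> X) = c \<odot>\<^bsub>N\<^esub> \<phi> ` X" if X: "X \<in> carrier M" for c X
  proof -
    obtain a where "X = cls J' a" using X by (auto simp: M)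
    then show ?thesis
      by (simp add: M N image_cls J.cls_mult J'.cls_mult khom_mult[OF hom] khom_scalar[OF hom])
  qed
  ultimately show ?thesis
    by (simp add: algebra_iso_def ring_iso_def)
qed

lemma calg_iso_tensor: "calg_iso (tensor_ideal J) (tensor_ideal J') (tens_map \<phi>) (tens_map \<psi>)"
proof -
  interpret T: cideal "tensor_ideal J" by (rule cideal_tensor_ideal)
  interpret T': cideal "tensor_ideal J'" by (rule cideal_tensor_ideal)
  show ?thesis
    by unfold_locales
      (rule khom_tens_map[OF hom] khom_tens_map[OF hom'] tens_map_inverse[OF hom hom' \<phi>_\<psi>]
        tens_map_inverse[OF hom' hom \<psi>_\<phi>] tens_map_tensor_ideal[OF hom image_J']
        tens_map_tensor_ideal[OF hom' image_J])+
qed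

end

text \<open>Every part is closed, so with y_i it contains the series e^(\<hbar>y_i), and a rescaled
  generator stays in its Borel part.\<close>

lemma (in quea_iso) \<phi>_part_alg:
  assumes "\<And>i. y i \<in> part_alg X R.J"
  shows "\<phi> ` part_alg X R'.J \<subseteq> part_alg X R.J"
proof (cases "X = Whole")
  case True
  then show ?thesis by (simp add: part_alg_Whole)
next
  case False
  interpret U: closed_alg "part_alg X R.J" by (rule closed_alg_part_alg)
  have "\<phi> ` part_gens X \<subseteq> part_alg X R.J"
  proof (rule image_subsetI)
    fix a :: "('n, 'h', 'k) qfree" assume "a \<in> part_gens X"
    then consider x where "a = gen (Tor x)"
      | i where "a = gen (Egen i)" "R.E i \<in> part_gens X"
      | i where "a = gen (Fgen i)" "R.F i \<in> part_gens X"
      using False by (cases X) auto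
    then show "\<phi> a \<in> part_alg X R.J"
      by cases (simp_all add: Tor_mem U.times_mem U.hexp_mem assms part_gens_mem)
  qed
  moreover have "\<phi> ` R'.J \<subseteq> part_alg X R.J"
    using \<phi>_ideal closed_alg_hull_superset unfolding part_alg_def by blast
  ultimately show ?thesis
    unfolding part_alg_def by (intro khom_closed_alg_hull khom_\<phi>) (simp add: image_Un)
qed

lemma tens_map_part_alg2:
  assumes "khom L" "L ` J' \<subseteq> J" "L ` part_alg X J' \<subseteq> part_alg X J"
  shows "tens_map L ` part_alg2 X J' \<subseteq> part_alg2 X J"
proof (cases "X = Whole")
  case True
  then show ?thesis by (simp add: part_alg2_def)
next
  case False
  have "tens_map L x \<in> part_alg2 X J"
    if x: "x \<in> {tens a b | a b. a \<in> part_alg X J' \<and> b \<in> part_alg X J'}" for x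
  proof -
    obtain a b where "x = tens a b" "a \<in> part_alg X J'" "b \<in> part_alg X J'" using x by blast
    then show ?thesis
      using assms(3) by (auto simp: tens_map_tens[OF assms(1)] intro!: tens_mem_part_alg2)
  qed
  moreover have "tensor_ideal J \<subseteq> part_alg2 X J"
    using closed_alg_hull_superset[of "{tens a b | a b. a \<in> part_alg X J \<and> b \<in> part_alg X J} \<union> tensor_ideal J"] False
    unfolding part_alg2_def by simp
  then have "tens_map L ` tensor_ideal J' \<subseteq> part_alg2 X J"
    using tens_map_tensor_ideal[OF assms(1,2)] by blast
  ultimately have "tens_map L ` ({tens a b | a b. a \<in> part_alg X J' \<and> b \<in> part_alg X J'} \<union> tensor_ideal J') \<subseteq> part_alg2 X J"
    by blast
  then show ?thesis
    unfolding part_alg2_def using False by (simp add: khom_closed_alg_hull khom_tens_map assms(1))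
qed

locale quea_twist_iso = quea_twist A d P R P' R' f Z t H \<Phi>
  for A :: "int ^ 'n ^ 'n" and d :: "'n::finite \<Rightarrow> nat"
    and P :: "'k::field_char_0 fps ^ 'n ^ 'n" and R :: "('n, 'k, 'h::ab_group_add) realization"
    and P' :: "'k fps ^ 'n ^ 'n" and R' :: "('n, 'k, 'h'::ab_group_add) realization"
    and f :: "'h' \<Rightarrow> 'h" and Z :: "'n \<Rightarrow> 'h" and t H \<Phi> +
  fixes f' :: "'h \<Rightarrow> 'h'"
  assumes f_f': "f (f' x) = x" and f'_f: "f' (f z) = z"
begin

lemma f'_add: "f' (x + y) = f' x + f' y"
  by (metis f_add f_f' f'_f)

lemma f'_scale: "f' (scale R c x) = scale R' c (f' x)"
  by (metis f_scale f_f' f'_f)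

lemma f'_minus: "f' (- x) = - f' x"
  using f'_add[of x "-x"] f'_add[of 0 0] by (simp add: eq_neg_iff_add_eq_0 add.commute)

lemma root_f': "root R' j (f' x) = root R j x"
  by (metis root_f f_f')

text \<open>With the two realizations exchanged and Z_i replaced by its transported negative, the
  whole theory of \<open>\<phi>\<close> applies to the inverse, in particular the inclusion of
  ideals.\<close>

lemma quea_iso_inverse:
  "quea_iso A d P' R' P R f' (\<lambda>i. - f' (Z i)) (\<lambda>i. - gen (Tor (f' (Z i))))"
proof (rule quea_iso.intro[OF R'.quea_calculus_axioms R.quea_calculus_axioms], rule quea_iso_axioms.intro)
  show "module_hom (scale R) (scale R') f'"
    using R.module_R R'.module_R f'_add f'_scale
    by (simp add: module_hom_def module_hom_axioms_def)
  fix i j x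
  show "root R' j (f' x) = root R j x" by (rule root_f')
  show "f' (Tplus R i) = Tplus R' i + (- f' (Z i) + - f' (Z i))"
    using f_Tplus[of i] by (metis (no_types) add.inverse_distrib_swap add_diff_cancel_right' diff_conv_add_uminus f'_add f'_minus f'_f)
  show "f' (Tminus R i) = Tminus R' i - (- f' (Z i) + - f' (Z i))"
    using f_Tminus[of i] by (metis (no_types) diff_conv_add_uminus diff_add_cancel f'_add f'_minus f'_f add.inverse_distrib_swap)
  show "root R' j (- f' (Z i)) = - root R' i (- f' (Z j))"
    using Z_antisym[of j i] by (simp add: R'.root_minus root_f')
  show "- R'.T (f' (Z i)) \<approx>[R'.J] R'.T (- f' (Z i))"
    by (rule R'.eqv_sym[OF R'.T_minus])
qed

sublocale inv: quea_iso A d P' R' P R f' "\<lambda>i. - f' (Z i)" "\<lambda>i. - gen (Tor (f' (Z i)))"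
  by (rule quea_iso_inverse)

lemma \<phi>_inverse: "\<phi> (inv.\<phi> x) = x" "inv.\<phi> (\<phi> z) = z"
proof -
  show "\<phi> (inv.\<phi> x) = x"
  proof (rule khom_unique[where L = "\<lambda>x. \<phi> (inv.\<phi> x)" and M = "\<lambda>x. x"])
    show "\<phi> (inv.\<phi> (gen g)) = gen g" for g
      by (cases g) (simp_all add: khom_mult[OF khom_\<phi>] khom_hexp[OF khom_\<phi>] khom_minus[OF khom_\<phi>] f_f')
  qed (rule khom_comp[OF khom_\<phi> inv.khom_\<phi>] khom_id)+
  show "inv.\<phi> (\<phi> z) = z"
  proof (rule khom_unique[where L = "\<lambda>z. inv.\<phi> (\<phi> z)" and M = "\<lambda>z. z"])
    show "inv.\<phi> (\<phi> (gen g)) = gen g" for g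
      by (cases g) (simp_all add: khom_mult[OF inv.khom_\<phi>] khom_hexp[OF inv.khom_\<phi>] f'_f)
  qed (rule khom_comp[OF inv.khom_\<phi> khom_\<phi>] khom_id)+
qed

sublocale iso: calg_iso R.J R'.J \<phi> inv.\<phi>
  by unfold_locales (rule khom_\<phi> inv.khom_\<phi> \<phi>_inverse \<phi>_ideal inv.\<phi>_ideal)+

sublocale iso2: calg_iso J2 "tensor_ideal R'.J" "tens_map \<phi>" "tens_map inv.\<phi>"
  by (rule iso.calg_iso_tensor)

lemma \<phi>_image_part_alg: "\<phi> ` part_alg X R'.J = part_alg X R.J"
  by (intro iso.image_eq \<phi>_part_alg inv.\<phi>_part_alg Tor_mem
      closed_alg.uminus_mem[OF closed_alg_part_alg])

lemma \<phi>_image_part_alg2: "tens_map \<phi> ` part_alg2 X R'.J = part_alg2 X R.J"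
proof (rule iso2.image_eq)
  show "tens_map \<phi> ` part_alg2 X R'.J \<subseteq> part_alg2 X R.J"
    using \<phi>_image_part_alg by (intro tens_map_part_alg2 khom_\<phi> \<phi>_ideal) simp
  show "tens_map inv.\<phi> ` part_alg2 X R.J \<subseteq> part_alg2 X R'.J"
    by (intro tens_map_part_alg2 inv.khom_\<phi> inv.\<phi>_ideal inv.\<phi>_part_alg Tor_mem
      closed_alg.uminus_mem[OF closed_alg_part_alg])
qed

lemma \<omega>_mem: "\<omega> \<in> part_alg2 X R.J"
proof -
  interpret U: closed_alg "part_alg2 X R.J" by (rule closed_alg_part_alg2)
  show ?thesis
    unfolding \<omega>_def by (intro U.sums_mem U.scalar_mult_mem tens_mem_part_alg2 Tor_mem)
qed

theorem hopf_isomorphic_toral_twist: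
  "quantum_algebra X A d P' R' \<cong>\<^sub>H toral_twist X A d P R t H \<Phi>"
proof -
  interpret U: closed_alg "part_alg X R.J" by (rule closed_alg_part_alg)
  interpret U2: closed_alg "part_alg2 X R.J" by (rule closed_alg_part_alg2)
  let ?Q' = "quantum_algebra X A d P' R'" and ?Q = "quantum_algebra X A d P R"
  let ?K = "toral_twist X A d P R t H \<Phi>"
  let ?v = "lin_ext (\<lambda>(u, w). monom u * antipode_R (monom w)) (hexp \<omega>)"
  note Q' = quantum_algebra_eq[OF R'.real, of X A d] and Q = quantum_algebra_eq[OF R.real, of X A d]
  note fields = restrict_fields quea_fields quot_algebra_simps
  have K: "?K = twist_by (cls J2 (hexp \<omega>)) (cls R.J ?v) ?Q"
    unfolding toral_twist_def Let_def toral_element_hexp ..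
  have v: "cls R.J ?v = cls R.J 1"
    using mult_antipode_toral_element unfolding mult_antipode_def by (simp add: R.cls_eq_iff)
  have inv_v: "inv\<^bsub>?Q\<^esub> (cls R.J 1) = cls R.J 1"
    by (rule R.inv_cls) (auto simp: Q fields intro: U.one_mem)
  \<comment> \<open>The inverse is formed inside the tensor square of the selected part, hence the
    membership of \<omega> there.\<close>
  have inv_F: "inv\<^bsub>tensor_square ?Q\<^esub> (cls J2 (hexp \<omega>)) = cls J2 (hexp (- \<omega>))"
    by (rule J2.inv_cls) (auto simp: Q fields intro!: imageI U2.hexp_mem U2.uminus_mem \<omega>_mem)
  have comult_K: "comult ?K X = (\<Union>x\<in>X. cls J2 (Ad (alg_ext (gen_comult R) x)))" for X
    unfolding K twist_by_def Ad_def
    by (simp add: inv_F) (simp add: Q fields J2.rcoset_mult_UN_right J2.rcoset_mult_UN_left)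
  have antipode_K: "antipode ?K X = (\<Union>x\<in>X. cls R.J (antipode_R x))" for X
    unfolding K twist_by_def
    by (simp add: v inv_v) (simp add: Q fields R.rcoset_mult_UN_right R.rcoset_mult_UN_left)
  have K_fields: "carrier ?K = carrier ?Q" "mult ?K = mult ?Q" "one ?K = one ?Q" "add ?K = add ?Q"
    "smult ?K = smult ?Q" "tensor_square ?K = tensor_square ?Q" "tensor ?K = tensor ?Q" "counit ?K = counit ?Q"
    by (simp_all add: K twist_by_def)
  show ?thesis
    unfolding hopf_isomorphic_def
  proof (intro exI conjI ballI)
    show "(\<lambda>X. \<phi> ` X) \<in> algebra_iso ?Q' ?K"
      by (rule iso.algebra_iso_image[OF \<phi>_image_part_alg[of X]]) (simp_all add: K_fields Q Q' fields)
    show "(\<lambda>X. tens_map \<phi> ` X) \<in> algebra_iso (tensor_square ?Q') (tensor_square ?K)"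
      by (rule iso2.algebra_iso_image[OF \<phi>_image_part_alg2[of X]]) (simp_all add: K_fields Q Q' fields)
    fix S
    show "tens_map \<phi> ` tensor ?Q' S S' = tensor ?K (\<phi> ` S) (\<phi> ` S')" for S'
      by (simp add: K_fields Q Q' fields image_Union_cls iso2.image_cls tens_map_tens khom_\<phi>)
    have "cls J2 (tens_map \<phi> (alg_ext (gen_comult R') x)) = cls J2 (Ad (alg_ext (gen_comult R) (\<phi> x)))" for x
      unfolding J2.cls_eq_iff by (rule comult_\<phi>)
    then show "tens_map \<phi> ` comult ?Q' S = comult ?K (\<phi> ` S)"
      by (simp add: comult_K Q' fields image_Union_cls iso2.image_cls)
    show "counit ?K (\<phi> ` S) = counit ?Q' S"
      by (simp add: K_fields Q Q' fields image_image free_counit_\<phi>)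
    have "cls R.J (\<phi> (antialg_ext (gen_antipode R') x)) = cls R.J (antipode_R (\<phi> x))" for x
      unfolding R.cls_eq_iff by (rule antipode_\<phi>)
    then show "\<phi> ` antipode ?Q' S = antipode ?K (\<phi> ` S)"
      by (simp add: antipode_K Q' fields image_Union_cls iso.image_cls)
  qed
qed

end

section \<open>Linear algebra over a field and over power series\<close>

text \<open>Elimination without division, so that it applies to power series as well as to
  fields.\<close>

lemma underdetermined_system:
  fixes D :: "'i \<Rightarrow> 'j \<Rightarrow> 'a::idom"
  assumes "finite J" "finite I" "card J < card I"
  shows "\<exists>c. (\<exists>i\<in>I. c i \<noteq> 0) \<and> (\<forall>j\<in>J. (\<Sum>i\<in>I. c i * D i j) = 0)"
  using assms
proof (induction J arbitrary: I D rule: finite_induct)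
  case empty
  then have "I \<noteq> {}" by auto
  then show ?case by (intro exI[of _ "\<lambda>_. 1"]) auto
next
  case (insert j J)
  show ?case
  proof (cases "\<forall>i\<in>I. D i j = 0")
    case True
    obtain c where "\<exists>i\<in>I. c i \<noteq> 0" "\<forall>l\<in>J. (\<Sum>i\<in>I. c i * D i l) = 0"
      using insert.IH[of I D] insert.prems insert.hyps by auto
    then show ?thesis using True by (intro exI[of _ c]) auto
  next
    case False
    then obtain p where p: "p \<in> I" "D p j \<noteq> 0" by blast
    let ?I = "I - {p}"
    have "card J < card ?I"
      using insert p by (simp add: card_insert_if)
    then obtain c where c: "\<exists>i\<in>?I. c i \<noteq> 0"
      "\<forall>l\<in>J. (\<Sum>i\<in>?I. c i * (D p j * D i l - D i j * D p l)) = 0"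
      using insert.IH[of ?I "\<lambda>i l. D p j * D i l - D i j * D p l"] insert.prems by auto
    \<comment> \<open>All other coefficients are scaled by \<open>D p j\<close>; the equation for
      \<open>j\<close> then forces the pivot coefficient.\<close>
    define c' where "c' i = (if i = p then - (\<Sum>i\<in>?I. D i j * c i) else D p j * c i)" for i
    have split: "(\<Sum>i\<in>I. c' i * D i l) = (\<Sum>i\<in>?I. c i * (D p j * D i l - D i j * D p l))" for l
    proof -
      have "(\<Sum>i\<in>I. c' i * D i l) = c' p * D p l + (\<Sum>i\<in>?I. c' i * D i l)"
        using p insert.prems by (simp add: sum.remove)
      also have "(\<Sum>i\<in>?I. c' i * D i l) = (\<Sum>i\<in>?I. D p j * c i * D i l)"
        by (intro sum.cong) (auto simp: c'_def)
      also have "c' p * D p l + \<dots> = (\<Sum>i\<in>?I. - (D i j * c i) * D p l + D p j * c i * D i l)"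
        by (simp add: c'_def sum.distrib sum_negf sum_distrib_right sum_subtractf)
      also have "\<dots> = (\<Sum>i\<in>?I. c i * (D p j * D i l - D i j * D p l))"
        by (intro sum.cong refl) (simp add: algebra_simps)
      finally show ?thesis .
    qed
    have "\<exists>i\<in>I. c' i \<noteq> 0"
      using c(1) p by (auto simp: c'_def)
    moreover have "\<forall>l\<in>insert j J. (\<Sum>i\<in>I. c' i * D i l) = 0"
      using c(2) unfolding split by (auto simp: algebra_simps)
    ultimately show ?thesis by blast
  qed
qed

text \<open>A largest subset of \<open>E\<close> independent modulo the span of the rows
  \<open>a\<close> spans the rest together with them. The rows \<open>a\<close> may be dependent
  among themselves, so only the coefficients \<open>x\<close> are forced to vanish.\<close>

lemma relative_basis:
  fixes a :: "'i \<Rightarrow> 'j \<Rightarrow> 'k::field" and e :: "'c \<Rightarrow> 'j \<Rightarrow> 'k"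
  assumes "finite E"
  shows "\<exists>C\<subseteq>E. (\<forall>s x. (\<forall>j\<in>J. (\<Sum>i\<in>I. s i * a i j) + (\<Sum>c\<in>C. x c * e c j) = 0) \<longrightarrow> (\<forall>c\<in>C. x c = 0)) \<and>
    (\<forall>c\<in>E. \<exists>s x. \<forall>j\<in>J. e c j = (\<Sum>i\<in>I. s i * a i j) + (\<Sum>c\<in>C. x c * e c j))"
proof -
  define indep where "indep C \<longleftrightarrow>
    (\<forall>s x. (\<forall>j\<in>J. (\<Sum>i\<in>I. s i * a i j) + (\<Sum>c\<in>C. x c * e c j) = 0) \<longrightarrow> (\<forall>c\<in>C. x c = 0))" for C
  have "\<exists>C. (C \<subseteq> E \<and> indep C) \<and> (\<forall>C'. C' \<subseteq> E \<and> indep C' \<longrightarrow> card C' \<le> card C)"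
    by (rule ex_has_greatest_nat[of _ "{}" _ "card E + 1"]) (auto simp: indep_def card_mono assms le_imp_less_Suc)
  then obtain C where C: "C \<subseteq> E" "indep C" and max: "\<And>C'. C' \<subseteq> E \<Longrightarrow> indep C' \<Longrightarrow> card C' \<le> card C"
    by blast
  have fin: "finite C" using C(1) assms by (rule finite_subset)
  have "\<exists>s x. \<forall>j\<in>J. e b j = (\<Sum>i\<in>I. s i * a i j) + (\<Sum>c\<in>C. x c * e c j)" if b: "b \<in> E" for b
  proof (cases "b \<in> C")
    case True
    have "\<forall>j\<in>J. e b j = (\<Sum>i\<in>I. 0 * a i j) + (\<Sum>c\<in>C. (if c = b then 1 else 0) * e c j)"
      using True fin by (simp add: if_distrib[of "\<lambda>x. x * _"] sum.delta cong: if_cong)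
    then show ?thesis by (intro exI[of _ "\<lambda>_. 0"] exI[of _ "\<lambda>c. if c = b then 1 else 0"]) simp
  next
    case False
    have "\<not> indep (insert b C)"
      using max[of "insert b C"] C(1) b False fin by auto
    then obtain s x where rel: "\<forall>j\<in>J. (\<Sum>i\<in>I. s i * a i j) + (\<Sum>c\<in>insert b C. x c * e c j) = 0"
      and nz: "\<exists>c\<in>insert b C. x c \<noteq> 0"
      unfolding indep_def by blast
    have rel': "(\<Sum>i\<in>I. s i * a i j) + (\<Sum>c\<in>C. x c * e c j) = - (x b * e b j)" if "j \<in> J" for j
      using rel that False fin by (simp add: eq_neg_iff_add_eq_0 algebra_simps)
    have xb: "x b \<noteq> 0"
    proof
      assume "x b = 0"
      then have "\<forall>c\<in>C. x c = 0" using rel' C(2) unfolding indep_def by auto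
      then show False using nz \<open>x b = 0\<close> by auto
    qed
    have "e b j = (\<Sum>i\<in>I. (- s i / x b) * a i j) + (\<Sum>c\<in>C. (- x c / x b) * e c j)" if "j \<in> J" for j
    proof -
      have "(\<Sum>i\<in>I. (- s i / x b) * a i j) + (\<Sum>c\<in>C. (- x c / x b) * e c j) =
          - ((\<Sum>i\<in>I. s i * a i j) + (\<Sum>c\<in>C. x c * e c j)) / x b"
        by (simp add: sum_negf sum_divide_distrib[symmetric] add_divide_distrib diff_divide_distrib)
      also have "\<dots> = e b j" using rel'[OF that] xb by simp
      finally show ?thesis by simp
    qed
    then show ?thesis
      by (intro exI[of _ "\<lambda>i. - s i / x b"] exI[of _ "\<lambda>c. - x c / x b"]) simp
  qed
  then show ?thesis
    using C(1) C(2)[unfolded indep_def] by (intro exI[of _ C] conjI ballI)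
qed

lemma unit_system:
  fixes N :: "'i \<Rightarrow> 'i \<Rightarrow> 'k::field fps" and v :: "'i \<Rightarrow> 'k fps"
  assumes fin: "finite I" and N0: "\<And>i j. i \<in> I \<Longrightarrow> j \<in> I \<Longrightarrow> fps_nth (N i j) 0 = (if i = j then 1 else 0)"
  shows "\<exists>x. \<forall>i\<in>I. (\<Sum>j\<in>I. N i j * x j) = v i"
proof -
  \<comment> \<open>Comparing coefficients of \<open>\<hbar>\<^sup>n\<close> determines the \<open>n\<close>-th coefficients of the solution recursively.\<close>
  define step where "step n y i = fps_nth (v i) n - (\<Sum>l<n. \<Sum>j\<in>I. fps_nth (N i j) (n - l) * y l j)"
    for n and y :: "nat \<Rightarrow> 'i \<Rightarrow> 'k" and i
  define y where "y = wfrec less_than (\<lambda>y n. step n y)"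
  have y: "y n = step n y" for n
  proof -
    have "y n = step n (cut y less_than n)"
      unfolding y_def by (subst wfrec) simp_all
    also have "\<dots> = step n y"
      by (auto simp: step_def cut_def intro!: ext)
    finally show ?thesis .
  qed
  define x where "x j = Abs_fps (\<lambda>n. y n j)" for j
  have "(\<Sum>j\<in>I. N i j * x j) = v i" if i: "i \<in> I" for i
  proof (rule fps_ext)
    fix n
    have "fps_nth (\<Sum>j\<in>I. N i j * x j) n = (\<Sum>j\<in>I. \<Sum>l\<le>n. fps_nth (N i j) (n - l) * y l j)"
    proof -
      have "fps_nth (N i j * x j) n = (\<Sum>l\<le>n. fps_nth (N i j) (n - l) * y l j)" for j
        unfolding fps_mult_nth x_def
        by (rule sum.reindex_bij_witness[of _ "\<lambda>l. n - l" "\<lambda>l. n - l"]) auto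
      then show ?thesis by (simp add: fps_sum_nth)
    qed
    also have "\<dots> = (\<Sum>l\<le>n. \<Sum>j\<in>I. fps_nth (N i j) (n - l) * y l j)"
      by (rule sum.swap)
    also have "\<dots> = (\<Sum>l<n. \<Sum>j\<in>I. fps_nth (N i j) (n - l) * y l j) + (\<Sum>j\<in>I. fps_nth (N i j) 0 * y n j)"
      by (simp add: lessThan_Suc_atMost[symmetric])
    also have "(\<Sum>j\<in>I. fps_nth (N i j) 0 * y n j) = y n i"
      using i fin by (simp add: N0 if_distrib[of "\<lambda>x. x * _"] cong: if_cong sum.cong)
    also have "y n i = step n y i" by (simp only: y[of n])
    finally show "fps_nth (\<Sum>j\<in>I. N i j * x j) n = fps_nth (v i) n"
      by (simp add: step_def)
  qed
  then show ?thesis by blast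
qed

lemma fps_const_shift: "(c :: 'k::field fps) = fps_const (fps_nth c 0) + fps_X * fps_shift 1 c"
  by (auto simp: fps_eq_iff)

section \<open>Frames of free modules over power series\<close>

text \<open>A finite basis as an indexed family. The index set is arbitrary so that sum types can
  label frames assembled from several families.\<close>

definition frame :: "('k::field_char_0 fps \<Rightarrow> 'h \<Rightarrow> 'h::ab_group_add) \<Rightarrow> 'i set \<Rightarrow> ('i \<Rightarrow> 'h) \<Rightarrow> bool" where
  "frame s I e \<longleftrightarrow> finite I \<and> (\<forall>x. \<exists>c. x = (\<Sum>i\<in>I. s (c i) (e i))) \<and>
     (\<forall>c. (\<Sum>i\<in>I. s (c i) (e i)) = 0 \<longrightarrow> (\<forall>i\<in>I. c i = 0))"

lemma is_basis_frame:
  assumes "Modules.module s" "is_basis s t H"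
  shows "frame s {..<t} H"
proof -
  interpret Modules.module s by fact
  have inj: "inj_on H {..<t}" and ind: "\<not> dependent (H ` {..<t})" and span: "span (H ` {..<t}) = UNIV"
    using assms(2) by (auto simp: is_basis_def)
  have "\<exists>c. x = (\<Sum>g<t. s (c g) (H g))" for x
  proof -
    have "x \<in> span (H ` {..<t})" using span by simp
    then obtain u where "x = (\<Sum>v\<in>H ` {..<t}. s (u v) v)"
      by (auto simp: span_finite)
    then have "x = (\<Sum>g<t. s (u (H g)) (H g))"
      by (simp add: sum.reindex[OF inj])
    then show ?thesis by (intro exI[of _ "\<lambda>g. u (H g)"])
  qed
  moreover have "\<forall>g<t. c g = 0" if "(\<Sum>g<t. s (c g) (H g)) = 0" for c
  proof (rule ccontr)
    assume "\<not> (\<forall>g<t. c g = 0)"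
    then obtain g where g: "g < t" "c g \<noteq> 0" by blast
    let ?u = "\<lambda>v. c (the_inv_into {..<t} H v)"
    have "(\<Sum>v\<in>H ` {..<t}. s (?u v) v) = (\<Sum>g<t. s (c g) (H g))"
      by (simp add: sum.reindex[OF inj] the_inv_into_f_f[OF inj] cong: sum.cong_simp)
    then have "dependent (H ` {..<t})"
      unfolding dependent_finite[OF finite_imageI[OF finite_lessThan]]
      using that g inj by (intro exI[of _ ?u]) (auto simp: the_inv_into_f_f intro!: bexI[of _ "H g"])
    then show False using ind by simp
  qed
  ultimately show ?thesis by (auto simp: frame_def)
qed

locale framed_module = Modules.module s
  for s :: "'k::field_char_0 fps \<Rightarrow> 'h \<Rightarrow> 'h::ab_group_add" +
  fixes I :: "'i set" and e :: "'i \<Rightarrow> 'h"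
  assumes frame: "frame s I e"
begin

lemma finite_I: "finite I"
  using frame by (simp add: frame_def)

lemma frame_indep: "(\<Sum>i\<in>I. s (c i) (e i)) = 0 \<Longrightarrow> i \<in> I \<Longrightarrow> c i = 0"
  using frame by (auto simp: frame_def)

text \<open>Only the values on \<open>I\<close> are determined, whence the condition i \<in> I in
  the rules below.\<close>

definition coord :: "'h \<Rightarrow> 'i \<Rightarrow> 'k fps" where
  "coord x = (SOME c. x = (\<Sum>i\<in>I. s (c i) (e i)))"

lemma coord_sum: "(\<Sum>i\<in>I. s (coord x i) (e i)) = x"
proof -
  have "\<exists>c. x = (\<Sum>i\<in>I. s (c i) (e i))"
    using frame by (auto simp: frame_def)
  then show ?thesis unfolding coord_def by (rule someI2_ex) simp
qed

lemma coord_unique: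
  assumes "(\<Sum>i\<in>I. s (c i) (e i)) = x" "i \<in> I" shows "coord x i = c i"
proof -
  have "(\<Sum>i\<in>I. s (coord x i - c i) (e i)) = 0"
    using assms(1) coord_sum[of x] by (simp add: scale_left_diff_distrib sum_subtractf)
  then show ?thesis using frame_indep[of "\<lambda>i. coord x i - c i"] assms(2) by simp
qed

lemma coord_add: "i \<in> I \<Longrightarrow> coord (x + y) i = coord x i + coord y i"
  by (rule coord_unique) (simp_all add: scale_left_distrib sum.distrib coord_sum)

lemma coord_scale: "i \<in> I \<Longrightarrow> coord (s r x) i = r * coord x i"
proof (rule coord_unique)
  have "(\<Sum>i\<in>I. s (r * coord x i) (e i)) = s r (\<Sum>i\<in>I. s (coord x i) (e i))"
    by (simp add: scale_sum_right)
  then show "(\<Sum>i\<in>I. s (r * coord x i) (e i)) = s r x" by (simp add: coord_sum)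
qed

lemma coord_sum_family: "i \<in> I \<Longrightarrow> coord (\<Sum>a\<in>S. s (r a) (x a)) i = (\<Sum>a\<in>S. r a * coord (x a) i)"
proof (induction S rule: infinite_finite_induct)
  case empty
  then show ?case using coord_unique[of "\<lambda>_. 0" 0 i] by simp
next
  case (infinite S)
  then show ?case using coord_unique[of "\<lambda>_. 0" 0 i] by simp
qed (simp add: coord_add coord_scale)

lemma coord_e: "i \<in> I \<Longrightarrow> j \<in> I \<Longrightarrow> coord (e j) i = (if i = j then 1 else 0)"
proof (rule coord_unique)
  assume "j \<in> I"
  then show "(\<Sum>i\<in>I. s (if i = j then 1 else 0) (e i)) = e j"
    using finite_I by (simp add: if_distrib[of "\<lambda>c. s c _"] cong: if_cong)
qed

lemma X_divisible: "(\<exists>y. x = s fps_X y) \<longleftrightarrow> (\<forall>i\<in>I. fps_nth (coord x i) 0 = 0)"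
proof
  assume *: "\<forall>i\<in>I. fps_nth (coord x i) 0 = 0"
  have "x = (\<Sum>i\<in>I. s (coord x i) (e i))" by (simp add: coord_sum)
  also have "\<dots> = (\<Sum>i\<in>I. s (fps_X * fps_shift 1 (coord x i)) (e i))"
    using * fps_const_shift[of "coord x _"] by (intro sum.cong refl) (metis add_0 fps_const_0_eq_0)
  also have "\<dots> = s fps_X (\<Sum>i\<in>I. s (fps_shift 1 (coord x i)) (e i))"
    by (simp add: scale_sum_right)
  finally show "\<exists>y. x = s fps_X y" ..
qed (auto simp: coord_scale)

lemma X_cancel: "s fps_X x = 0 \<Longrightarrow> x = 0"
proof -
  assume "s fps_X x = 0"
  then have "(\<Sum>i\<in>I. s (fps_X * coord x i) (e i)) = 0"
    using scale_sum_right[of fps_X "\<lambda>i. s (coord x i) (e i)" I] by (simp add: coord_sum)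
  then have "fps_X * coord x i = 0" if "i \<in> I" for i
    using frame_indep[of "\<lambda>i. fps_X * coord x i"] that by simp
  then have "\<forall>i\<in>I. coord x i = 0" by simp
  then show "x = 0" using coord_sum[of x] by simp
qed

text \<open>In coordinates, a longer family gives more unknowns than equations over a
  domain.\<close>

lemma frame_card_le:
  assumes "frame s I' e'"
  shows "card I' \<le> card I"
proof (rule ccontr)
  assume "\<not> card I' \<le> card I"
  then obtain c where c: "\<exists>i\<in>I'. c i \<noteq> 0" "\<forall>j\<in>I. (\<Sum>i\<in>I'. c i * coord (e' i) j) = 0"
    using underdetermined_system[of I I' "\<lambda>i. coord (e' i)"] finite_I assms by (auto simp: frame_def)
  have "(\<Sum>i\<in>I'. s (c i) (e' i)) = (\<Sum>j\<in>I. s (coord (\<Sum>i\<in>I'. s (c i) (e' i)) j) (e j))"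
    by (simp add: coord_sum)
  also have "\<dots> = 0"
    using c(2) by (simp add: coord_sum_family)
  finally show False using assms c(1) by (auto simp: frame_def)
qed

text \<open>A basis modulo \<hbar> lifts. A relation has vanishing constant terms and can be divided
  by \<hbar>, as free modules have no torsion, and the argument repeats; generation comes from
  inverting a matrix that is the identity modulo \<hbar>.\<close>

lemma nakayama:
  assumes fin: "finite I'"
    and ind: "\<And>c. (\<exists>y. (\<Sum>i\<in>I'. s (fps_const (c i)) (e' i)) = s fps_X y) \<Longrightarrow> \<forall>i\<in>I'. c i = 0"
    and span: "\<And>g. g \<in> I \<Longrightarrow> \<exists>c y. e g = (\<Sum>i\<in>I'. s (c i) (e' i)) + s fps_X y"
  shows "frame s I' e'"
proof -
  have step: "(\<forall>i\<in>I'. fps_nth (c i) 0 = 0) \<and> (\<Sum>i\<in>I'. s (fps_shift 1 (c i)) (e' i)) = 0"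
    if c: "(\<Sum>i\<in>I'. s (c i) (e' i)) = 0" for c
  proof -
    let ?h = "\<Sum>i\<in>I'. s (fps_shift 1 (c i)) (e' i)"
    have "0 = (\<Sum>i\<in>I'. s (fps_const (fps_nth (c i) 0) + fps_X * fps_shift 1 (c i)) (e' i))"
      using c by (simp only: fps_const_shift[symmetric])
    also have "\<dots> = (\<Sum>i\<in>I'. s (fps_const (fps_nth (c i) 0)) (e' i)) + s fps_X ?h"
      by (simp add: scale_left_distrib sum.distrib scale_sum_right)
    finally have sum: "(\<Sum>i\<in>I'. s (fps_const (fps_nth (c i) 0)) (e' i)) + s fps_X ?h = 0" by simp
    then have "(\<Sum>i\<in>I'. s (fps_const (fps_nth (c i) 0)) (e' i)) = s fps_X (- ?h)"
      by (simp add: eq_neg_iff_add_eq_0)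
    then have 0: "\<forall>i\<in>I'. fps_nth (c i) 0 = 0" by (intro ind) blast
    then have "s fps_X ?h = 0" using sum by simp
    with 0 show ?thesis by (blast intro: X_cancel)
  qed
  have "\<forall>i\<in>I'. fps_nth (c i) n = 0" if "(\<Sum>i\<in>I'. s (c i) (e' i)) = 0" for c n
    using that
  proof (induction n arbitrary: c)
    case (Suc n c)
    then show ?case using Suc.IH[of "\<lambda>i. fps_shift 1 (c i)"] step[of c] by simp
  qed (use step in blast)
  then have "\<forall>i\<in>I'. c i = 0" if "(\<Sum>i\<in>I'. s (c i) (e' i)) = 0" for c
    using that by (auto simp: fps_eq_iff)
  moreover have "\<exists>c. x = (\<Sum>i\<in>I'. s (c i) (e' i))" for x
  proof -
    obtain c y where cy: "\<And>g. g \<in> I \<Longrightarrow> e g = (\<Sum>i\<in>I'. s (c g i) (e' i)) + s fps_X (y g)"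
      using span by metis
    \<comment> \<open>The error terms \<open>y\<close> are moved to the left: N = 1 - \<hbar>
      coord(y) sends the old frame into the span of the new family.\<close>
    define N where "N l g = (if l = g then 1 else 0) - fps_X * coord (y l) g" for l g
    have Ne: "(\<Sum>g\<in>I. s (N l g) (e g)) = (\<Sum>i\<in>I'. s (c l i) (e' i))" if l: "l \<in> I" for l
    proof -
      have "(\<Sum>g\<in>I. s (N l g) (e g)) = (\<Sum>g\<in>I. s (if l = g then 1 else 0) (e g)) - s fps_X (\<Sum>g\<in>I. s (coord (y l) g) (e g))"
        by (simp add: N_def scale_left_diff_distrib sum_subtractf scale_sum_right)
      also have "(\<Sum>g\<in>I. s (if l = g then 1 else 0) (e g)) = e l"
        using l finite_I by (simp add: if_distrib[of "\<lambda>c. s c _"] cong: if_cong)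
      finally show ?thesis using cy[OF l] by (simp add: coord_sum)
    qed
    have N0: "fps_nth (N l g) 0 = (if g = l then 1 else 0)" for g l
      by (simp add: N_def)
    obtain q where q: "\<And>g. g \<in> I \<Longrightarrow> (\<Sum>l\<in>I. N l g * q l) = coord x g"
      using unit_system[OF finite_I N0, of "coord x"] by blast
    have "x = (\<Sum>g\<in>I. s (\<Sum>l\<in>I. N l g * q l) (e g))"
      by (simp add: q coord_sum)
    also have "\<dots> = (\<Sum>g\<in>I. \<Sum>l\<in>I. s (q l) (s (N l g) (e g)))"
      by (simp add: scale_sum_left mult.commute)
    also have "\<dots> = (\<Sum>l\<in>I. \<Sum>g\<in>I. s (q l) (s (N l g) (e g)))"
      by (rule sum.swap)
    also have "\<dots> = (\<Sum>l\<in>I. s (q l) (\<Sum>g\<in>I. s (N l g) (e g)))"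
      by (simp add: scale_sum_right)
    also have "\<dots> = (\<Sum>l\<in>I. s (q l) (\<Sum>i\<in>I'. s (c l i) (e' i)))"
      by (simp add: Ne)
    also have "\<dots> = (\<Sum>l\<in>I. \<Sum>i\<in>I'. s (q l * c l i) (e' i))"
      by (simp add: scale_sum_right)
    also have "\<dots> = (\<Sum>i\<in>I'. \<Sum>l\<in>I. s (q l * c l i) (e' i))"
      by (rule sum.swap)
    also have "\<dots> = (\<Sum>i\<in>I'. s (\<Sum>l\<in>I. q l * c l i) (e' i))"
      by (simp add: scale_sum_left)
    finally show ?thesis by (rule exI[of _ "\<lambda>i. \<Sum>l\<in>I. q l * c l i"])
  qed
  ultimately show ?thesis using fin by (auto simp: frame_def)
qed

end

lemma frame_isomorphism:
  assumes "framed_module s I e" "framed_module s' I e'"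
  obtains f f' where "module_hom s' s f" "\<And>x. f (f' x) = x" "\<And>z. f' (f z) = z" "\<And>i. i \<in> I \<Longrightarrow> f (e' i) = e i"
proof -
  interpret A: framed_module s I e by fact
  interpret B: framed_module s' I e' by fact
  define f where "f z = (\<Sum>i\<in>I. s (B.coord z i) (e i))" for z
  define f' where "f' x = (\<Sum>i\<in>I. s' (A.coord x i) (e' i))" for x
  have "module_hom s' s f"
    by unfold_locales
      (simp_all add: f_def B.coord_add B.coord_scale A.scale_left_distrib sum.distrib A.scale_sum_right)
  moreover have "f (f' x) = x" for x
  proof -
    have "B.coord (f' x) i = A.coord x i" if "i \<in> I" for i
      using that unfolding f'_def by (rule B.coord_unique[OF refl])
    then show ?thesis by (simp add: f_def A.coord_sum)
  qed
  moreover have "f' (f z) = z" for z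
  proof -
    have "A.coord (f z) i = B.coord z i" if "i \<in> I" for i
      using that unfolding f_def by (rule A.coord_unique[OF refl])
    then show ?thesis by (simp add: f'_def B.coord_sum)
  qed
  moreover have "f (e' i) = e i" if "i \<in> I" for i
    using that A.finite_I by (simp add: f_def B.coord_e if_distrib[of "\<lambda>c. s c _"] cong: if_cong)
  ultimately show ?thesis using that by blast
qed

section \<open>Isomorphisms of straight realizations\<close>

lemma frame_reindex:
  assumes "bij_betw h I' I" "frame s I e"
  shows "frame s I' (\<lambda>i. e (h i))"
proof -
  have sum: "(\<Sum>i\<in>I'. s (c (h i)) (e (h i))) = (\<Sum>i\<in>I. s (c i) (e i))" for c
    by (rule sum.reindex_bij_betw[OF assms(1)])
  have "finite I'"
    using assms bij_betw_finite[OF assms(1)] by (simp add: frame_def)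
  moreover have "\<exists>c. x = (\<Sum>i\<in>I'. s (c i) (e (h i)))" for x
  proof -
    obtain c where "x = (\<Sum>i\<in>I. s (c i) (e i))" using assms(2) unfolding frame_def by blast
    then show ?thesis by (intro exI[of _ "\<lambda>i. c (h i)"]) (simp add: sum)
  qed
  moreover have "\<forall>i\<in>I'. c i = 0" if c: "(\<Sum>i\<in>I'. s (c i) (e (h i))) = 0" for c
  proof
    fix i assume i: "i \<in> I'"
    have inv: "the_inv_into I' h (h i) = i" if "i \<in> I'" for i
      using that assms(1) by (simp add: bij_betw_def the_inv_into_f_f)
    have "(\<Sum>i\<in>I. s (c (the_inv_into I' h i)) (e i)) = 0"
      unfolding sum[symmetric] using c by (simp add: inv cong: sum.cong_simp)
    then have "c (the_inv_into I' h (h i)) = 0"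
      using assms i unfolding frame_def by (metis bij_betw_apply)
    then show "c i = 0" by (simp add: inv i)
  qed
  ultimately show ?thesis by (simp add: frame_def)
qed

context quea_calculus
begin

lemma root_sum: "root R j (\<Sum>a\<in>S. scale R (r a) (x a)) = (\<Sum>a\<in>S. r a * root R j (x a))"
  by (induction S rule: infinite_finite_induct) (simp_all add: root_0 root_add root_scale)

text \<open>A combination of roots vanishing modulo \<hbar> on a frame is divisible by \<hbar>
  everywhere, and the quotient is again a linear form; straightness applies to it.\<close>

lemma straight_rows_independent:
  fixes t :: nat
  assumes str: "straight R" and fr: "frame (scale R) {..<t} H"
    and c: "\<And>g. g < t \<Longrightarrow> (\<Sum>i\<in>UNIV. c i * fps_nth (root R i (H g)) 0) = 0"
  shows "c i = 0"
proof -
  interpret H: framed_module "scale R" "{..<t}" H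
    by unfold_locales (rule fr)
  define \<gamma> where "\<gamma> x = (\<Sum>i\<in>UNIV. fps_const (c i) * root R i x)" for x
  have \<gamma>_H: "fps_nth (\<gamma> (H g)) 0 = 0" if "g < t" for g
    using c[OF that] by (simp add: \<gamma>_def fps_sum_nth)
  have \<gamma>_add: "\<gamma> (x + y) = \<gamma> x + \<gamma> y" for x y
    by (simp add: \<gamma>_def root_add distrib_left sum.distrib)
  have \<gamma>_scale: "\<gamma> (scale R r x) = r * \<gamma> x" for r x
    by (simp add: \<gamma>_def root_scale sum_distrib_left mult.left_commute)
  have "\<gamma> 0 = 0" using \<gamma>_scale[of 0 0] by simp
  then have "\<gamma> (\<Sum>g\<in>G. scale R (k g) (H g)) = (\<Sum>g\<in>G. k g * \<gamma> (H g))" for k G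
    by (induction G rule: infinite_finite_induct) (simp_all add: \<gamma>_add \<gamma>_scale)
  note \<gamma>_sum = this
  have "\<gamma> x = (\<Sum>g<t. H.coord x g * \<gamma> (H g))" for x
    using \<gamma>_sum[of "H.coord x" "{..<t}"] unfolding H.coord_sum .
  note \<gamma>_coord = this
  have \<gamma>_0: "fps_nth (\<gamma> x) 0 = 0" for x
    by (subst \<gamma>_coord) (simp add: fps_sum_nth \<gamma>_H)
  define \<beta> where "\<beta> x = fps_shift 1 (\<gamma> x)" for x
  have \<beta>: "\<gamma> x = fps_X * \<beta> x" for x
    using fps_const_shift[of "\<gamma> x"] by (simp add: \<beta>_def \<gamma>_0)
  have "module_hom (scale R) (*) \<beta>"
  proof unfold_locales
    show "\<beta> (x + y) = \<beta> x + \<beta> y" for x y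
      by (simp add: \<beta>_def \<gamma>_add fps_shift_add)
    show "\<beta> (scale R r x) = r * \<beta> x" for r x
    proof -
      have "fps_X * \<beta> (scale R r x) = fps_X * (r * \<beta> x)"
        using \<gamma>_scale[of r x] by (simp add: \<beta> mult.left_commute)
      then show ?thesis by simp
    qed
  qed (simp_all add: algebra_simps)
  then have "\<exists>\<beta>. module_hom (scale R) (*) \<beta> \<and> (\<forall>x. (\<Sum>i\<in>UNIV. fps_const (c i) * root R i x) = fps_X * \<beta> x)"
    using \<beta> unfolding \<gamma>_def by blast
  then show ?thesis using str unfolding straight_def by blast
qed

text \<open>Straightness gives the matrix of root values modulo \<hbar> full rank, so dual vectors
  exist over the field. Lifted, their pairing is the identity modulo \<hbar>, and
  \<open>unit_system\<close> corrects it.\<close>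

lemma dual_vectors:
  fixes t :: nat
  assumes str: "straight R" and fr: "frame (scale R) {..<t} H"
  obtains b where "\<And>i j. root R i (b j) = (if i = j then 1 else 0)"
proof -
  define a where "a g i = fps_nth (root R i (H g)) 0" for g i
  have "\<exists>G\<subseteq>{..<t}. (\<forall>x. (\<forall>i. (\<Sum>g\<in>G. x g * a g i) = 0) \<longrightarrow> (\<forall>g\<in>G. x g = 0)) \<and>
      (\<forall>g\<in>{..<t}. \<exists>x. \<forall>i. a g i = (\<Sum>g\<in>G. x g * a g i))"
    using relative_basis[OF finite_lessThan, where J = UNIV and I = "{} :: nat set" and a = "\<lambda>_ _. 0" and e = a]
    by simp
  then obtain G where G: "G \<subseteq> {..<t}"
    and ind': "\<forall>x. (\<forall>i. (\<Sum>g\<in>G. x g * a g i) = 0) \<longrightarrow> (\<forall>g\<in>G. x g = 0)"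
    and span': "\<forall>g\<in>{..<t}. \<exists>x. \<forall>i. a g i = (\<Sum>g\<in>G. x g * a g i)"
    by (elim exE conjE)
  have span: "\<exists>x. \<forall>i. a g i = (\<Sum>g\<in>G. x g * a g i)" if "g < t" for g
    using span' that by (simp only: lessThan_iff)
  have finG: "finite G" using G finite_subset by blast
  \<comment> \<open>Otherwise a nontrivial combination of the roots would vanish modulo \<hbar> on
    the rows in \<open>G\<close>, and therefore on the whole frame.\<close>
  have "CARD('n) \<le> card G"
  proof (rule ccontr)
    assume "\<not> CARD('n) \<le> card G"
    then obtain c where c: "\<exists>i. c i \<noteq> 0" "\<forall>g\<in>G. (\<Sum>i\<in>UNIV. c i * a g i) = 0"
      using underdetermined_system[of G "UNIV :: 'n set" "\<lambda>i g. a g i"] finG by auto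
    have "(\<Sum>i\<in>UNIV. c i * a g i) = 0" if g: "g < t" for g
    proof -
      obtain x where "\<forall>i. a g i = (\<Sum>g\<in>G. x g * a g i)" using span[OF g] by blast
      then have "(\<Sum>i\<in>UNIV. c i * a g i) = (\<Sum>i\<in>UNIV. \<Sum>g\<in>G. x g * (c i * a g i))"
        by (simp add: sum_distrib_left mult.left_commute)
      also have "\<dots> = (\<Sum>g\<in>G. \<Sum>i\<in>UNIV. x g * (c i * a g i))" by (rule sum.swap)
      also have "\<dots> = 0" using c(2) by (simp flip: sum_distrib_left)
      finally show ?thesis .
    qed
    then have "c i = 0" for i
      using straight_rows_independent[OF str fr, of c] unfolding a_def by simp
    then show False using c(1) by simp
  qed
  \<comment> \<open>The index \<open>t\<close>, outside \<open>G\<close>, labels one more row, the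
    unit vector to be represented. There are then more rows than columns, and a relation must
    involve the new row.\<close>
  then have card: "CARD('n) < card (insert t G)"
    using G finG by (subst card_insert_disjoint) auto
  have "\<exists>x. \<forall>i. (\<Sum>g\<in>G. x g * a g i) = (if i = j then 1 else 0)" for j
  proof -
    let ?D = "\<lambda>g i. if g = t then (if i = j then 1 else 0) else a g i"
    have tG: "t \<notin> G" using G by auto
    obtain c where c: "\<exists>g\<in>insert t G. c g \<noteq> 0" "\<And>i. (\<Sum>g\<in>insert t G. c g * ?D g i) = 0"
      using underdetermined_system[of "UNIV :: 'n set" "insert t G" ?D] card finG by auto
    have "(\<Sum>g\<in>G. c g * ?D g i) = (\<Sum>g\<in>G. c g * a g i)" for i
      using tG by (intro sum.cong) auto
    then have rel: "(\<Sum>g\<in>G. c g * a g i) = - (c t * (if i = j then 1 else 0))" for i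
      using c(2)[of i] tG finG by (simp add: eq_neg_iff_add_eq_0 add.commute)
    have ct: "c t \<noteq> 0"
    proof
      assume "c t = 0"
      then have "\<forall>i. (\<Sum>g\<in>G. c g * a g i) = 0" unfolding rel by simp
      then have "\<forall>g\<in>G. c g = 0" by (rule ind'[THEN spec, THEN mp])
      then show False using c(1) \<open>c t = 0\<close> by auto
    qed
    have "(\<Sum>g\<in>G. (- c g / c t) * a g i) = (if i = j then 1 else 0)" for i
    proof -
      have "(\<Sum>g\<in>G. (- c g / c t) * a g i) = - (\<Sum>g\<in>G. c g * a g i) / c t"
        by (simp add: sum_negf sum_divide_distrib)
      then show ?thesis using rel[of i] ct by simp
    qed
    then show ?thesis by (intro exI[of _ "\<lambda>g. - c g / c t"] allI)
  qed
  then have "\<exists>x. \<forall>j i. (\<Sum>g\<in>G. x j g * a g i) = (if i = j then 1 else 0)"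
    by (rule choice[OF allI])
  then obtain x where x: "\<And>i j. (\<Sum>g\<in>G. x j g * a g i) = (if i = j then 1 else 0)"
    by blast
  define b0 where "b0 j = (\<Sum>g\<in>G. scale R (fps_const (x j g)) (H g))" for j
  have N0: "fps_nth (root R i (b0 j)) 0 = (if i = j then 1 else 0)" for i j
    using x[of j i] by (simp add: b0_def root_sum fps_sum_nth a_def)
  have "\<exists>q. \<forall>i\<in>UNIV. (\<Sum>l\<in>UNIV. root R i (b0 l) * q l) = (if i = j then 1 else 0)" for j
    by (rule unit_system) (simp_all add: N0)
  then have "\<exists>q. \<forall>j. \<forall>i\<in>UNIV. (\<Sum>l\<in>UNIV. root R i (b0 l) * q j l) = (if i = j then 1 else 0)"
    by (rule choice[OF allI])
  then obtain q where q: "\<And>i j. (\<Sum>l\<in>UNIV. root R i (b0 l) * q j l) = (if i = j then 1 else 0)"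
    by blast
  show ?thesis
  proof (rule that)
    show "root R i (\<Sum>l\<in>UNIV. scale R (q j l) (b0 l)) = (if i = j then 1 else 0)" for i j
      using q[of i j] by (simp add: root_sum mult.commute)
  qed
qed

lemma S_independent:
  "(\<exists>y. (\<Sum>i\<in>UNIV. scale R (fps_const (c i)) (S_elem R i)) = scale R fps_X y) \<Longrightarrow> c i = 0"
  using real unfolding is_realization_def by blast

text \<open>
  As in Kac's uniqueness proof for realizations, the \<open>S i\<close> are completed first by dual vectors \<open>b c\<close>,
  with \<open>C\<close> spanning a complement of the image of the pairing matrix \<open>m\<close>, and then by vectors \<open>w g\<close>
  annihilated by all roots. The values of the roots on such a frame depend on \<open>m\<close> and \<open>C\<close> only.
\<close>

lemma adapted_frame:
  fixes t :: nat
  assumes str: "straight R" and fr: "frame (scale R) {..<t} H"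
    and m: "\<And>i j. root R j (S_elem R i) = fps_const (m i j)"
    and C: "\<forall>s x. (\<forall>j. (\<Sum>i\<in>UNIV. s i * m i j) + (\<Sum>c\<in>C. x c * (if c = j then 1 else 0)) = 0) \<longrightarrow> (\<forall>c\<in>C. x c = 0)"
      "\<forall>c. \<exists>s x. \<forall>j. (if c = j then 1 else 0) = (\<Sum>i\<in>UNIV. s i * m i j) + (\<Sum>c\<in>C. x c * (if c = j then 1 else 0))"
  shows "\<exists>b w G. G \<subseteq> {..<t} \<and>
    frame (scale R) ((UNIV <+> C) <+> G) (case_sum (case_sum (S_elem R) b) w) \<and>
    (\<forall>i j. root R i (b j) = (if j = i then 1 else 0)) \<and> (\<forall>i g. root R i (w g) = 0)"
proof -
  interpret H: framed_module "scale R" "{..<t}" H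
    by unfold_locales (rule fr)
  obtain b where b': "\<And>i j. root R i (b j) = (if i = j then 1 else 0)"
    by (rule dual_vectors[OF str fr], blast)
  have b: "root R i (b j) = (if j = i then 1 else 0)" for i j
    using b'[of i j] by auto
  have finC: "finite C" by simp
  have "\<exists>s. \<forall>l. \<exists>x. \<forall>j. (if l = j then 1 else 0) = (\<Sum>i\<in>UNIV. s l i * m i j) + (\<Sum>c\<in>C. x c * (if c = j then 1 else 0))"
    by (rule choice[OF C(2)])
  then obtain s where "\<forall>l. \<exists>x. \<forall>j. (if l = j then 1 else 0) = (\<Sum>i\<in>UNIV. s l i * m i j) + (\<Sum>c\<in>C. x c * (if c = j then 1 else 0))" ..
  from choice[OF this] obtain x where
    sx: "\<And>l j. (if l = j then 1 else 0) = (\<Sum>i\<in>UNIV. s l i * m i j) + (\<Sum>c\<in>C. x l c * (if c = j then 1 else 0))"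
    by blast
  \<comment> \<open>\<open>C(2)\<close> writes a unit vector through the rows of \<open>m\<close>
    and the unit vectors in \<open>C\<close>; the same combination of the S_i and b_c is dual to the
    roots.\<close>
  define p where "p l = (\<Sum>i\<in>UNIV. scale R (fps_const (s l i)) (S_elem R i)) + (\<Sum>c\<in>C. scale R (fps_const (x l c)) (b c))" for l
  have root_p: "root R j (p l) = (if l = j then 1 else 0)" for j l
  proof -
    have "root R j (p l) = (\<Sum>i\<in>UNIV. fps_const (s l i) * fps_const (m i j)) +
        (\<Sum>c\<in>C. fps_const (x l c) * (if c = j then 1 else 0))"
      by (simp add: p_def root_add root_sum m b)
    also have "\<dots> = fps_const ((\<Sum>i\<in>UNIV. s l i * m i j) + (\<Sum>c\<in>C. x l c * (if c = j then 1 else 0)))"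
      by (simp only: fps_const_add[symmetric] fps_const_sum)
        (intro arg_cong2[where f = "(+)"] sum.cong refl; simp)
    finally show ?thesis unfolding sx[symmetric] by simp
  qed
  define w where "w g = H g - (\<Sum>l\<in>UNIV. scale R (root R l (H g)) (p l))" for g
  have root_w: "root R i (w g) = 0" for i g
  proof -
    have "root R i (w g) = root R i (H g) - root R i (\<Sum>l\<in>UNIV. scale R (root R l (H g)) (p l))"
      using root_add[of i "H g" "- (\<Sum>l\<in>UNIV. scale R (root R l (H g)) (p l))"]
      by (simp add: w_def root_minus)
    also have "root R i (\<Sum>l\<in>UNIV. scale R (root R l (H g)) (p l)) = root R i (H g)"
      by (simp add: root_sum root_p if_distrib[of "\<lambda>x. _ * x"] cong: if_cong)
    finally show ?thesis by simp
  qed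
  let ?base = "case_sum (S_elem R) b" and ?K = "(UNIV :: 'n set) <+> C"
  define r where "r x g = fps_nth (H.coord x g) 0" for x g
  have "\<exists>G\<subseteq>{..<t}. (\<forall>s x. (\<forall>g\<in>{..<t}. (\<Sum>i\<in>?K. s i * r (?base i) g) + (\<Sum>c\<in>G. x c * r (w c) g) = 0) \<longrightarrow> (\<forall>c\<in>G. x c = 0)) \<and>
      (\<forall>c\<in>{..<t}. \<exists>s x. \<forall>g\<in>{..<t}. r (w c) g = (\<Sum>i\<in>?K. s i * r (?base i) g) + (\<Sum>c\<in>G. x c * r (w c) g))"
    by (rule relative_basis) simp
  then obtain G where G: "G \<subseteq> {..<t}"
    and ind: "\<forall>s x. (\<forall>g\<in>{..<t}. (\<Sum>i\<in>?K. s i * r (?base i) g) + (\<Sum>c\<in>G. x c * r (w c) g) = 0) \<longrightarrow> (\<forall>c\<in>G. x c = 0)"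
    and span: "\<forall>c\<in>{..<t}. \<exists>s x. \<forall>g\<in>{..<t}. r (w c) g = (\<Sum>i\<in>?K. s i * r (?base i) g) + (\<Sum>c\<in>G. x c * r (w c) g)"
    by (elim exE conjE)
  have finG: "finite G" using G finite_subset by blast
  have finK: "finite ?K" by simp
  let ?e = "case_sum ?base w" and ?I = "?K <+> G"
  have sum_I: "(\<Sum>i\<in>?I. scale R (c i) (?e i)) =
      (\<Sum>i\<in>?K. scale R (c (Inl i)) (?base i)) + (\<Sum>g\<in>G. scale R (c (Inr g)) (w g))" for c
    by (simp add: sum.Plus finK finG comp_def)
  have sum_I0: "(\<Sum>i\<in>?K. scale R (c i) (?base i)) =
      (\<Sum>i\<in>UNIV. scale R (c (Inl i)) (S_elem R i)) + (\<Sum>j\<in>C. scale R (c (Inr j)) (b j))" for c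
    by (simp add: sum.Plus comp_def)
  have r_sum0: "r (\<Sum>i\<in>S. scale R (fps_const (c i)) (z i)) g = (\<Sum>i\<in>S. c i * r (z i) g)"
    if "g < t" for S :: "('n + 'n) set" and c z g
    using that by (simp add: r_def H.coord_sum_family fps_sum_nth)
  have r_sumG: "r (\<Sum>i\<in>S. scale R (fps_const (c i)) (z i)) g = (\<Sum>i\<in>S. c i * r (z i) g)"
    if "g < t" for S :: "nat set" and c z g
    using that by (simp add: r_def H.coord_sum_family fps_sum_nth)
  note r_sum = r_sum0 r_sumG
  have r_add: "r (y + z) g = r y g + r z g" if "g < t" for y z g
    using that by (simp add: r_def H.coord_add)
  have "frame (scale R) ?I ?e"
  proof (rule H.nakayama)
    show "finite ?I" using finK finG by simp
  next
    fix c assume "\<exists>y. (\<Sum>i\<in>?I. scale R (fps_const (c i)) (?e i)) = scale R fps_X y"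
    then obtain y where y: "(\<Sum>i\<in>?I. scale R (fps_const (c i)) (?e i)) = scale R fps_X y" ..
    \<comment> \<open>Independence modulo \<hbar> is peeled off in three layers: coordinates kill
      the coefficients of the \<open>w\<close>, root values those of the \<open>b\<close>, and the
      realization axiom those of the S_i.\<close>
    have "(\<Sum>i\<in>?K. c (Inl i) * r (?base i) g) + (\<Sum>h\<in>G. c (Inr h) * r (w h) g) = 0" if g: "g < t" for g
    proof -
      have "(\<Sum>i\<in>?K. c (Inl i) * r (?base i) g) + (\<Sum>h\<in>G. c (Inr h) * r (w h) g) = r (scale R fps_X y) g"
        unfolding y[symmetric] sum_I r_add[OF g] by (simp only: r_sum[OF g])
      also have "\<dots> = 0" using g by (simp add: r_def H.coord_scale)
      finally show ?thesis .
    qed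
    then have cG: "\<forall>g\<in>G. c (Inr g) = 0"
      using ind[THEN spec, THEN spec, of "\<lambda>i. c (Inl i)" "\<lambda>g. c (Inr g)"] by simp
    then have y0: "(\<Sum>i\<in>UNIV. scale R (fps_const (c (Inl (Inl i)))) (S_elem R i)) +
        (\<Sum>j\<in>C. scale R (fps_const (c (Inl (Inr j)))) (b j)) = scale R fps_X y"
      using y unfolding sum_I sum_I0 by simp
    have "(\<Sum>i\<in>UNIV. c (Inl (Inl i)) * m i j) + (\<Sum>l\<in>C. c (Inl (Inr l)) * (if l = j then 1 else 0)) = 0" for j
    proof -
      have "fps_nth (root R j (scale R fps_X y)) 0 = 0" by (simp add: root_scale)
      moreover have "fps_nth (if l = j then 1 else (0 :: 'k fps)) 0 = (if l = j then 1 else 0)" for l by simp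
      ultimately show ?thesis
        unfolding y0[symmetric] root_add root_sum by (simp add: fps_sum_nth m b)
    qed
    then have cC: "\<forall>j\<in>C. c (Inl (Inr j)) = 0"
      using C(1)[THEN spec, THEN spec, of "\<lambda>i. c (Inl (Inl i))" "\<lambda>j. c (Inl (Inr j))"] by blast
    then have "(\<Sum>i\<in>UNIV. scale R (fps_const (c (Inl (Inl i)))) (S_elem R i)) = scale R fps_X y"
      using y0 by simp
    then have "c (Inl (Inl i)) = 0" for i
      using S_independent[of "\<lambda>i. c (Inl (Inl i))"] by blast
    then show "\<forall>i\<in>?I. c i = 0" using cG cC by auto
  next
    fix g assume "g \<in> {..<t}"
    then have g: "g < t" by simp
    obtain s' x' where sx': "\<forall>h\<in>{..<t}. r (w g) h = (\<Sum>i\<in>?K. s' i * r (?base i) h) + (\<Sum>c\<in>G. x' c * r (w c) h)"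
      using span[THEN bspec, OF \<open>g \<in> {..<t}\<close>] by (elim exE)
    let ?v = "(\<Sum>i\<in>?K. scale R (fps_const (s' i)) (?base i)) + (\<Sum>h\<in>G. scale R (fps_const (x' h)) (w h))"
    have "r (w g - ?v) h = 0" if h: "h < t" for h
    proof -
      have "r (w g) h = r (w g - ?v) h + r ?v h"
        using r_add[OF h, of "w g - ?v" ?v] by simp
      moreover have "r ?v h = r (w g) h"
        using sx' h unfolding r_add[OF h] r_sum[OF h] by simp
      ultimately show ?thesis by simp
    qed
    then obtain y where y: "w g - ?v = scale R fps_X y"
      using H.X_divisible[of "w g - ?v"] by (auto simp: r_def)
    define k where "k i = root R i (H g)" for i
    have "(\<Sum>l\<in>UNIV. scale R (k l) (p l)) =
        (\<Sum>l\<in>UNIV. \<Sum>i\<in>UNIV. scale R (k l * fps_const (s l i)) (S_elem R i)) +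
        (\<Sum>l\<in>UNIV. \<Sum>c\<in>C. scale R (k l * fps_const (x l c)) (b c))"
      by (simp add: p_def h.scale_right_distrib h.scale_sum_right sum.distrib)
    also have "\<dots> = (\<Sum>i\<in>UNIV. \<Sum>l\<in>UNIV. scale R (k l * fps_const (s l i)) (S_elem R i)) +
        (\<Sum>c\<in>C. \<Sum>l\<in>UNIV. scale R (k l * fps_const (x l c)) (b c))"
      by (intro arg_cong2[where f = "(+)"] sum.swap)
    also have "\<dots> = (\<Sum>i\<in>UNIV. scale R (\<Sum>l\<in>UNIV. k l * fps_const (s l i)) (S_elem R i)) +
        (\<Sum>c\<in>C. scale R (\<Sum>l\<in>UNIV. k l * fps_const (x l c)) (b c))"
      by (simp add: h.scale_sum_left)
    also have "\<dots> = (\<Sum>i\<in>?K. scale R (case_sum (\<lambda>i. \<Sum>l\<in>UNIV. k l * fps_const (s l i))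
          (\<lambda>c. \<Sum>l\<in>UNIV. k l * fps_const (x l c)) i) (?base i))"
      unfolding sum_I0 by simp
    finally have kp: "(\<Sum>l\<in>UNIV. scale R (k l) (p l)) = (\<Sum>i\<in>?K. scale R (case_sum (\<lambda>i. \<Sum>l\<in>UNIV. k l * fps_const (s l i))
          (\<lambda>c. \<Sum>l\<in>UNIV. k l * fps_const (x l c)) i) (?base i))" (is "_ = (\<Sum>i\<in>?K. scale R (?k i) (?base i))") .
    have "H g = w g + (\<Sum>l\<in>UNIV. scale R (k l) (p l))"
      by (simp add: w_def k_def)
    also have "w g = ?v + scale R fps_X y"
      using y by (simp add: algebra_simps)
    also have "?v + scale R fps_X y + (\<Sum>l\<in>UNIV. scale R (k l) (p l)) =
        (\<Sum>i\<in>?I. scale R (case_sum (\<lambda>i. fps_const (s' i) + ?k i) (\<lambda>h. fps_const (x' h)) i) (?e i)) + scale R fps_X y"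
      unfolding sum_I kp by (simp add: h.scale_left_distrib sum.distrib)
    finally show "\<exists>c y. H g = (\<Sum>i\<in>?I. scale R (c i) (?e i)) + scale R fps_X y"
      by blast
  qed
  then show ?thesis
    using G b root_w by (intro exI[of _ b] exI[of _ w] exI[of _ G]) simp
qed

end

lemma frame_card_eq:
  assumes "Modules.module s" "frame s I e" "frame s I' e'"
  shows "card I = card I'"
proof -
  interpret A: framed_module s I e by (intro framed_module.intro framed_module_axioms.intro assms)
  interpret B: framed_module s I' e' by (intro framed_module.intro framed_module_axioms.intro assms)
  show ?thesis using A.frame_card_le[OF assms(3)] B.frame_card_le[OF assms(2)] by simp
qed

text \<open>Both realizations receive adapted frames for the same \<open>m\<close> and
  \<open>C\<close>. Equal rank makes the two families of vectors killed by the roots equally large,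
  so the frames match index by index, with equal root values.\<close>

lemma realization_isomorphism:
  fixes R :: "('n::finite, 'k::field_char_0, 'h::ab_group_add) realization"
    and R' :: "('n, 'k, 'h'::ab_group_add) realization" and t :: nat
  assumes R: "is_realization P R" "straight R" "frame (scale R) {..<t} H"
    and R': "is_realization P' R'" "straight R'" "frame (scale R') {..<t} H'"
    and m: "\<And>i j. root R j (S_elem R i) = fps_const (m i j)" "\<And>i j. root R' j (S_elem R' i) = fps_const (m i j)"
  obtains f f' where "module_hom (scale R') (scale R) f" "\<And>x. f (f' x) = x" "\<And>z. f' (f z) = z"
    "\<And>i. f (S_elem R' i) = S_elem R i" "\<And>j x. root R j (f x) = root R' j x"
proof -
  interpret R: quea_calculus A d P R for A d by standard (rule R(1))
  interpret R': quea_calculus A d P' R' for A d by standard (rule R'(1))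
  let ?\<delta> = "\<lambda>c j. if c = j then 1 else 0 :: 'k"
  have "\<exists>C\<subseteq>UNIV. (\<forall>s x. (\<forall>j\<in>UNIV. (\<Sum>i\<in>UNIV. s i * m i j) + (\<Sum>c\<in>C. x c * ?\<delta> c j) = 0) \<longrightarrow> (\<forall>c\<in>C. x c = 0)) \<and>
      (\<forall>c\<in>UNIV. \<exists>s x. \<forall>j\<in>UNIV. ?\<delta> c j = (\<Sum>i\<in>UNIV. s i * m i j) + (\<Sum>c\<in>C. x c * ?\<delta> c j))"
    by (rule relative_basis) simp
  then obtain C where C1: "\<forall>s x. (\<forall>j\<in>UNIV. (\<Sum>i\<in>UNIV. s i * m i j) + (\<Sum>c\<in>C. x c * ?\<delta> c j) = 0) \<longrightarrow> (\<forall>c\<in>C. x c = 0)"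
    and C2: "\<forall>c\<in>UNIV. \<exists>s x. \<forall>j\<in>UNIV. ?\<delta> c j = (\<Sum>i\<in>UNIV. s i * m i j) + (\<Sum>c\<in>C. x c * ?\<delta> c j)"
    by (elim exE conjE)
  note C = C1[unfolded ball_UNIV] C2[unfolded ball_UNIV]
  obtain b w G where G: "G \<subseteq> {..<t}"
    and fr: "frame (scale R) (((UNIV :: 'n set) <+> C) <+> G) (case_sum (case_sum (S_elem R) b) w)"
    and b: "\<forall>i j. root R i (b j) = (if j = i then 1 else 0)" and w: "\<forall>i g. root R i (w g) = 0"
    using R.adapted_frame[OF R(2,3) m(1) C] by (elim exE conjE)
  obtain b' w' G' where G': "G' \<subseteq> {..<t}"
    and fr': "frame (scale R') (((UNIV :: 'n set) <+> C) <+> G') (case_sum (case_sum (S_elem R') b') w')"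
    and b': "\<forall>i j. root R' i (b' j) = (if j = i then 1 else 0)" and w': "\<forall>i g. root R' i (w' g) = 0"
    using R'.adapted_frame[OF R'(2,3) m(2) C] by (elim exE conjE)
  have fin: "finite G" "finite G'" "finite ((UNIV :: 'n set) <+> C)"
    using G G' finite_subset[OF _ finite_lessThan] by simp_all
  have "card (((UNIV :: 'n set) <+> C) <+> G) = card (((UNIV :: 'n set) <+> C) <+> G')"
    using frame_card_eq[OF R.module_R R(3) fr] frame_card_eq[OF R'.module_R R'(3) fr'] by simp
  then have "card G = card G'" using fin by (simp add: card_Plus)
  then obtain \<pi> where \<pi>: "bij_betw \<pi> G' G"
    using fin finite_same_card_bij[of G' G] by auto
  have bij: "bij_betw (map_sum id \<pi>) (((UNIV :: 'n set) <+> C) <+> G') (((UNIV :: 'n set) <+> C) <+> G)"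
  proof (rule bij_betw_imageI)
    show "inj_on (map_sum id \<pi>) (((UNIV :: 'n set) <+> C) <+> G')"
      using bij_betw_imp_inj_on[OF \<pi>] by (intro inj_onI) (elim PlusE; simp add: inj_on_eq_iff)
    show "map_sum id \<pi> ` (((UNIV :: 'n set) <+> C) <+> G') = ((UNIV <+> C) <+> G)"
      by (simp add: Plus_def[of "_ <+> _"] image_Un image_image bij_betw_imp_surj_on[OF \<pi>, symmetric])
  qed
  define e where "e i = case_sum (case_sum (S_elem R) b) w (map_sum id \<pi> i)" for i
  let ?e' = "case_sum (case_sum (S_elem R') b') w'" and ?I = "((UNIV :: 'n set) <+> C) <+> G'"
  have "frame (scale R) ?I e"
    unfolding e_def by (rule frame_reindex[OF bij fr])
  then have A: "framed_module (scale R) ?I e"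
    by (intro framed_module.intro framed_module_axioms.intro R.module_R)
  have B: "framed_module (scale R') ?I ?e'"
    by (intro framed_module.intro framed_module_axioms.intro R'.module_R fr')
  interpret A: framed_module "scale R" ?I e by (rule A)
  interpret B: framed_module "scale R'" ?I ?e' by (rule B)
  obtain f f' where f: "module_hom (scale R') (scale R) f" "\<And>x. f (f' x) = x" "\<And>z. f' (f z) = z"
    and fe: "\<And>i. i \<in> ?I \<Longrightarrow> f (?e' i) = e i"
    by (rule frame_isomorphism[OF A B], blast)
  interpret f: module_hom "scale R'" "scale R" f by (rule f(1))
  have root_e: "root R j (e i) = root R' j (?e' i)" for i j
    by (cases i; (rename_tac a; case_tac a)?) (auto simp: e_def m b b' w w')
  have root_f: "root R j (f x) = root R' j x" for j x
  proof -
    have "f x = (\<Sum>i\<in>?I. scale R (B.coord x i) (f (?e' i)))"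
      by (subst B.coord_sum[of x, symmetric]) (simp only: f.sum f.scale)
    also have "\<dots> = (\<Sum>i\<in>?I. scale R (B.coord x i) (e i))"
      by (intro sum.cong refl) (simp only: fe)
    finally have "root R j (f x) = (\<Sum>i\<in>?I. B.coord x i * root R j (e i))"
      by (simp only: R.root_sum)
    also have "\<dots> = root R' j (\<Sum>i\<in>?I. scale R' (B.coord x i) (?e' i))"
      by (simp only: R'.root_sum root_e)
    finally show ?thesis by (simp only: B.coord_sum)
  qed
  have "f (S_elem R' i) = S_elem R i" for i
    using fe[OF InlI[OF InlI[OF UNIV_I[of i]]]] by (simp add: e_def)
  then show ?thesis by (rule that[OF f _ root_f])
qed

section \<open>Twists between realizations\<close>

lemma cartan_type_sum: "cartan_type A d P \<Longrightarrow> P $ i $ j + P $ j $ i = 2 * DA_matrix A d $ i $ j"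
  by (simp add: cartan_type_def vec_eq_iff transpose_def)

lemma DA_matrix_symmetric:
  assumes "cartan_type A d (P :: 'k::field_char_0 fps ^ 'n::finite ^ 'n)"
  shows "DA_matrix A d $ j $ i = (DA_matrix A d $ i $ j :: 'k fps)"
proof -
  have "2 * DA_matrix A d $ j $ i = (2 * DA_matrix A d $ i $ j :: 'k fps)"
    using cartan_type_sum[OF assms, of i j] cartan_type_sum[OF assms, of j i] by (simp add: add.commute)
  then show ?thesis by simp
qed

lemma cartan_type_DA:
  "cartan_type A d (P :: 'k::field_char_0 fps ^ 'n::finite ^ 'n) \<Longrightarrow>
    cartan_type A d (DA_matrix A d :: 'k fps ^ 'n ^ 'n)"
  using DA_matrix_symmetric by (auto simp: cartan_type_def vec_eq_iff transpose_def)

lemma DA_matrix_const: "DA_matrix A d $ i $ j = fps_const (of_int (int (d i) * A $ i $ j))"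
  by (simp only: DA_matrix_def vec_lambda_beta fps_of_int)

lemma half_double: "fps_const (1 / 2 :: 'k::field_char_0) * 2 = 1"
  by (simp flip: numeral_fps_const)

lemma (in quea_calculus) half_sum: "scale R (fps_const (1 / 2)) x + scale R (fps_const (1 / 2)) x = x"
  by (simp flip: h.scale_left_distrib)

lemma (in quea_calculus) S_double: "scale R 2 (S_elem R i) = Tplus R i + Tminus R i"
proof -
  have "2 * fps_const (1 / 2 :: 'k) = 1" using half_double by (simp add: mult.commute)
  then show ?thesis by (simp only: S_elem_def h.scale_scale h.scale_one)
qed

text \<open>Averaging T_i^+ and T_i^- leaves only the symmetric part of P, which is constant in
  \<hbar> and common to all realizations of the same Cartan type.\<close>

lemma (in quea_calculus) root_S:
  assumes "cartan_type A' d' P"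
  shows "root R j (S_elem R i) = fps_const (of_int (int (d' i) * A' $ i $ j))"
proof -
  have "root R j (S_elem R i) = fps_const (1 / 2) * (2 * DA_matrix A' d' $ i $ j)"
    using cartan_type_sum[OF assms, of i j]
    by (simp add: S_elem_def root_scale root_add root_Tplus root_Tminus)
  also have "\<dots> = DA_matrix A' d' $ i $ j"
    by (simp only: mult.assoc[symmetric] half_double mult_1_left)
  finally show ?thesis by (simp only: DA_matrix_const)
qed

lemma (in quea_calculus) exists_twist_matrix:
  assumes str: "straight R" and H: "is_basis (scale R) t H"
    and Z: "\<And>i j. root R j (Z i) = - root R i (Z j)"
  obtains \<Phi> where "\<Phi> \<in> antisymmetric t"
    "\<And>i. (\<Sum>g<t. \<Sum>k<t. scale R (fps_const (1 / 2) * \<Phi> g k * root R i (H g)) (H k)) = - Z i"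
proof -
  have fr: "frame (scale R) {..<t} H" by (rule is_basis_frame[OF module_R H])
  interpret H: framed_module "scale R" "{..<t}" H
    by unfold_locales (rule fr)
  obtain b where b: "\<And>i j. root R i (b j) = (if i = j then 1 else 0)"
    by (rule dual_vectors[OF str fr], blast)
  \<comment> \<open>The bivector \<open>\<Sum>\<^sub>i Z\<^sub>i \<and> b\<^sub>i - \<Sum>\<^sub>i\<^sub>j \<alpha>\<^sub>i(Z\<^sub>j) b\<^sub>i \<otimes> b\<^sub>j\<close> contracts with \<open>\<alpha>\<^sub>l\<close> to \<open>- Z\<^sub>l\<close>.\<close>
  define c where "c = H.coord"
  define \<psi> where "\<psi> g k = (\<Sum>i\<in>UNIV. c (Z i) g * c (b i) k - c (b i) g * c (Z i) k)
    - (\<Sum>i\<in>UNIV. \<Sum>j\<in>UNIV. root R i (Z j) * (c (b i) g * c (b j) k))" for g k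
  have "\<psi> k g = - \<psi> g k" for g k
  proof -
    have "(\<Sum>i\<in>UNIV. \<Sum>j\<in>UNIV. root R i (Z j) * (c (b i) k * c (b j) g)) =
        (\<Sum>j\<in>UNIV. \<Sum>i\<in>UNIV. root R i (Z j) * (c (b i) k * c (b j) g))" by (rule sum.swap)
    also have "\<dots> = (\<Sum>j\<in>UNIV. \<Sum>i\<in>UNIV. - (root R j (Z i) * (c (b j) g * c (b i) k)))"
      by (intro sum.cong refl) (subst Z, simp)
    finally show ?thesis
      by (simp add: \<psi>_def sum_negf sum_subtractf algebra_simps)
  qed
  note \<psi> = this
  \<comment> \<open>The factor 2 compensates the 1/2 in the exponent of the twist.\<close>
  have "2 * \<psi> g k = - (2 * \<psi> k g)" for g k
    by (subst \<psi>) simp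
  then have "(\<lambda>g k. 2 * \<psi> g k) \<in> antisymmetric t"
    unfolding antisymmetric_def mem_Collect_eq by (intro allI impI)
  moreover have "(\<Sum>g<t. \<Sum>k<t. scale R (fps_const (1 / 2) * (2 * \<psi> g k) * root R l (H g)) (H k)) = - Z l" for l
  proof -
    have half: "fps_const (1 / 2) * (2 * \<psi> g k) = \<psi> g k" for g k
      by (simp only: mult.assoc[symmetric] half_double mult_1_left)
    have root_c: "(\<Sum>g<t. c x g * root R l (H g)) = root R l x" for x
      using root_sum[of l "c x" H "{..<t}"] by (simp add: c_def H.coord_sum)
    have contract: "(\<Sum>g<t. \<psi> g k * root R l (H g)) =
        (\<Sum>i\<in>UNIV. root R l (Z i) * c (b i) k - root R l (b i) * c (Z i) k) -
        (\<Sum>i\<in>UNIV. \<Sum>j\<in>UNIV. root R i (Z j) * (root R l (b i) * c (b j) k))" for k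
    proof -
      have "(\<Sum>g<t. \<psi> g k * root R l (H g)) =
          (\<Sum>g<t. \<Sum>i\<in>UNIV. c (Z i) g * root R l (H g) * c (b i) k - c (b i) g * root R l (H g) * c (Z i) k) -
          (\<Sum>g<t. \<Sum>i\<in>UNIV. \<Sum>j\<in>UNIV. root R i (Z j) * (c (b i) g * root R l (H g) * c (b j) k))"
        unfolding \<psi>_def left_diff_distrib sum_distrib_right sum_subtractf[symmetric]
        by (intro sum.cong refl arg_cong2[where f = minus]) (simp_all add: algebra_simps)
      also have "(\<Sum>g<t. \<Sum>i\<in>UNIV. c (Z i) g * root R l (H g) * c (b i) k - c (b i) g * root R l (H g) * c (Z i) k) =
          (\<Sum>i\<in>UNIV. \<Sum>g<t. c (Z i) g * root R l (H g) * c (b i) k - c (b i) g * root R l (H g) * c (Z i) k)"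
        by (rule sum.swap)
      also have "(\<Sum>g<t. \<Sum>i\<in>UNIV. \<Sum>j\<in>UNIV. root R i (Z j) * (c (b i) g * root R l (H g) * c (b j) k)) =
          (\<Sum>i\<in>UNIV. \<Sum>j\<in>UNIV. \<Sum>g<t. root R i (Z j) * (c (b i) g * root R l (H g) * c (b j) k))"
        by (subst sum.swap, intro sum.cong refl, rule sum.swap)
      finally show ?thesis
        by (simp only: sum_subtractf sum_distrib_left[symmetric] sum_distrib_right[symmetric] root_c)
    qed
    have "(\<Sum>g<t. \<psi> g k * root R l (H g)) = - c (Z l) k" for k
    proof -
      have 1: "(\<Sum>i\<in>UNIV. root R l (b i) * c (Z i) k) = c (Z l) k"
        by (simp add: b if_distrib[of "\<lambda>x. x * _"] cong: if_cong)
      \<comment> \<open>Duality collapses the double sum to the coordinates of \<Sum>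
        \<alpha>_l(Z_j) b_j, which cancel the first sum in \<open>contract\<close>; only those of
        -Z_l remain.\<close>
      have "(\<Sum>i\<in>UNIV. \<Sum>j\<in>UNIV. root R i (Z j) * (root R l (b i) * c (b j) k)) =
          (\<Sum>i\<in>UNIV. if l = i then \<Sum>j\<in>UNIV. root R i (Z j) * c (b j) k else 0)"
        by (intro sum.cong refl) (auto simp: b)
      also have "\<dots> = (\<Sum>j\<in>UNIV. root R l (Z j) * c (b j) k)"
        by simp
      finally show ?thesis
        unfolding contract sum_subtractf 1 by simp
    qed
    then have "(\<Sum>k<t. scale R (\<Sum>g<t. \<psi> g k * root R l (H g)) (H k)) = - Z l"
      using H.coord_sum[of "Z l"] by (simp add: c_def sum_negf h.scale_minus_left)
    moreover have "(\<Sum>g<t. \<Sum>k<t. scale R (\<psi> g k * root R l (H g)) (H k)) =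
        (\<Sum>k<t. scale R (\<Sum>g<t. \<psi> g k * root R l (H g)) (H k))"
      by (subst sum.swap) (simp add: h.scale_sum_left)
    ultimately show ?thesis by (simp only: half)
  qed
  ultimately show ?thesis by (rule that)
qed

text \<open>As \<open>f\<close> matches the S_i, it displaces T_i^+ and T_i^- by opposite vectors, 2
  Z_i and -2 Z_i. The matrix \<alpha>_j(Z_i) is half of P' - P, antisymmetric because both have the
  same symmetric part.\<close>

lemma toral_twist_isomorphism:
  fixes R :: "('n::finite, 'k::field_char_0, 'h::ab_group_add) realization"
    and R' :: "('n, 'k, 'h'::ab_group_add) realization"
  assumes P: "cartan_type A d P" "cartan_type A d P'"
    and R: "is_realization P R" "straight R" "is_basis (scale R) t H" and R': "is_realization P' R'"
    and f: "module_hom (scale R') (scale R) f" "\<And>x. f (f' x) = x" "\<And>z. f' (f z) = z"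
    and f_S: "\<And>i. f (S_elem R' i) = S_elem R i" and root_f: "\<And>j x. root R j (f x) = root R' j x"
  shows "\<exists>\<Phi>\<in>antisymmetric t. quantum_algebra X A d P' R' \<cong>\<^sub>H toral_twist X A d P R t H \<Phi>"
proof -
  interpret R: quea_calculus A d P R by standard (rule R(1))
  interpret R': quea_calculus A d P' R' by standard (rule R')
  interpret f: module_hom "scale R'" "scale R" f by (rule f(1))
  define Z where "Z i = scale R (fps_const (1 / 2)) (f (Tplus R' i) - Tplus R i)" for i
  have ZZ: "Z i + Z i = f (Tplus R' i) - Tplus R i" for i
    unfolding Z_def by (rule R.half_sum)
  have T_sum: "f (Tplus R' i) + f (Tminus R' i) = Tplus R i + Tminus R i" for i
  proof -
    have "f (Tplus R' i) + f (Tminus R' i) = f (scale R' 2 (S_elem R' i))"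
      by (simp only: R'.S_double f.add)
    then show ?thesis by (simp only: f.scale f_S R.S_double)
  qed
  have root_Z: "root R j (Z i) = fps_const (1 / 2) * (P' $ i $ j - P $ i $ j)" for i j
    using R.root_add[of j "f (Tplus R' i)" "- Tplus R i"]
    by (simp add: Z_def R.root_scale R.root_minus root_f R'.root_Tplus R.root_Tplus)
  have "root R j (Z i) = - root R i (Z j)" for i j
  proof -
    have "P' $ i $ j - P $ i $ j = - (P' $ j $ i - P $ j $ i)"
      using cartan_type_sum[OF P(1), of i j] cartan_type_sum[OF P(2), of i j] by (simp add: algebra_simps)
    then show ?thesis unfolding root_Z by (simp only: mult_minus_right)
  qed
  note Z = this
  obtain \<Phi> where \<Phi>: "\<Phi> \<in> antisymmetric t"
    "\<And>i. (\<Sum>g<t. \<Sum>k<t. scale R (fps_const (1 / 2) * \<Phi> g k * root R i (H g)) (H k)) = - Z i"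
    using R.exists_twist_matrix[OF R(2,3) Z] by blast
  have "quea_iso A d P R P' R' f Z (\<lambda>i. gen (Tor (Z i)))"
  proof (rule quea_iso.intro[OF R.quea_calculus_axioms R'.quea_calculus_axioms], rule quea_iso_axioms.intro)
    show "module_hom (scale R') (scale R) f" by (rule f(1))
    fix i j x
    show "root R j (f x) = root R' j x" by (rule root_f)
    show "f (Tplus R' i) = Tplus R i + (Z i + Z i)" by (simp add: ZZ)
    show "f (Tminus R' i) = Tminus R i - (Z i + Z i)"
      using T_sum[of i] unfolding ZZ by (simp add: algebra_simps)
    show "root R j (Z i) = - root R i (Z j)" by (rule Z)
    show "R.T (Z i) \<approx>[R.J] R.T (Z i)" by simp
  qed
  then interpret quea_twist_iso A d P R P' R' f Z t H \<Phi> f'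
    by (intro quea_twist_iso.intro quea_twist.intro quea_twist_axioms.intro quea_twist_iso_axioms.intro \<Phi> f)
  show ?thesis using \<Phi>(1) hopf_isomorphic_toral_twist by blast
qed

text \<open>Module and roots are kept; T_i^+ and T_i^- are moved by opposite vectors, built from
  dual vectors to produce P' - P. The S_i do not change, so their independence is inherited.\<close>

lemma change_of_realization:
  fixes R :: "('n::finite, 'k::field_char_0, 'h::ab_group_add) realization"
  assumes P: "cartan_type A d P" "cartan_type A d P'"
    and R: "is_realization P R" "straight R" "has_rank R t"
  obtains R' :: "('n, 'k, 'h) realization" where "is_realization P' R'" "straight R'" "scale R' = scale R" "root R' = root R"
    "\<And>i. S_elem R' i = S_elem R i"
proof -
  interpret R: quea_calculus A d P R by standard (rule R(1))
  obtain H where H: "is_basis (scale R) t H" using R(3) unfolding has_rank_def by blast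
  obtain b where b: "\<And>i j. root R i (b j) = (if i = j then 1 else 0)"
    by (rule R.dual_vectors[OF R(2) is_basis_frame[OF R.module_R H]], blast)
  define W where "W i = (\<Sum>j\<in>UNIV. scale R (P' $ i $ j - P $ i $ j) (b j))" for i
  have root_W: "root R j (W i) = P' $ i $ j - P $ i $ j" for i j
    by (simp add: W_def R.root_sum b if_distrib[of "\<lambda>x. _ * x"] cong: if_cong)
  let ?R' = "R\<lparr>Tplus := \<lambda>i. Tplus R i + W i, Tminus := \<lambda>i. Tminus R i - W i\<rparr>"
  have S: "S_elem ?R' i = S_elem R i" for i
    by (simp add: S_elem_def)
  have "root R j (Tminus R i - W i) = P' $ j $ i" for i j
  proof -
    have "root R j (Tminus R i - W i) = P $ j $ i - (P' $ i $ j - P $ i $ j)"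
      using R.root_add[of j "Tminus R i" "- W i"] by (simp add: R.root_minus root_W R.root_Tminus)
    also have "\<dots> = (P $ i $ j + P $ j $ i) - P' $ i $ j" by simp
    also have "\<dots> = P' $ j $ i"
      unfolding cartan_type_sum[OF P(1)] cartan_type_sum[OF P(2), symmetric] by simp
    finally show ?thesis .
  qed
  moreover have "root R j (Tplus R i + W i) = P' $ i $ j" for i j
    by (simp add: R.root_add root_W R.root_Tplus)
  ultimately have "is_realization P' ?R'"
    using R(1) unfolding is_realization_def has_rank_def S by simp
  moreover have "straight ?R'"
    using R(2) unfolding straight_def by simp
  ultimately show ?thesis using that S by simp
qed

text \<open>Replacing T_i^+ and T_i^- by S_i discards the antisymmetric part of P and leaves DA; the
  two spans in the definition of smallness become literally the same.\<close>

lemma split_realization: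
  fixes R :: "('n::finite, 'k::field_char_0, 'h::ab_group_add) realization"
  assumes P: "cartan_type A d P" and R: "is_realization P R" "straight R"
  obtains R0 :: "('n, 'k, 'h) realization" where "is_realization (DA_matrix A d) R0" "straight R0" "small R0"
    "scale R0 = scale R" "root R0 = root R" "\<And>i. S_elem R0 i = S_elem R i" "\<And>i. Tplus R0 i = Tminus R0 i"
proof -
  interpret R: quea_calculus A d P R by standard (rule R(1))
  let ?R0 = "R\<lparr>Tplus := S_elem R, Tminus := S_elem R\<rparr>"
  have S: "S_elem ?R0 i = S_elem R i" for i
    by (simp add: S_elem_def[of ?R0] R.h.scale_right_distrib R.half_sum)
  have "root R j (S_elem R i) = DA_matrix A d $ i $ j" for i j
    using R.root_S[OF P, of j i] by (simp only: DA_matrix_const)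
  moreover have "DA_matrix A d $ j $ i = (DA_matrix A d $ i $ j :: 'k fps)" for i j
    by (rule DA_matrix_symmetric[OF P])
  ultimately have "is_realization (DA_matrix A d) ?R0"
    using R(1) unfolding is_realization_def has_rank_def S by simp
  moreover have "straight ?R0"
    using R(2) unfolding straight_def by simp
  moreover have "small ?R0"
    unfolding small_def S[abs_def] by (simp add: S)
  ultimately show ?thesis using that S by simp
qed

lemma module_hom_same:
  assumes "Modules.module s" shows "module_hom s s (\<lambda>x. x)"
proof -
  interpret Modules.module s by fact
  show ?thesis by unfold_locales simp_all
qed

text \<open>The quantifier over \<open>X\<close> joins (d) to (a), (b) and (c). New realizations are
  built on the given module, whereas (b) compares two module types.\<close>

theorem theorem5p1p5:
  fixes A :: "int ^ 'n ^ 'n" and d :: "'n::finite \<Rightarrow> nat"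
    and P P' :: "'k::field_char_0 fps ^ 'n ^ 'n"
    and t :: nat
  assumes "cartan_datum A d" and "cartan_type A d P" and "cartan_type A d P'"
  shows "\<forall>X :: part.
    (\<forall>(R :: ('n, 'k, 'h::ab_group_add) realization) H.
       is_realization P R \<and> straight R \<and> is_basis (scale R) t H \<longrightarrow>
       (\<exists>(R' :: ('n, 'k, 'h) realization) \<Phi>.
          is_realization P' R' \<and> straight R' \<and> has_rank R' t \<and> \<Phi> \<in> antisymmetric t \<and>
          quantum_algebra X A d P' R' \<cong>\<^sub>H toral_twist X A d P R t H \<Phi>)) \<and>
    (\<forall>R' :: ('n, 'k, 'h) realization.
       is_realization P' R' \<and> straight R' \<and> has_rank R' t \<longrightarrow>
       (\<exists>R :: ('n, 'k, 'h) realization.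
          is_realization P R \<and> straight R \<and> has_rank R t \<and>
          (\<forall>H. is_basis (scale R) t H \<longrightarrow>
             (\<exists>\<Phi> \<in> antisymmetric t.
                quantum_algebra X A d P' R' \<cong>\<^sub>H toral_twist X A d P R t H \<Phi>)))) \<and>
    (\<forall>(R :: ('n, 'k, 'h) realization) (R' :: ('n, 'k, 'h'::ab_group_add) realization) H.
       is_realization P R \<and> straight R \<and> small R \<and> is_basis (scale R) t H \<and>
       is_realization P' R' \<and> straight R' \<and> small R' \<and> has_rank R' t \<longrightarrow>
       (\<exists>\<Phi> \<in> antisymmetric t.
          quantum_algebra X A d P' R' \<cong>\<^sub>H toral_twist X A d P R t H \<Phi>)) \<and>
    (\<forall>R :: ('n, 'k, 'h) realization.
       is_realization P R \<and> straight R \<and> small R \<and> has_rank R t \<longrightarrow>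
       (\<exists>R\<^sub>0 :: ('n, 'k, 'h) realization.
          is_realization (DA_matrix A d) R\<^sub>0 \<and> straight R\<^sub>0 \<and> small R\<^sub>0 \<and> has_rank R\<^sub>0 t \<and>
          (\<forall>i. Tplus R\<^sub>0 i = Tminus R\<^sub>0 i) \<and>
          (\<forall>H. is_basis (scale R\<^sub>0) t H \<longrightarrow>
             (\<exists>\<Phi> \<in> antisymmetric t.
                quantum_algebra X A d P R \<cong>\<^sub>H
                toral_twist X A d (DA_matrix A d) R\<^sub>0 t H \<Phi>))))"
proof (intro allI conjI impI; (elim conjE)?)
  fix X and R :: "('n, 'k, 'h) realization" and H
  assume R: "is_realization P R" "straight R" "is_basis (scale R) t H"
  have rank: "has_rank R t" using R(3) by (auto simp: has_rank_def)
  interpret R: quea_calculus A d P R by standard (rule R(1))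
  obtain R' :: "('n, 'k, 'h) realization" where R': "is_realization P' R'" "straight R'"
      "scale R' = scale R" "root R' = root R" "\<And>i. S_elem R' i = S_elem R i"
    using change_of_realization[OF assms(2,3) R(1,2) rank] by blast
  \<comment> \<open>Both realizations share module, roots and S_i, so the identity serves as
    \<open>f\<close>.\<close>
  have "\<exists>\<Phi>\<in>antisymmetric t. quantum_algebra X A d P' R' \<cong>\<^sub>H toral_twist X A d P R t H \<Phi>"
    by (rule toral_twist_isomorphism[OF assms(2,3) R R'(1), where f = "\<lambda>x. x" and f' = "\<lambda>x. x"])
      (simp_all add: R' module_hom_same R.module_R)
  moreover have "has_rank R' t" using rank by (simp add: has_rank_def R'(3))
  ultimately show "\<exists>(R' :: ('n, 'k, 'h) realization) \<Phi>.
      is_realization P' R' \<and> straight R' \<and> has_rank R' t \<and> \<Phi> \<in> antisymmetric t \<and>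
      quantum_algebra X A d P' R' \<cong>\<^sub>H toral_twist X A d P R t H \<Phi>"
    using R'(1,2) by blast
next
  fix X and R' :: "('n, 'k, 'h) realization"
  assume R': "is_realization P' R'" "straight R'" and rank: "has_rank R' t"
  interpret R': quea_calculus A d P' R' by standard (rule R'(1))
  obtain R :: "('n, 'k, 'h) realization" where R: "is_realization P R" "straight R"
      "scale R = scale R'" "root R = root R'" "\<And>i. S_elem R i = S_elem R' i"
    using change_of_realization[OF assms(3,2) R' rank] by blast
  have "\<exists>\<Phi>\<in>antisymmetric t. quantum_algebra X A d P' R' \<cong>\<^sub>H toral_twist X A d P R t H \<Phi>"
    if "is_basis (scale R) t H" for H
    by (rule toral_twist_isomorphism[OF assms(2,3) R(1,2) that R'(1), where f = "\<lambda>x. x" and f' = "\<lambda>x. x"])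
      (simp_all add: R module_hom_same R'.module_R)
  moreover have "has_rank R t" using rank by (simp add: has_rank_def R(3))
  ultimately show "\<exists>R :: ('n, 'k, 'h) realization.
      is_realization P R \<and> straight R \<and> has_rank R t \<and>
      (\<forall>H. is_basis (scale R) t H \<longrightarrow> (\<exists>\<Phi>\<in>antisymmetric t.
        quantum_algebra X A d P' R' \<cong>\<^sub>H toral_twist X A d P R t H \<Phi>))"
    using R(1,2) by blast
next
  fix X and R :: "('n, 'k, 'h) realization" and R' :: "('n, 'k, 'h') realization" and H
  assume R: "is_realization P R" "straight R" "is_basis (scale R) t H"
    and R': "is_realization P' R'" "straight R'" "has_rank R' t"
  interpret R: quea_calculus A d P R by standard (rule R(1))
  interpret R': quea_calculus A d P' R' by standard (rule R'(1))
  obtain H' where H': "is_basis (scale R') t H'" using R'(3) by (auto simp: has_rank_def)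
  \<comment> \<open>For unrelated modules the matching exists because both pairings of roots with
    S_i are d_i a_ij.\<close>
  obtain f f' where f: "module_hom (scale R') (scale R) f" "\<And>x. f (f' x) = x" "\<And>z. f' (f z) = z"
    "\<And>i. f (S_elem R' i) = S_elem R i" "\<And>j x. root R j (f x) = root R' j x"
    using realization_isomorphism[OF R(1,2) is_basis_frame[OF R.module_R R(3)]
        R'(1,2) is_basis_frame[OF R'.module_R H'] R.root_S[OF assms(2)] R'.root_S[OF assms(3)]] by blast
  show "\<exists>\<Phi>\<in>antisymmetric t. quantum_algebra X A d P' R' \<cong>\<^sub>H toral_twist X A d P R t H \<Phi>"
    by (rule toral_twist_isomorphism[OF assms(2,3) R R'(1) f])
next
  fix X and R :: "('n, 'k, 'h) realization"
  assume R: "is_realization P R" "straight R" and rank: "has_rank R t"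
  interpret R: quea_calculus A d P R by standard (rule R(1))
  obtain R0 :: "('n, 'k, 'h) realization" where R0: "is_realization (DA_matrix A d) R0" "straight R0" "small R0"
      "scale R0 = scale R" "root R0 = root R" "\<And>i. S_elem R0 i = S_elem R i" "\<And>i. Tplus R0 i = Tminus R0 i"
    using split_realization[OF assms(2) R] by blast
  \<comment> \<open>Here DA, itself of Cartan type A, takes the place of P, and P that of
    P'.\<close>
  have "\<exists>\<Phi>\<in>antisymmetric t. quantum_algebra X A d P R \<cong>\<^sub>H toral_twist X A d (DA_matrix A d) R0 t H \<Phi>"
    if "is_basis (scale R0) t H" for H
    by (rule toral_twist_isomorphism[OF cartan_type_DA[OF assms(2)] assms(2) R0(1,2) that R(1),
          where f = "\<lambda>x. x" and f' = "\<lambda>x. x"])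
      (simp_all add: R0(4-6) module_hom_same R.module_R)
  moreover have "has_rank R0 t" using rank by (simp add: has_rank_def R0(4))
  ultimately show "\<exists>R\<^sub>0 :: ('n, 'k, 'h) realization.
      is_realization (DA_matrix A d) R\<^sub>0 \<and> straight R\<^sub>0 \<and> small R\<^sub>0 \<and> has_rank R\<^sub>0 t \<and>
      (\<forall>i. Tplus R\<^sub>0 i = Tminus R\<^sub>0 i) \<and>
      (\<forall>H. is_basis (scale R\<^sub>0) t H \<longrightarrow> (\<exists>\<Phi>\<in>antisymmetric t.
        quantum_algebra X A d P R \<cong>\<^sub>H toral_twist X A d (DA_matrix A d) R\<^sub>0 t H \<Phi>))"
    using R0(1-3,7) by blast
qed

end
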